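(* Let $U(w)=\frac{w^{1-\gamma}-1}{1-\gamma}$ with $\gamma\in(0,1)$ and let $\lambda>0$ be a constant. Consider the problem of maximizing, over randomized controls $\boldsymbol\pi=\{\boldsymbol\pi_t\}_{t\in[0,T]}$, the objective functional $$\mathbb E\left[\int_0^T\lambda\,\mathcal H(\boldsymbol\pi_s)\,\mathrm ds+U(W_T^{\boldsymbol\pi})\right],$$ where $W^{\boldsymbol\pi}$ is the wealth process $$\frac{\mathrm dW_t^{\boldsymbol\pi}}{W_t^{\boldsymbol\pi}}=\left[r+(\mu(t,X_t)-r)\operatorname{Mean}(\boldsymbol\pi_t)\right]\mathrm dt+\sigma(t,X_t)\left[\operatorname{Mean}(\boldsymbol\pi_t)\,\mathrm dB_t+\sqrt{\operatorname{Var}(\boldsymbol\pi_t)}\,\mathrm d\bar B_t\right],\qquad W_0^{\boldsymbol\pi}=w_0>0.$$ Then this problem is ill-posed, with an infinite optimal value: the supremum of the objective functional over randomized controls equals $+\infty$.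
   Context: Market: $T>0$ is a fixed horizon, $r$ is a constant interest rate, and $B,\tilde B,\bar B$ are independent one-dimensional Brownian motions. The factor process $X$ satisfies $\mathrm dX_t=m(t,X_t)\,\mathrm dt+\nu(t,X_t)[\rho\,\mathrm dB_t+\sqrt{1-\rho^2}\,\mathrm d\tilde B_t]$, $X_0=x_0$, with constant $\rho\in(-1,1)$. The stock price satisfies $\mathrm dS_t/S_t=\mu(t,X_t)\,\mathrm dt+\sigma(t,X_t)\,\mathrm dB_t$. The functions $\mu,\sigma,m,\nu$ are deterministic and continuous in $(t,x)$ and such that the SDEs for $(S,X)$ admit a unique weak solution. A randomized control $\boldsymbol\pi=\{\boldsymbol\pi_t\}_{t\in[0,T]}$ is a process, adapted to the filtration generated by $(B,\bar B,\tilde B)$, with values in the probability densities on $\mathbb R$, such that the wealth equation has a (positive) solution and the objective is well defined as an extended real number. $\operatorname{Mean}(\boldsymbol\pi_t)$ and $\operatorname{Var}(\boldsymbol\pi_t)$ denote the mean and variance of the distribution $\boldsymbol\pi_t$. The differential entropy of a density $\boldsymbol\pi$ is $\mathcal H(\boldsymbol\pi)=-\int_{\mathbb R}\boldsymbol\pi(a)\log\boldsymbol\pi(a)\,\mathrm da$. *)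

theory Defs
  imports "HOL-Probability.Probability"
begin

section \<open>Processes and Brownian motions on \<open>[0, T]\<close>\<close>

text \<open>A process is a function of time and of the sample point; only times in \<open>{0..T}\<close> matter.\<close>

type_synonym 'a process = "real \<Rightarrow> 'a \<Rightarrow> real"

definition usual_conditions :: "'a measure \<Rightarrow> (real \<Rightarrow> 'a measure) \<Rightarrow> real \<Rightarrow> bool" where
  "usual_conditions M F T \<longleftrightarrow>
     filtration (space M) F \<and> complete_measure M \<and>
     (\<forall>t\<in>{0..T}. sets (F t) \<subseteq> sets M \<and> null_sets M \<subseteq> sets (F t)) \<and>
     (\<forall>t\<in>{0..<T}. sets (F t) = (\<Inter>u\<in>{t<..T}. sets (F u)))"

definition continuous_adapted ::
    "'a measure \<Rightarrow> (real \<Rightarrow> 'a measure) \<Rightarrow> real \<Rightarrow> 'a process \<Rightarrow> bool" where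
  "continuous_adapted M F T Z \<longleftrightarrow>
     (\<forall>t\<in>{0..T}. Z t \<in> borel_measurable (F t)) \<and>
     (\<forall>\<omega>\<in>space M. continuous_on {0..T} (\<lambda>t. Z t \<omega>))"

definition progressive :: "(real \<Rightarrow> 'a measure) \<Rightarrow> real \<Rightarrow> 'a process \<Rightarrow> bool" where
  "progressive F T H \<longleftrightarrow>
     (\<forall>t\<in>{0..T}. (\<lambda>(s, \<omega>). H s \<omega>) \<in> borel_measurable (restrict_space borel {0..t} \<Otimes>\<^sub>M F t))"

definition brownian_motion ::
    "'a measure \<Rightarrow> (real \<Rightarrow> 'a measure) \<Rightarrow> real \<Rightarrow> 'a process \<Rightarrow> bool" where
  "brownian_motion M F T B \<longleftrightarrow>
     continuous_adapted M F T B \<and>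
     (AE \<omega> in M. B 0 \<omega> = 0) \<and>
     (\<forall>s t. 0 \<le> s \<and> s < t \<and> t \<le> T \<longrightarrow>
        distributed M lborel (\<lambda>\<omega>. B t \<omega> - B s \<omega>) (\<lambda>x. ennreal (normal_density 0 (sqrt (t - s)) x)) \<and>
        prob_space.indep_set M (sets (F s))
          {(\<lambda>\<omega>. B t \<omega> - B s \<omega>) -` A \<inter> space M |A. A \<in> sets borel})"

text \<open>The listed processes are Brownian motions with respect to \<open>F\<close>, and they are independent as
  path-valued random variables.\<close>

definition independent_brownian_motions ::
    "'a measure \<Rightarrow> (real \<Rightarrow> 'a measure) \<Rightarrow> real \<Rightarrow> 'a process list \<Rightarrow> bool" where
  "independent_brownian_motions M F T Bs \<longleftrightarrow>
     (\<forall>B\<in>set Bs. brownian_motion M F T B) \<and>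
     prob_space.indep_vars M (\<lambda>_. PiM {0..T} (\<lambda>_. borel))
       (\<lambda>i \<omega>. restrict (\<lambda>t. (Bs ! i) t \<omega>) {0..T}) {..<length Bs}"

definition generated_filtration :: "'a measure \<Rightarrow> 'a process list \<Rightarrow> real \<Rightarrow> 'a measure" where
  "generated_filtration M Bs t =
     sigma (space M) {B s -` A \<inter> space M |B s A. B \<in> set Bs \<and> 0 \<le> s \<and> s \<le> t \<and> A \<in> sets borel}"


section \<open>The Ito integral\<close>

text \<open>A triple \<open>(n, \<tau>, \<xi>)\<close> encodes the simple process that equals \<open>\<xi> i\<close> on \<open>(\<tau> i, \<tau> (i + 1)]\<close>
  for \<open>i < n\<close> and vanishes elsewhere.\<close>

type_synonym 'a step_process = "nat \<times> (nat \<Rightarrow> real) \<times> (nat \<Rightarrow> 'a \<Rightarrow> real)"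

fun simple_process ::
    "'a measure \<Rightarrow> (real \<Rightarrow> 'a measure) \<Rightarrow> real \<Rightarrow> 'a step_process \<Rightarrow> bool" where
  "simple_process M F T (n, \<tau>, \<xi>) \<longleftrightarrow>
     0 \<le> \<tau> 0 \<and> \<tau> n \<le> T \<and> (\<forall>i<n. \<tau> i \<le> \<tau> (Suc i)) \<and>
     (\<forall>i<n. \<xi> i \<in> borel_measurable (F (\<tau> i)) \<and> bounded (\<xi> i ` space M))"

fun step_value :: "'a step_process \<Rightarrow> 'a process" where
  "step_value (n, \<tau>, \<xi>) s \<omega> = (\<Sum>i<n. \<xi> i \<omega> * indicator {\<tau> i<..\<tau> (Suc i)} s)"

fun step_integral :: "'a process \<Rightarrow> 'a step_process \<Rightarrow> 'a process" where
  "step_integral B (n, \<tau>, \<xi>) t \<omega> =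
     (\<Sum>i<n. \<xi> i \<omega> * (B (min t (\<tau> (Suc i))) \<omega> - B (min t (\<tau> i)) \<omega>))"

text \<open>\<open>I t\<close> is the Ito integral of \<open>H\<close> against \<open>B\<close> over \<open>[0, t]\<close>, for integrands that are almost
  surely square-integrable in time: some simple processes \<open>P k\<close> satisfy \<open>\<integral>\<^sub>0\<^sup>T (P k - H)\<^sup>2 ds \<rightarrow> 0\<close>
  in probability, and their elementary integrals converge to \<open>I t\<close> in probability for each \<open>t\<close>.
  As \<open>I\<close> is continuous, this determines it up to indistinguishability.\<close>

definition ito_integral ::
    "'a measure \<Rightarrow> (real \<Rightarrow> 'a measure) \<Rightarrow> real \<Rightarrow> 'a process \<Rightarrow> 'a process \<Rightarrow> 'a process \<Rightarrow> bool" where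
  "ito_integral M F T B H I \<longleftrightarrow>
     progressive F T H \<and>
     (AE \<omega> in M. (\<integral>\<^sup>+s\<in>{0..T}. ennreal ((H s \<omega>)\<^sup>2) \<partial>lborel) < \<infinity>) \<and>
     continuous_adapted M F T I \<and>
     (\<exists>P. (\<forall>k. simple_process M F T (P k)) \<and>
        (\<forall>\<epsilon>>0. (\<lambda>k. measure M {\<omega>\<in>space M.
            (\<integral>\<^sup>+s\<in>{0..T}. ennreal ((step_value (P k) s \<omega> - H s \<omega>)\<^sup>2) \<partial>lborel) > ennreal \<epsilon>})
          \<longlonglongrightarrow> 0) \<and>
        (\<forall>t\<in>{0..T}. \<forall>\<epsilon>>0. (\<lambda>k. measure M {\<omega>\<in>space M.
            \<bar>step_integral B (P k) t \<omega> - I t \<omega>\<bar> > \<epsilon>})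
          \<longlonglongrightarrow> 0))"

text \<open>\<open>ito_sde M F T z b HBs Z\<close> says \<open>dZ = b dt + (\<Sum>(H, B)\<leftarrow>HBs. H dB)\<close> on \<open>[0, T]\<close>, \<open>Z 0 = z\<close>.
  The coefficients may be built from \<open>Z\<close> itself.\<close>

definition ito_sde ::
    "'a measure \<Rightarrow> (real \<Rightarrow> 'a measure) \<Rightarrow> real \<Rightarrow> real \<Rightarrow> 'a process \<Rightarrow>
      ('a process \<times> 'a process) list \<Rightarrow> 'a process \<Rightarrow> bool" where
  "ito_sde M F T z b HBs Z \<longleftrightarrow>
     continuous_adapted M F T Z \<and>
     progressive F T b \<and> (AE \<omega> in M. set_integrable lborel {0..T} (\<lambda>s. b s \<omega>)) \<and>
     (\<exists>I. (\<forall>i<length HBs. ito_integral M F T (snd (HBs ! i)) (fst (HBs ! i)) (I i)) \<and>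
        (AE \<omega> in M. \<forall>t\<in>{0..T}.
          Z t \<omega> = z + (\<integral>s\<in>{0..t}. b s \<omega> \<partial>lborel) + (\<Sum>i<length HBs. I i t \<omega>)))"

text \<open>\<open>dZ / Z = b dt + (\<Sum>(H, B)\<leftarrow>HBs. H dB)\<close>, \<open>Z 0 = z\<close>, with a positive solution \<open>Z\<close>.\<close>

definition return_sde ::
    "'a measure \<Rightarrow> (real \<Rightarrow> 'a measure) \<Rightarrow> real \<Rightarrow> real \<Rightarrow> 'a process \<Rightarrow>
      ('a process \<times> 'a process) list \<Rightarrow> 'a process \<Rightarrow> bool" where
  "return_sde M F T z b HBs Z \<longleftrightarrow>
     (AE \<omega> in M. \<forall>t\<in>{0..T}. 0 < Z t \<omega>) \<and>
     ito_sde M F T z (\<lambda>t \<omega>. Z t \<omega> * b t \<omega>) (map (\<lambda>(H, B). (\<lambda>t \<omega>. Z t \<omega> * H t \<omega>, B)) HBs) Z"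


section \<open>The market\<close>

definition weak_solution ::
    "real \<Rightarrow> real \<Rightarrow> (real \<Rightarrow> real \<Rightarrow> real) \<Rightarrow> (real \<Rightarrow> real \<Rightarrow> real) \<Rightarrow> (real \<Rightarrow> real \<Rightarrow> real) \<Rightarrow>
      (real \<Rightarrow> real \<Rightarrow> real) \<Rightarrow> real \<Rightarrow> real \<Rightarrow> 'a measure \<Rightarrow> (real \<Rightarrow> 'a measure) \<Rightarrow>
      'a process \<Rightarrow> 'a process \<Rightarrow> 'a process \<Rightarrow> 'a process \<Rightarrow> bool" where
  "weak_solution T \<rho> \<mu> \<sigma> m \<nu> x0 s0 M F B Bt X S \<longleftrightarrow>
     prob_space M \<and> usual_conditions M F T \<and>
     independent_brownian_motions M F T [B, Bt] \<and>
     ito_sde M F T x0 (\<lambda>t \<omega>. m t (X t \<omega>))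
       [(\<lambda>t \<omega>. \<nu> t (X t \<omega>) * \<rho>, B), (\<lambda>t \<omega>. \<nu> t (X t \<omega>) * sqrt (1 - \<rho>\<^sup>2), Bt)] X \<and>
     return_sde M F T s0 (\<lambda>t \<omega>. \<mu> t (X t \<omega>)) [(\<lambda>t \<omega>. \<sigma> t (X t \<omega>), B)] S"

definition path_law ::
    "real \<Rightarrow> 'a measure \<Rightarrow> 'a process \<Rightarrow> 'a process \<Rightarrow> (real \<Rightarrow> real \<times> real) measure" where
  "path_law T M X S =
     distr M (PiM {0..T} (\<lambda>_. borel)) (\<lambda>\<omega>. restrict (\<lambda>t. (X t \<omega>, S t \<omega>)) {0..T})"

text \<open>Existence and uniqueness in law. The sample spaces are subsets of the type of quadruples of
  paths. This is no restriction: being a weak solution depends only on the joint law of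
  \<open>(B, Bt, X, S)\<close>, once \<open>F\<close> is replaced by the usual augmentation of the filtration these four
  processes generate, so every weak solution has a copy on a space of this type.\<close>

type_synonym path_space = "real \<Rightarrow> real \<times> real \<times> real \<times> real"

definition unique_weak_solution ::
    "real \<Rightarrow> real \<Rightarrow> (real \<Rightarrow> real \<Rightarrow> real) \<Rightarrow> (real \<Rightarrow> real \<Rightarrow> real) \<Rightarrow> (real \<Rightarrow> real \<Rightarrow> real) \<Rightarrow>
      (real \<Rightarrow> real \<Rightarrow> real) \<Rightarrow> real \<Rightarrow> real \<Rightarrow> bool" where
  "unique_weak_solution T \<rho> \<mu> \<sigma> m \<nu> x0 s0 \<longleftrightarrow>
     (\<exists>(M :: path_space measure) F B Bt X S. weak_solution T \<rho> \<mu> \<sigma> m \<nu> x0 s0 M F B Bt X S) \<and>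
     (\<forall>(M :: path_space measure) F B Bt X S (M' :: path_space measure) F' B' Bt' X' S'.
        weak_solution T \<rho> \<mu> \<sigma> m \<nu> x0 s0 M F B Bt X S \<and>
        weak_solution T \<rho> \<mu> \<sigma> m \<nu> x0 s0 M' F' B' Bt' X' S' \<longrightarrow>
        path_law T M X S = path_law T M' X' S')"

definition market ::
    "real \<Rightarrow> real \<Rightarrow> (real \<Rightarrow> real \<Rightarrow> real) \<Rightarrow> (real \<Rightarrow> real \<Rightarrow> real) \<Rightarrow> (real \<Rightarrow> real \<Rightarrow> real) \<Rightarrow>
      (real \<Rightarrow> real \<Rightarrow> real) \<Rightarrow> real \<Rightarrow> real \<Rightarrow> 'a measure \<Rightarrow> (real \<Rightarrow> 'a measure) \<Rightarrow>
      'a process \<Rightarrow> 'a process \<Rightarrow> 'a process \<Rightarrow> 'a process \<Rightarrow> 'a process \<Rightarrow> bool" where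
  "market T \<rho> \<mu> \<sigma> m \<nu> x0 s0 M F B Bt Bb X S \<longleftrightarrow>
     0 < T \<and> -1 < \<rho> \<and> \<rho> < 1 \<and> 0 < s0 \<and>
     (\<forall>f\<in>{\<mu>, \<sigma>, m, \<nu>}. continuous_on ({0..T} \<times> UNIV) (\<lambda>(t, x). f t x)) \<and>
     unique_weak_solution T \<rho> \<mu> \<sigma> m \<nu> x0 s0 \<and>
     weak_solution T \<rho> \<mu> \<sigma> m \<nu> x0 s0 M F B Bt X S \<and>
     independent_brownian_motions M F T [B, Bt, Bb]"


section \<open>Extended-real integrals and entropy\<close>

text \<open>\<open>e2ennreal\<close> maps negative numbers to \<open>0\<close>, so the two integrals are those of the positive and
  the negative part.\<close>

definition quasi_integrable :: "'b measure \<Rightarrow> ('b \<Rightarrow> ereal) \<Rightarrow> bool" where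
  "quasi_integrable N f \<longleftrightarrow>
     f \<in> borel_measurable N \<and>
     ((\<integral>\<^sup>+x. e2ennreal (f x) \<partial>N) \<noteq> \<infinity> \<or> (\<integral>\<^sup>+x. e2ennreal (- f x) \<partial>N) \<noteq> \<infinity>)"

definition ereal_integral :: "'b measure \<Rightarrow> ('b \<Rightarrow> ereal) \<Rightarrow> ereal" where
  "ereal_integral N f =
     enn2ereal (\<integral>\<^sup>+x. e2ennreal (f x) \<partial>N) - enn2ereal (\<integral>\<^sup>+x. e2ennreal (- f x) \<partial>N)"

definition density_measure :: "(real \<Rightarrow> real) \<Rightarrow> real measure" where
  "density_measure p = density lborel (\<lambda>a. ennreal (p a))"

definition probability_density :: "(real \<Rightarrow> real) \<Rightarrow> bool" where
  "probability_density p \<longleftrightarrow>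
     p \<in> borel_measurable borel \<and> (\<forall>a. 0 \<le> p a) \<and> prob_space (density_measure p)"

definition Mean :: "(real \<Rightarrow> real) \<Rightarrow> real" where
  "Mean p = (\<integral>a. a \<partial>density_measure p)"

definition Var :: "(real \<Rightarrow> real) \<Rightarrow> real" where
  "Var p = (\<integral>a. (a - Mean p)\<^sup>2 \<partial>density_measure p)"

text \<open>Since \<open>ln 0 = 0\<close>, the integrand vanishes where the density does.\<close>

definition entropy_integrand :: "(real \<Rightarrow> real) \<Rightarrow> real \<Rightarrow> ereal" where
  "entropy_integrand p a = ereal (- (p a * ln (p a)))"

definition differential_entropy :: "(real \<Rightarrow> real) \<Rightarrow> ereal" where
  "differential_entropy p = ereal_integral lborel (entropy_integrand p)"

definition power_utility :: "real \<Rightarrow> real \<Rightarrow> real" where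
  "power_utility \<gamma> w = (w powr (1 - \<gamma>) - 1) / (1 - \<gamma>)"


section \<open>Randomized controls and the objective\<close>

type_synonym 'a control = "real \<Rightarrow> 'a \<Rightarrow> real \<Rightarrow> real"

text \<open>The second moments must be finite for the coefficients of the wealth equation to make sense,
  because the Bochner integral of a non-integrable function is \<open>0\<close>.\<close>

definition wealth_equation ::
    "'a measure \<Rightarrow> (real \<Rightarrow> 'a measure) \<Rightarrow> real \<Rightarrow> real \<Rightarrow> (real \<Rightarrow> real \<Rightarrow> real) \<Rightarrow>
      (real \<Rightarrow> real \<Rightarrow> real) \<Rightarrow> 'a process \<Rightarrow> 'a process \<Rightarrow> 'a process \<Rightarrow> real \<Rightarrow>
      'a control \<Rightarrow> 'a process \<Rightarrow> bool" where
  "wealth_equation M F T r \<mu> \<sigma> B Bb X w0 \<pi> W \<longleftrightarrow>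
     (\<forall>t\<in>{0..T}. \<forall>\<omega>\<in>space M. integrable (density_measure (\<pi> t \<omega>)) (\<lambda>a. a\<^sup>2)) \<and>
     return_sde M F T w0 (\<lambda>t \<omega>. r + (\<mu> t (X t \<omega>) - r) * Mean (\<pi> t \<omega>))
       [(\<lambda>t \<omega>. \<sigma> t (X t \<omega>) * Mean (\<pi> t \<omega>), B),
        (\<lambda>t \<omega>. \<sigma> t (X t \<omega>) * sqrt (Var (\<pi> t \<omega>)), Bb)] W"

text \<open>The positive solution is unique up to indistinguishability (the equation is linear in \<open>W\<close>), so
  the objective below does not depend on the choice made here.\<close>

definition wealth ::
    "'a measure \<Rightarrow> (real \<Rightarrow> 'a measure) \<Rightarrow> real \<Rightarrow> real \<Rightarrow> (real \<Rightarrow> real \<Rightarrow> real) \<Rightarrow>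
      (real \<Rightarrow> real \<Rightarrow> real) \<Rightarrow> 'a process \<Rightarrow> 'a process \<Rightarrow> 'a process \<Rightarrow> real \<Rightarrow>
      'a control \<Rightarrow> 'a process" where
  "wealth M F T r \<mu> \<sigma> B Bb X w0 \<pi> = (SOME W. wealth_equation M F T r \<mu> \<sigma> B Bb X w0 \<pi> W)"

definition payoff :: "real \<Rightarrow> real \<Rightarrow> real \<Rightarrow> 'a control \<Rightarrow> 'a process \<Rightarrow> 'a \<Rightarrow> ereal" where
  "payoff T \<gamma> lam \<pi> W \<omega> =
     ereal_integral (restrict_space lborel {0..T}) (\<lambda>s. ereal lam * differential_entropy (\<pi> s \<omega>))
     + ereal (power_utility \<gamma> (W T \<omega>))"

definition well_defined_payoff ::
    "'a measure \<Rightarrow> real \<Rightarrow> real \<Rightarrow> real \<Rightarrow> 'a control \<Rightarrow> 'a process \<Rightarrow> bool" where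
  "well_defined_payoff M T \<gamma> lam \<pi> W \<longleftrightarrow>
     (\<forall>t\<in>{0..T}. \<forall>\<omega>\<in>space M. quasi_integrable lborel (entropy_integrand (\<pi> t \<omega>))) \<and>
     (AE \<omega> in M. quasi_integrable (restrict_space lborel {0..T})
        (\<lambda>s. ereal lam * differential_entropy (\<pi> s \<omega>))) \<and>
     quasi_integrable M (payoff T \<gamma> lam \<pi> W)"

definition objective ::
    "'a measure \<Rightarrow> (real \<Rightarrow> 'a measure) \<Rightarrow> real \<Rightarrow> real \<Rightarrow> (real \<Rightarrow> real \<Rightarrow> real) \<Rightarrow>
      (real \<Rightarrow> real \<Rightarrow> real) \<Rightarrow> 'a process \<Rightarrow> 'a process \<Rightarrow> 'a process \<Rightarrow> real \<Rightarrow>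
      real \<Rightarrow> real \<Rightarrow> 'a control \<Rightarrow> ereal" where
  "objective M F T r \<mu> \<sigma> B Bb X w0 \<gamma> lam \<pi> =
     ereal_integral M (payoff T \<gamma> lam \<pi> (wealth M F T r \<mu> \<sigma> B Bb X w0 \<pi>))"

text \<open>Adaptedness of the density-valued process refers to the standard \<open>\<sigma>\<close>-algebra on the probability
  measures on the real line.\<close>

definition randomized_control ::
    "'a measure \<Rightarrow> (real \<Rightarrow> 'a measure) \<Rightarrow> real \<Rightarrow> real \<Rightarrow> (real \<Rightarrow> real \<Rightarrow> real) \<Rightarrow>
      (real \<Rightarrow> real \<Rightarrow> real) \<Rightarrow> 'a process \<Rightarrow> 'a process \<Rightarrow> 'a process \<Rightarrow> 'a process \<Rightarrow> real \<Rightarrow>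
      real \<Rightarrow> real \<Rightarrow> 'a control \<Rightarrow> bool" where
  "randomized_control M F T r \<mu> \<sigma> B Bt Bb X w0 \<gamma> lam \<pi> \<longleftrightarrow>
     (\<forall>t\<in>{0..T}. \<forall>\<omega>\<in>space M. probability_density (\<pi> t \<omega>)) \<and>
     (\<forall>t\<in>{0..T}. (\<lambda>\<omega>. density_measure (\<pi> t \<omega>))
        \<in> generated_filtration M [B, Bb, Bt] t \<rightarrow>\<^sub>M prob_algebra borel) \<and>
     (\<exists>W. wealth_equation M F T r \<mu> \<sigma> B Bb X w0 \<pi> W) \<and>
     well_defined_payoff M T \<gamma> lam \<pi> (wealth M F T r \<mu> \<sigma> B Bb X w0 \<pi>)"

end

theory Submission
  imports Defs "HOL-Real_Asymp.Real_Asymp"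
begin

text \<open>Constant controls suffice: the uniform density on \<open>[-A, A]\<close> has mean \<open>0\<close> and entropy \<open>ln (2 A)\<close>, while
  the power utility is bounded below by \<open>-1 / (1 - \<gamma>)\<close>, so the objective is at least
  \<open>lam T ln (2 A) - 1 / (1 - \<gamma>)\<close>, which is unbounded in \<open>A\<close>. The work lies in showing that such a control is
  admissible, i.e. in solving \<open>dW = W (r dt + h dB)\<close> for a continuous adapted \<open>h\<close>. The solution is
  \<open>w0 exp (r t + \<integral> h dB - 1/2 \<integral> h\<^sup>2 dt)\<close>, where the exponent is the almost surely uniform limit of its versions for
  \<open>h\<close> frozen on dyadic grids and clipped at slowly growing levels. Instead of using Ito's formula, the
  error between the exponential of a frozen exponent and its Euler sum is
  computed exactly: it is a sum of orthogonal terms built from \<open>exp (k x - k\<^sup>2 d / 2) - 1 - k x\<close> with \<open>x\<close> normal of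
  variance \<open>d\<close>, whose second moment is \<open>exp (k\<^sup>2 d) - 1 - k\<^sup>2 d\<close>.\<close>

subsection \<open>Gaussian increments\<close>

text \<open>\<open>ito_integral\<close> is a predicate witnessed by bounded step integrands, so no
  stochastic integral has to be constructed: \<open>I\<close> is defined as what the equation leaves
  over, \<open>W\<close> minus \<open>w0\<close> minus the drift integral, and the content is that
  elementary integrals of suitable step processes tend to it.

  Two obstacles shape the rest. The volatility along the factor path,
  \<open>\<sigma> t (X t \<omega>)\<close>, is continuous and adapted but comes without moment
  bounds, while all estimates are second-moment ones; clipping supplies the bounds, and the events
  \<open>bad\<close>, whose probability tends to 0, take over the part usually played by stopping
  times. And the limit must have continuous adapted paths, with one null set for all times, so the
  convergence is made almost sure and uniform in time along a subsequence fast enough for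
  Borel-Cantelli; the maximal inequality passes from finite grids to \<open>[0, T]\<close> by path
  continuity.\<close>

lemma normal_density_tilt:
  assumes "0 < d"
  shows "exp (k * x - k\<^sup>2 * d / 2) * normal_density 0 (sqrt d) x = normal_density (k * d) (sqrt d) x"
proof -
  \<comment> \<open>Completing the square: the weight only moves the mean to \<open>k * d\<close>,
    so the exponential moments below reduce to plain normal ones.\<close>
  have "k * x - k\<^sup>2 * d / 2 + - x\<^sup>2 / (2 * d) = - (x - k * d)\<^sup>2 / (2 * d)"
    using assms by (simp add: field_simps power2_eq_square)
  then show ?thesis
    using assms by (simp add: normal_density_def exp_add[symmetric])
qed

lemma normal_moments:
  assumes "0 < d"
  shows "has_bochner_integral lborel (\<lambda>x. normal_density 0 (sqrt d) x * x) 0"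
    and "has_bochner_integral lborel (\<lambda>x. normal_density 0 (sqrt d) x * x\<^sup>2) d"
    and "has_bochner_integral lborel (\<lambda>x. normal_density \<mu> (sqrt d) x) 1"
  using normal_moment_nz_1[of "sqrt d" 0] normal_moment_even[of "sqrt d" 0 1]
    normal_moment_even[of "sqrt d" \<mu> 0] assms
  by (simp_all add: power2_eq_square)

text \<open>The factor by which the stochastic exponential with constant integrand \<open>k\<close>
  grows over a step of length \<open>d\<close> with Brownian increment \<open>x\<close>.\<close>

definition exp_increment :: "real \<Rightarrow> real \<Rightarrow> real \<Rightarrow> real" where
  "exp_increment d k x = exp (k * x - k\<^sup>2 * d / 2)"

lemma exp_increment_moments:
  assumes d: "0 < d"
  defines "N \<equiv> \<lambda>x. normal_density 0 (sqrt d) x"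
  shows "has_bochner_integral lborel (\<lambda>x. N x * exp_increment d k x) 1"
    and "has_bochner_integral lborel (\<lambda>x. N x * (x * exp_increment d k x)) (k * d)"
    and "has_bochner_integral lborel (\<lambda>x. N x * (exp_increment d k x)\<^sup>2) (exp (k\<^sup>2 * d))"
proof -
  have tilt: "N x * exp_increment d k x = normal_density (k * d) (sqrt d) x" for k x
    using normal_density_tilt[OF d, of k x] by (simp add: N_def exp_increment_def mult.commute)
  \<comment> \<open>Squaring doubles \<open>k\<close> and leaves the factor
    \<open>exp (k\<^sup>2 * d)\<close>, so the second moment is again a first moment.\<close>
  have sq: "(exp_increment d k x)\<^sup>2 = exp (k\<^sup>2 * d) * exp_increment d (2 * k) x" for x
    by (simp add: exp_increment_def exp_add[symmetric] power2_eq_square algebra_simps)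
  show "has_bochner_integral lborel (\<lambda>x. N x * exp_increment d k x) 1"
    using normal_moments(3)[OF d] by (simp add: tilt)
  show "has_bochner_integral lborel (\<lambda>x. N x * (x * exp_increment d k x)) (k * d)"
    using normal_moment_nz_1[of "sqrt d" "k * d"] d
    unfolding tilt[symmetric] by (simp add: ac_simps)
  show "has_bochner_integral lborel (\<lambda>x. N x * (exp_increment d k x)\<^sup>2) (exp (k\<^sup>2 * d))"
    using has_bochner_integral_mult_right[OF normal_moments(3)[OF d, of "2 * k * d"], of "exp (k\<^sup>2 * d)"]
    unfolding sq tilt[symmetric] by (simp add: ac_simps)
qed

text \<open>What one Euler step for \<open>dZ = k Z dB\<close> misses. Its mean is 0, which makes
  weighted sums of residuals orthogonal, and its variance is of order \<open>d\<^sup>2\<close>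
  rather than \<open>d\<close>.\<close>

definition exp_residual :: "real \<Rightarrow> real \<Rightarrow> real \<Rightarrow> real" where
  "exp_residual d k x = exp_increment d k x - 1 - k * x"

lemma exp_residual_moments:
  assumes d: "0 < d"
  defines "N \<equiv> \<lambda>x. normal_density 0 (sqrt d) x"
  shows "has_bochner_integral lborel (\<lambda>x. N x * exp_residual d k x) 0"
    and "has_bochner_integral lborel (\<lambda>x. N x * (exp_residual d k x)\<^sup>2) (exp (k\<^sup>2 * d) - 1 - k\<^sup>2 * d)"
proof -
  note A = exp_increment_moments[OF d, folded N_def, where k = k]
  note B = normal_moments(1,2)[OF d, folded N_def] normal_moments(3)[OF d, of 0, folded N_def]
  have "has_bochner_integral lborel (\<lambda>x. N x * exp_increment d k x - N x - k * (N x * x)) (1 - 1 - k * 0)"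
    by (intro has_bochner_integral_diff has_bochner_integral_mult_right A B)
  then show "has_bochner_integral lborel (\<lambda>x. N x * exp_residual d k x) 0"
    by (simp add: exp_residual_def algebra_simps)
  have "has_bochner_integral lborel (\<lambda>x. N x * (exp_increment d k x)\<^sup>2 - 2 * (N x * exp_increment d k x)
      - (2 * k) * (N x * (x * exp_increment d k x)) + N x + (2 * k) * (N x * x) + k\<^sup>2 * (N x * x\<^sup>2))
      (exp (k\<^sup>2 * d) - 2 * 1 - (2 * k) * (k * d) + 1 + (2 * k) * 0 + k\<^sup>2 * d)"
    by (intro has_bochner_integral_diff has_bochner_integral_add has_bochner_integral_mult_right A B)
  then show "has_bochner_integral lborel (\<lambda>x. N x * (exp_residual d k x)\<^sup>2) (exp (k\<^sup>2 * d) - 1 - k\<^sup>2 * d)"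
    by (simp add: exp_residual_def algebra_simps power2_eq_square)
qed

text \<open>Makes the variance of one residual quadratic in the step length, so that after summation
  one factor of the mesh survives. It follows from \<open>1 - y \<le> exp (- y)\<close>.\<close>

lemma exp_minus_one_minus_le:
  fixes y :: real
  assumes "0 \<le> y"
  shows "exp y - 1 - y \<le> y\<^sup>2 * exp y"
proof -
  have "1 - y \<le> exp (- y)" using exp_ge_add_one_self[of "- y"] by simp
  then have "(1 - y) * exp y \<le> 1" by (simp add: exp_minus field_simps)
  then have "exp y - 1 \<le> y * exp y" by (simp add: algebra_simps)
  moreover have "y * (exp y - 1) \<le> y * (y * exp y)"
    using assms calculation by (intro mult_left_mono) auto
  ultimately show ?thesis by (simp add: algebra_simps power2_eq_square)
qed

text \<open>The cross term is \<open>2 * a * z * m\<close>, and \<open>a * m = 0\<close> covers both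
  uses: a centred increment added to a running sum (\<open>m = 0\<close>), and a multiplicative step
  without a running sum (\<open>a = 0\<close>).\<close>

lemma nn_integral_square_affine:
  assumes N: "\<And>x. 0 \<le> N x" and N1: "has_bochner_integral lborel N 1"
    and m: "has_bochner_integral lborel (\<lambda>x. N x * p x) m"
    and v: "has_bochner_integral lborel (\<lambda>x. N x * (p x)\<^sup>2) v"
    and "a * m = 0"
  shows "(\<integral>\<^sup>+x. ennreal (N x) * ennreal ((a + z * p x)\<^sup>2) \<partial>lborel) = ennreal (a\<^sup>2 + z\<^sup>2 * v)"
proof -
  have *: "has_bochner_integral lborel (\<lambda>x. a\<^sup>2 * N x + (2 * a * z) * (N x * p x) + z\<^sup>2 * (N x * (p x)\<^sup>2))
     (a\<^sup>2 * 1 + (2 * a * z) * m + z\<^sup>2 * v)"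
    by (intro has_bochner_integral_add has_bochner_integral_mult_right assms)
  have "has_bochner_integral lborel (\<lambda>x. N x * (a + z * p x)\<^sup>2) (a\<^sup>2 + z\<^sup>2 * v)"
    using * \<open>a * m = 0\<close> by (auto simp: algebra_simps power2_eq_square)
  then show ?thesis
    using N by (simp add: ennreal_mult'[symmetric] nn_integral_eq_integral has_bochner_integral_iff)
qed

text \<open>Takes the place of conditioning on \<open>G\<close>: by independence the joint law of
  \<open>A\<close> and \<open>Y\<close> is a product, so \<open>Y\<close> can be integrated out with
  \<open>A\<close> frozen. As \<phi> has values in \<open>ennreal\<close>, Tonelli applies and no
  integrability has to be checked.\<close>

lemma (in prob_space) nn_integral_indep_increment:
  assumes sub: "sets G \<subseteq> sets M" "space G = space M"
    and D: "distributed M lborel Y (\<lambda>x. ennreal (f x))"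
    and ind: "indep_set (sets G) {Y -` A \<inter> space M |A. A \<in> sets borel}"
    and A: "A \<in> measurable G N"
    and \<phi>: "\<phi> \<in> borel_measurable (N \<Otimes>\<^sub>M borel)"
  shows "(\<integral>\<^sup>+\<omega>. \<phi> (A \<omega>, Y \<omega>) \<partial>M) = (\<integral>\<^sup>+\<omega>. (\<integral>\<^sup>+x. ennreal (f x) * \<phi> (A \<omega>, x) \<partial>lborel) \<partial>M)"
proof -
  have AM: "A \<in> measurable M N"
    using measurable_mono[OF order_refl refl sub] A by blast
  have Y: "Y \<in> borel_measurable M" and f: "(\<lambda>x. ennreal (f x)) \<in> borel_measurable lborel"
    using D by (auto simp: distributed_def)
  interpret PA: prob_space "distr M N A" using AM by (rule prob_space_distr)
  interpret PY: prob_space "distr M borel Y" using Y by (rule prob_space_distr)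
  \<comment> \<open>The two measures agree on rectangles, which is independence, and therefore
    coincide.\<close>
  have *: "distr M N A \<Otimes>\<^sub>M distr M borel Y = distr M (N \<Otimes>\<^sub>M borel) (\<lambda>x. (A x, Y x))"
  proof (rule pair_measure_eqI)
    fix C D assume "C \<in> sets (distr M N A)" "D \<in> sets (distr M borel Y)"
    then have C: "C \<in> sets N" and D: "D \<in> sets borel" by auto
    have "A -` C \<inter> space M \<in> sets G" using measurable_sets[OF A C] sub by simp
    then have "prob ((A -` C \<inter> space M) \<inter> (Y -` D \<inter> space M)) = prob (A -` C \<inter> space M) * prob (Y -` D \<inter> space M)"
      using indep_setD[OF ind] D by blast
    moreover have "(A -` C \<inter> space M) \<inter> (Y -` D \<inter> space M) = (\<lambda>x. (A x, Y x)) -` (C \<times> D) \<inter> space M"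
      by auto
    ultimately show "emeasure (distr M N A) C * emeasure (distr M borel Y) D
        = emeasure (distr M (N \<Otimes>\<^sub>M borel) (\<lambda>x. (A x, Y x))) (C \<times> D)"
      using C D AM Y by (simp add: emeasure_distr emeasure_eq_measure ennreal_mult')
  qed (auto intro: PA.sigma_finite_measure_axioms PY.sigma_finite_measure_axioms)
  have dY: "distr M borel Y = density lborel (\<lambda>x. ennreal (f x))"
  proof -
    have "distr M lborel Y = density lborel (\<lambda>x. ennreal (f x))"
      using D by (simp add: distributed_def)
    moreover have "distr M lborel Y = distr M borel Y" by (rule distr_cong) auto
    ultimately show ?thesis by simp
  qed
  have "(\<integral>\<^sup>+\<omega>. \<phi> (A \<omega>, Y \<omega>) \<partial>M) = (\<integral>\<^sup>+p. \<phi> p \<partial>distr M (N \<Otimes>\<^sub>M borel) (\<lambda>x. (A x, Y x)))"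
    using AM Y \<phi> by (subst nn_integral_distr) auto
  also have "\<dots> = (\<integral>\<^sup>+a. \<integral>\<^sup>+x. \<phi> (a, x) \<partial>distr M borel Y \<partial>distr M N A)"
    using \<phi> by (subst *[symmetric], subst PY.nn_integral_fst[symmetric]) (auto cong: measurable_cong_sets)
  also have "\<dots> = (\<integral>\<^sup>+\<omega>. (\<integral>\<^sup>+x. \<phi> (A \<omega>, x) \<partial>distr M borel Y) \<partial>M)"
    using AM \<phi> by (subst nn_integral_distr) (auto intro!: PY.borel_measurable_nn_integral_fst cong: measurable_cong_sets)
  also have "\<dots> = (\<integral>\<^sup>+\<omega>. (\<integral>\<^sup>+x. ennreal (f x) * \<phi> (A \<omega>, x) \<partial>lborel) \<partial>M)"
  proof (rule nn_integral_cong)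
    fix \<omega> assume "\<omega> \<in> space M"
    then have "A \<omega> \<in> space N" using AM by (auto dest: measurable_space)
    then have "(\<lambda>x. \<phi> (A \<omega>, x)) \<in> borel_measurable borel" using \<phi> by simp
    then show "(\<integral>\<^sup>+x. \<phi> (A \<omega>, x) \<partial>distr M borel Y) = (\<integral>\<^sup>+x. ennreal (f x) * \<phi> (A \<omega>, x) \<partial>lborel)"
      unfolding dY using f by (subst nn_integral_density) auto
  qed
  finally show ?thesis .
qed

subsection \<open>Second moments and the maximal inequality for step integrals\<close>

locale brownian_setting = prob_space M for M :: "'a measure" +
  fixes F :: "real \<Rightarrow> 'a measure" and T :: real and B :: "'a process"
  assumes usual: "usual_conditions M F T" and bm: "brownian_motion M F T B" and T_pos: "0 < T"
begin

lemma filtration_F: "filtration (space M) F"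
  using usual by (simp add: usual_conditions_def)

lemma space_F [simp]: "space (F t) = space M"
  by (rule filtration.space_F[OF filtration_F])

lemma sets_F_mono: "s \<le> t \<Longrightarrow> sets (F s) \<subseteq> sets (F t)"
  by (rule filtration.sets_F_mono[OF filtration_F])

lemma sets_F_subset: "t \<in> {0..T} \<Longrightarrow> sets (F t) \<subseteq> sets M"
  and null_sets_F: "t \<in> {0..T} \<Longrightarrow> null_sets M \<subseteq> sets (F t)"
  using usual by (simp_all add: usual_conditions_def)

lemma measurable_F_mono: "f \<in> measurable (F s) N \<Longrightarrow> s \<le> t \<Longrightarrow> f \<in> measurable (F t) N"
  using measurable_mono[OF order_refl refl sets_F_mono[of s t], of N] by auto

lemma measurable_F_M: "f \<in> measurable (F t) N \<Longrightarrow> t \<in> {0..T} \<Longrightarrow> f \<in> measurable M N"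
  using measurable_mono[OF order_refl refl sets_F_subset[of t], of N] by auto

lemma B_adapted: "t \<in> {0..T} \<Longrightarrow> B t \<in> borel_measurable (F t)"
  and B_continuous: "\<omega> \<in> space M \<Longrightarrow> continuous_on {0..T} (\<lambda>t. B t \<omega>)"
  using bm by (simp_all add: brownian_motion_def continuous_adapted_def)

text \<open>The profile \<open>p\<close> is a parameter because one computation serves three
  increments: the Brownian increment itself, the exponential factor and the residual. The data
  \<open>a\<close>, \<open>z\<close>, \<open>k\<close> are known at time \<open>s\<close>, so only
  the increment is integrated.\<close>

lemma nn_integral_square_step:
  fixes p :: "real \<Rightarrow> real \<Rightarrow> real"
  assumes st: "0 \<le> s" "s < t" "t \<le> T"
    and meas [measurable]: "a \<in> borel_measurable (F s)" "z \<in> borel_measurable (F s)" "k \<in> borel_measurable (F s)"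
      "(\<lambda>(k, x). p k x) \<in> borel_measurable (borel \<Otimes>\<^sub>M borel)"
    and m: "\<And>k. has_bochner_integral lborel (\<lambda>x. normal_density 0 (sqrt (t - s)) x * p k x) (m k)"
    and v: "\<And>k. has_bochner_integral lborel (\<lambda>x. normal_density 0 (sqrt (t - s)) x * (p k x)\<^sup>2) (v k)"
    and am: "\<And>\<omega>. a \<omega> * m (k \<omega>) = 0"
  shows "(\<integral>\<^sup>+\<omega>. ennreal ((a \<omega> + z \<omega> * p (k \<omega>) (B t \<omega> - B s \<omega>))\<^sup>2) \<partial>M)
    = (\<integral>\<^sup>+\<omega>. ennreal ((a \<omega>)\<^sup>2 + (z \<omega>)\<^sup>2 * v (k \<omega>)) \<partial>M)"
proof -
  let ?Y = "\<lambda>\<omega>. B t \<omega> - B s \<omega>" and ?A = "\<lambda>\<omega>. (a \<omega>, z \<omega>, k \<omega>)"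
  let ?\<phi> = "\<lambda>q. ennreal ((fst (fst q) + fst (snd (fst q)) * p (snd (snd (fst q))) (snd q))\<^sup>2)"
  have D: "distributed M lborel ?Y (\<lambda>x. ennreal (normal_density 0 (sqrt (t - s)) x))"
    and I: "indep_set (sets (F s)) {?Y -` A \<inter> space M |A. A \<in> sets borel}"
    using bm st unfolding brownian_motion_def by auto
  have A: "?A \<in> measurable (F s) (borel \<Otimes>\<^sub>M borel \<Otimes>\<^sub>M borel)" by measurable
  have \<phi>: "?\<phi> \<in> borel_measurable ((borel \<Otimes>\<^sub>M borel \<Otimes>\<^sub>M borel) \<Otimes>\<^sub>M borel)"
  proof -
    have "(\<lambda>q. p (snd (snd (fst q))) (snd q))
        \<in> borel_measurable ((borel \<Otimes>\<^sub>M borel \<Otimes>\<^sub>M borel) \<Otimes>\<^sub>M borel)"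
      using measurable_compose[OF _ meas(4), of "\<lambda>q. (snd (snd (fst q)), snd q)"] by simp
    then show ?thesis by measurable
  qed
  have s: "sets (F s) \<subseteq> sets M" using sets_F_subset[of s] st by simp
  have "(\<integral>\<^sup>+\<omega>. ?\<phi> (?A \<omega>, ?Y \<omega>) \<partial>M)
      = (\<integral>\<^sup>+\<omega>. (\<integral>\<^sup>+x. ennreal (normal_density 0 (sqrt (t - s)) x) * ?\<phi> (?A \<omega>, x) \<partial>lborel) \<partial>M)"
    by (rule nn_integral_indep_increment[OF s space_F D I A \<phi>])
  also have "\<dots> = (\<integral>\<^sup>+\<omega>. ennreal ((a \<omega>)\<^sup>2 + (z \<omega>)\<^sup>2 * v (k \<omega>)) \<partial>M)"
  proof (rule nn_integral_cong)
    fix \<omega>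
    have "has_bochner_integral lborel (normal_density 0 (sqrt (t - s))) 1"
      using normal_moments(3)[of "t - s" 0] st by simp
    then show "(\<integral>\<^sup>+x. ennreal (normal_density 0 (sqrt (t - s)) x) * ?\<phi> (?A \<omega>, x) \<partial>lborel)
        = ennreal ((a \<omega>)\<^sup>2 + (z \<omega>)\<^sup>2 * v (k \<omega>))"
      unfolding fst_conv snd_conv
      by (intro nn_integral_square_affine[OF normal_density_nonneg _ m v am])
  qed
  finally show ?thesis unfolding fst_conv snd_conv .
qed

lemma nn_integral_square_step_linear:
  assumes st: "0 \<le> s" "s \<le> t" "t \<le> T"
    and meas [measurable]: "a \<in> borel_measurable (F s)" "z \<in> borel_measurable (F s)"
  shows "(\<integral>\<^sup>+\<omega>. ennreal ((a \<omega> + z \<omega> * (B t \<omega> - B s \<omega>))\<^sup>2) \<partial>M)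
    = (\<integral>\<^sup>+\<omega>. ennreal ((a \<omega>)\<^sup>2 + (z \<omega>)\<^sup>2 * (t - s)) \<partial>M)"
proof (cases "s < t")
  case True
  have "(\<lambda>(k, x). x) \<in> borel_measurable (borel \<Otimes>\<^sub>M borel)" by measurable
  with True st show ?thesis
    by (intro nn_integral_square_step[where p = "\<lambda>k x. x" and k = "\<lambda>_. 0" and m = "\<lambda>_. 0"] meas
        normal_moments(1,2)) simp_all
next
  case False
  then have "t = s" using st by simp
  then show ?thesis by simp
qed

text \<open>Grids stopped at a time have repeated points beyond it, hence \<open>s = t\<close> is
  allowed, where the increment has no density; the residual is 0 there.\<close>

lemma nn_integral_square_step_residual:
  assumes st: "0 \<le> s" "s \<le> t" "t \<le> T"
    and meas [measurable]: "a \<in> borel_measurable (F s)" "z \<in> borel_measurable (F s)" "k \<in> borel_measurable (F s)"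
  shows "(\<integral>\<^sup>+\<omega>. ennreal ((a \<omega> + z \<omega> * exp_residual (t - s) (k \<omega>) (B t \<omega> - B s \<omega>))\<^sup>2) \<partial>M)
    = (\<integral>\<^sup>+\<omega>. ennreal ((a \<omega>)\<^sup>2 + (z \<omega>)\<^sup>2 * (exp ((k \<omega>)\<^sup>2 * (t - s)) - 1 - (k \<omega>)\<^sup>2 * (t - s))) \<partial>M)"
proof (cases "s = t")
  case True then show ?thesis by (simp add: exp_residual_def exp_increment_def)
next
  case False
  have "(\<lambda>(k, x). exp_residual (t - s) k x) \<in> borel_measurable (borel \<Otimes>\<^sub>M borel)"
    unfolding exp_residual_def exp_increment_def by measurable
  with False show ?thesis
    using st by (intro nn_integral_square_step[where m = "\<lambda>_. 0"] meas exp_residual_moments) simp_all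
qed

lemma nn_integral_square_step_exp:
  assumes st: "0 \<le> s" "s \<le> t" "t \<le> T"
    and meas [measurable]: "z \<in> borel_measurable (F s)" "k \<in> borel_measurable (F s)"
  shows "(\<integral>\<^sup>+\<omega>. ennreal ((z \<omega> * exp_increment (t - s) (k \<omega>) (B t \<omega> - B s \<omega>))\<^sup>2) \<partial>M)
    = (\<integral>\<^sup>+\<omega>. ennreal ((z \<omega>)\<^sup>2 * exp ((k \<omega>)\<^sup>2 * (t - s))) \<partial>M)"
proof (cases "s = t")
  case True
  then have "t = s" by simp
  then show ?thesis by (simp add: exp_increment_def)
next
  case False
  have "(\<lambda>(k, x). exp_increment (t - s) k x) \<in> borel_measurable (borel \<Otimes>\<^sub>M borel)"
    unfolding exp_increment_def by measurable
  with False have "(\<integral>\<^sup>+\<omega>. ennreal ((0 + z \<omega> * exp_increment (t - s) (k \<omega>) (B t \<omega> - B s \<omega>))\<^sup>2) \<partial>M)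
    = (\<integral>\<^sup>+\<omega>. ennreal (0\<^sup>2 + (z \<omega>)\<^sup>2 * exp ((k \<omega>)\<^sup>2 * (t - s))) \<partial>M)"
    using st by (intro nn_integral_square_step[where m = "\<lambda>_. 1"] meas exp_increment_moments) simp_all
  then show ?thesis by simp
qed

text \<open>Half of the elementary Ito isometry. Each new increment is centred and independent of
  the past, so it is orthogonal to the sum so far and adds at most \<open>\<eta>\<^sup>2\<close>
  times its length.\<close>

lemma nn_integral_square_sum_le:
  assumes \<tau>: "0 \<le> \<tau> 0" "\<And>i. i < n \<Longrightarrow> \<tau> i \<le> \<tau> (Suc i)" "\<tau> n \<le> T"
    and \<xi>: "\<And>i. i < n \<Longrightarrow> \<xi> i \<in> borel_measurable (F (\<tau> i))"
    and bd: "\<And>i \<omega>. i < n \<Longrightarrow> \<omega> \<in> space M \<Longrightarrow> \<bar>\<xi> i \<omega>\<bar> \<le> \<eta>"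
  shows "(\<integral>\<^sup>+\<omega>. ennreal ((\<Sum>i<n. \<xi> i \<omega> * (B (\<tau> (Suc i)) \<omega> - B (\<tau> i) \<omega>))\<^sup>2) \<partial>M) \<le> ennreal (\<eta>\<^sup>2 * (\<tau> n - \<tau> 0))"
proof -
  have le: "i \<le> j \<Longrightarrow> j \<le> n \<Longrightarrow> \<tau> i \<le> \<tau> j" for i j
    by (induction j rule: dec_induct) (use \<tau>(2) in \<open>auto intro: order_trans\<close>)
  have in_T: "i \<le> n \<Longrightarrow> \<tau> i \<in> {0..T}" for i using le[of 0 i] le[of i n] \<tau> by auto
  let ?S = "\<lambda>j \<omega>. \<Sum>i<j. \<xi> i \<omega> * (B (\<tau> (Suc i)) \<omega> - B (\<tau> i) \<omega>)"
  have S: "?S j \<in> borel_measurable (F (\<tau> j))" if "j \<le> n" for j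
  proof (rule borel_measurable_sum)
    fix i assume "i \<in> {..<j}"
    then have ij: "i < n" "Suc i \<le> j" "i \<le> j" using that by auto
    show "(\<lambda>\<omega>. \<xi> i \<omega> * (B (\<tau> (Suc i)) \<omega> - B (\<tau> i) \<omega>)) \<in> borel_measurable (F (\<tau> j))"
      using ij that in_T[of i] in_T[of "Suc i"] le[of i j] le[of "Suc i" j]
      by (intro borel_measurable_times borel_measurable_diff measurable_F_mono[OF \<xi>] measurable_F_mono[OF B_adapted]) auto
  qed
  have "j \<le> n \<Longrightarrow> (\<integral>\<^sup>+\<omega>. ennreal ((?S j \<omega>)\<^sup>2) \<partial>M) \<le> ennreal (\<eta>\<^sup>2 * (\<tau> j - \<tau> 0))" for j
  proof (induction j)
    case (Suc j)
    have [measurable]: "?S j \<in> borel_measurable M" "\<xi> j \<in> borel_measurable M"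
      using Suc.prems S[of j] \<xi>[of j] in_T[of j] by (auto intro: measurable_F_M)
    have d: "0 \<le> \<tau> (Suc j) - \<tau> j" using \<tau>(2)[of j] Suc.prems by simp
    have "(\<integral>\<^sup>+\<omega>. ennreal ((?S (Suc j) \<omega>)\<^sup>2) \<partial>M) = (\<integral>\<^sup>+\<omega>. ennreal ((?S j \<omega>)\<^sup>2 + (\<xi> j \<omega>)\<^sup>2 * (\<tau> (Suc j) - \<tau> j)) \<partial>M)"
      using nn_integral_square_step_linear[of "\<tau> j" "\<tau> (Suc j)" "?S j" "\<xi> j"] Suc.prems in_T[of j] in_T[of "Suc j"]
        \<tau>(2)[of j] S[of j] \<xi>[of j] by simp
    also have "\<dots> \<le> (\<integral>\<^sup>+\<omega>. ennreal ((?S j \<omega>)\<^sup>2) + ennreal (\<eta>\<^sup>2 * (\<tau> (Suc j) - \<tau> j)) \<partial>M)"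
    proof (rule nn_integral_mono)
      fix \<omega> assume "\<omega> \<in> space M"
      then have "(\<xi> j \<omega>)\<^sup>2 \<le> \<eta>\<^sup>2" using bd[of j \<omega>] Suc.prems by (intro abs_le_square_iff[THEN iffD1]) auto
      with d show "ennreal ((?S j \<omega>)\<^sup>2 + (\<xi> j \<omega>)\<^sup>2 * (\<tau> (Suc j) - \<tau> j)) \<le> ennreal ((?S j \<omega>)\<^sup>2) + ennreal (\<eta>\<^sup>2 * (\<tau> (Suc j) - \<tau> j))"
        by (subst ennreal_plus[symmetric]) (auto intro!: ennreal_leI mult_right_mono)
    qed
    also have "\<dots> = (\<integral>\<^sup>+\<omega>. ennreal ((?S j \<omega>)\<^sup>2) \<partial>M) + ennreal (\<eta>\<^sup>2 * (\<tau> (Suc j) - \<tau> j))"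
      by (subst nn_integral_add) (auto simp: emeasure_space_1)
    also have "\<dots> \<le> ennreal (\<eta>\<^sup>2 * (\<tau> j - \<tau> 0)) + ennreal (\<eta>\<^sup>2 * (\<tau> (Suc j) - \<tau> j))"
      using Suc by (intro add_right_mono) auto
    also have "\<dots> = ennreal (\<eta>\<^sup>2 * (\<tau> (Suc j) - \<tau> 0))"
      using d le[of 0 j] Suc.prems by (subst ennreal_plus[symmetric]) (auto simp: right_diff_distrib intro!: mult_left_mono)
    finally show ?case .
  qed simp
  then show ?thesis by simp
qed

text \<open>Killing the integrand where it exceeds \<open>\<eta>\<close> or after the partial sums have exceeded \<open>\<epsilon>\<close> freezes the sum on \<open>E\<close> at
  its first value beyond \<open>\<epsilon>\<close>, and bounds the second moment of the killed sum by \<open>\<eta>\<^sup>2 T\<close>; no submartingale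
  theory is needed.\<close>

lemma maximal_inequality:
  assumes \<tau>: "0 \<le> \<tau> 0" "\<And>i. i < n \<Longrightarrow> \<tau> i \<le> \<tau> (Suc i)" "\<tau> n \<le> T"
    and \<xi>: "\<And>i. i < n \<Longrightarrow> \<xi> i \<in> borel_measurable (F (\<tau> i))" and "0 \<le> \<eta>" "0 < \<epsilon>"
  defines "S \<equiv> \<lambda>j \<omega>. \<Sum>i<j. \<xi> i \<omega> * (B (\<tau> (Suc i)) \<omega> - B (\<tau> i) \<omega>)"
  defines "E \<equiv> {\<omega> \<in> space M. (\<exists>j\<le>n. \<bar>S j \<omega>\<bar> > \<epsilon>) \<and> (\<forall>i<n. \<bar>\<xi> i \<omega>\<bar> \<le> \<eta>)}"
  shows "E \<in> sets M" and "prob E \<le> \<eta>\<^sup>2 * T / \<epsilon>\<^sup>2"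
proof -
  have le: "i \<le> j \<Longrightarrow> j \<le> n \<Longrightarrow> \<tau> i \<le> \<tau> j" for i j
    by (induction j rule: dec_induct) (use \<tau>(2) in \<open>auto intro: order_trans\<close>)
  have in_T: "i \<le> n \<Longrightarrow> \<tau> i \<in> {0..T}" for i using le[of 0 i] le[of i n] \<tau> by auto
  have SF: "S j \<in> borel_measurable (F (\<tau> j))" if "j \<le> n" for j
    unfolding S_def
  proof (rule borel_measurable_sum)
    fix i assume "i \<in> {..<j}"
    then have ij: "i < n" "Suc i \<le> j" "i \<le> j" using that by auto
    show "(\<lambda>\<omega>. \<xi> i \<omega> * (B (\<tau> (Suc i)) \<omega> - B (\<tau> i) \<omega>)) \<in> borel_measurable (F (\<tau> j))"
      using ij that in_T[of i] in_T[of "Suc i"] le[of i j] le[of "Suc i" j]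
      by (intro borel_measurable_times borel_measurable_diff measurable_F_mono[OF \<xi>] measurable_F_mono[OF B_adapted]) auto
  qed
  have SM: "S j \<in> borel_measurable M" if "j \<le> n" for j
    by (rule measurable_F_M[OF SF[OF that] in_T[OF that]])
  have \<xi>M: "\<xi> j \<in> borel_measurable M" if "j < n" for j
    by (rule measurable_F_M[OF \<xi>[OF that] in_T]) (use that in simp)
  have E_eq: "E = (\<Union>j\<in>{..n}. {\<omega> \<in> space M. \<bar>S j \<omega>\<bar> > \<epsilon>}) \<inter> (space M - (\<Union>i\<in>{..<n}. {\<omega> \<in> space M. \<not> \<bar>\<xi> i \<omega>\<bar> \<le> \<eta>}))"
    unfolding E_def by fast
  have "{\<omega> \<in> space M. \<bar>S j \<omega>\<bar> > \<epsilon>} \<in> sets M" if "j \<in> {..n}" for j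
    using SM[of j] that by simp
  moreover have "{\<omega> \<in> space M. \<not> \<bar>\<xi> i \<omega>\<bar> \<le> \<eta>} \<in> sets M" if "i \<in> {..<n}" for i
    using \<xi>M[of i] that by simp
  ultimately show [measurable]: "E \<in> sets M" unfolding E_eq
    by (intro sets.Int sets.Diff sets.finite_UN sets.top finite_atMost finite_lessThan)
  \<comment> \<open>Partial sums up to index \<open>i\<close> involve increments up to time
    \<open>\<tau> i\<close> only, so the test keeps \<open>\<xi>' i\<close> adapted; and the
    increment that first carries the sum beyond \<epsilon> is still included.\<close>
  define \<xi>' where "\<xi>' i \<omega> = (if \<bar>\<xi> i \<omega>\<bar> \<le> \<eta> \<and> (\<forall>j\<in>{..i}. \<bar>S j \<omega>\<bar> \<le> \<epsilon>) then \<xi> i \<omega> else 0)" for i \<omega>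
  let ?S' = "\<lambda>\<omega>. \<Sum>i<n. \<xi>' i \<omega> * (B (\<tau> (Suc i)) \<omega> - B (\<tau> i) \<omega>)"
  have \<xi>'F: "\<xi>' i \<in> borel_measurable (F (\<tau> i))" if "i < n" for i
  proof -
    have [measurable]: "\<xi> i \<in> borel_measurable (F (\<tau> i))" using \<xi> that by simp
    have "{\<omega> \<in> space (F (\<tau> i)). \<bar>S j \<omega>\<bar> \<le> \<epsilon>} \<in> sets (F (\<tau> i))" if "j \<in> {..i}" for j
    proof -
      have [measurable]: "S j \<in> borel_measurable (F (\<tau> i))"
        by (rule measurable_F_mono[OF SF le]) (use that \<open>i < n\<close> in simp_all)
      show ?thesis by measurable
    qed
    then have 2: "{\<omega> \<in> space (F (\<tau> i)). \<forall>j\<in>{..i}. \<bar>S j \<omega>\<bar> \<le> \<epsilon>} \<in> sets (F (\<tau> i))"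
      by (rule sets.sets_Collect_finite_All) simp_all
    have 1: "{\<omega> \<in> space (F (\<tau> i)). \<bar>\<xi> i \<omega>\<bar> \<le> \<eta>} \<in> sets (F (\<tau> i))"
      by measurable
    show ?thesis unfolding \<xi>'_def
    proof (rule measurable_If)
      show "{\<omega> \<in> space (F (\<tau> i)). \<bar>\<xi> i \<omega>\<bar> \<le> \<eta> \<and> (\<forall>j\<in>{..i}. \<bar>S j \<omega>\<bar> \<le> \<epsilon>)} \<in> sets (F (\<tau> i))"
        by (rule sets.sets_Collect_conj[OF 2 1])
    qed (use \<xi> that in simp_all)
  qed
  have b: "\<bar>\<xi>' i \<omega>\<bar> \<le> \<eta>" for i \<omega> using \<open>0 \<le> \<eta>\<close> by (simp add: \<xi>'_def)
  have S'_large: "\<bar>?S' \<omega>\<bar> > \<epsilon>" if "\<omega> \<in> E" for \<omega>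
  proof -
    have ex: "\<exists>j. j \<le> n \<and> \<bar>S j \<omega>\<bar> > \<epsilon>" and small: "i < n \<Longrightarrow> \<bar>\<xi> i \<omega>\<bar> \<le> \<eta>" for i
      using that by (auto simp: E_def)
    define j where "j = (LEAST j. j \<le> n \<and> \<bar>S j \<omega>\<bar> > \<epsilon>)"
    have j: "j \<le> n" "\<bar>S j \<omega>\<bar> > \<epsilon>" using LeastI_ex[OF ex] unfolding j_def by auto
    have j_least: "i < j \<Longrightarrow> \<bar>S i \<omega>\<bar> \<le> \<epsilon>" for i
      using not_less_Least[of i "\<lambda>j. j \<le> n \<and> \<bar>S j \<omega>\<bar> > \<epsilon>"] j(1) unfolding j_def[symmetric] by auto
    have eq: "\<xi>' i \<omega> = (if i < j then \<xi> i \<omega> else 0)" if "i < n" for i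
    proof (cases "i < j")
      case True
      then have "\<forall>k\<in>{..i}. \<bar>S k \<omega>\<bar> \<le> \<epsilon>" using j_least by auto
      then show ?thesis using small[OF that] True by (simp add: \<xi>'_def)
    next
      case False
      then have "\<not> (\<forall>k\<in>{..i}. \<bar>S k \<omega>\<bar> \<le> \<epsilon>)" using j(2) by (auto simp: not_le not_less)
      then show ?thesis using False by (auto simp: \<xi>'_def)
    qed
    have "?S' \<omega> = (\<Sum>i<n. if i < j then \<xi> i \<omega> * (B (\<tau> (Suc i)) \<omega> - B (\<tau> i) \<omega>) else 0)"
      by (intro sum.cong) (auto simp: eq)
    also have "\<dots> = S j \<omega>"
      unfolding S_def using j(1) by (auto simp: sum.If_cases intro!: sum.cong)
    finally show ?thesis using j(2) by simp
  qed
  have [measurable]: "\<xi>' i \<in> borel_measurable M" "B (\<tau> (Suc i)) \<in> borel_measurable M" "B (\<tau> i) \<in> borel_measurable M" if "i < n" for i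
    using that by (intro measurable_F_M[OF \<xi>'F] measurable_F_M[OF B_adapted] in_T; simp)+
  have [measurable]: "?S' \<in> borel_measurable M" by (intro borel_measurable_sum) auto
  have "ennreal (\<epsilon>\<^sup>2) * emeasure M E \<le> (\<integral>\<^sup>+\<omega>. ennreal ((?S' \<omega>)\<^sup>2) \<partial>M)"
  proof -
    have "ennreal (\<epsilon>\<^sup>2) * emeasure M E = (\<integral>\<^sup>+\<omega>. ennreal (\<epsilon>\<^sup>2) * indicator E \<omega> \<partial>M)"
      by (simp add: nn_integral_cmult_indicator)
    also have "\<dots> \<le> (\<integral>\<^sup>+\<omega>. ennreal ((?S' \<omega>)\<^sup>2) \<partial>M)"
    proof (rule nn_integral_mono)
      fix \<omega>
      have "\<omega> \<in> E \<Longrightarrow> \<epsilon>\<^sup>2 \<le> (?S' \<omega>)\<^sup>2"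
        using S'_large[of \<omega>] \<open>0 < \<epsilon>\<close> by (intro abs_le_square_iff[THEN iffD1]) auto
      then show "ennreal (\<epsilon>\<^sup>2) * indicator E \<omega> \<le> ennreal ((?S' \<omega>)\<^sup>2)"
        by (auto simp: indicator_def intro: ennreal_leI)
    qed
    finally show ?thesis .
  qed
  also have "\<dots> \<le> ennreal (\<eta>\<^sup>2 * (\<tau> n - \<tau> 0))"
    by (rule nn_integral_square_sum_le) (use \<tau> \<xi>'F b in auto)
  also have "\<dots> \<le> ennreal (\<eta>\<^sup>2 * T)"
    using \<tau> by (intro ennreal_leI mult_left_mono) auto
  finally have "\<epsilon>\<^sup>2 * prob E \<le> \<eta>\<^sup>2 * T"
    using T_pos by (simp add: emeasure_eq_measure ennreal_mult'[symmetric])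
  then show "prob E \<le> \<eta>\<^sup>2 * T / \<epsilon>\<^sup>2"
    using \<open>0 < \<epsilon>\<close> by (simp add: field_simps)
qed

end

text \<open>Dominated convergence for indicators. The sets may be non-measurable:
  \<open>measure\<close> is 0 there, so they can be replaced by \<open>{}\<close>. This allows the
  events in \<open>ito_integral\<close> to be treated without measurability proofs.\<close>

lemma (in prob_space) prob_tendsto_zero:
  assumes "AE \<omega> in M. eventually (\<lambda>k. \<omega> \<notin> A k) sequentially"
  shows "(\<lambda>k. prob (A k)) \<longlonglongrightarrow> 0"
proof -
  define A' where "A' k = (if A k \<in> sets M then A k else {})" for k
  have A' [measurable]: "A' k \<in> sets M" for k by (simp add: A'_def)
  have "(\<lambda>k. integral\<^sup>L M (indicator (A' k) :: _ \<Rightarrow> real)) \<longlonglongrightarrow> integral\<^sup>L M (\<lambda>_. 0 :: real)"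
  proof (rule integral_dominated_convergence[where w = "\<lambda>_. 1"])
    show "AE x in M. (\<lambda>k. indicator (A' k) x :: real) \<longlonglongrightarrow> 0"
      using assms
    proof eventually_elim
      case (elim \<omega>)
      then have "eventually (\<lambda>k. indicator (A' k) \<omega> = (0 :: real)) sequentially"
        by eventually_elim (simp add: A'_def)
      then show ?case by (rule tendsto_eventually)
    qed
  qed auto
  moreover have "integral\<^sup>L M (indicator (A' k) :: _ \<Rightarrow> real) = prob (A k)" for k
    using A'[of k] by (auto simp: A'_def measure_notin_sets)
  ultimately show ?thesis by simp
qed

section \<open>Progressive measurability; second moment of the Euler error\<close>

context brownian_setting
begin

lemma continuous_adapted_imp_progressive:
  assumes Z: "continuous_adapted M F T Z"
  shows "progressive F T Z"
  unfolding progressive_def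
proof
  fix t assume t: "t \<in> {0..T}"
  \<comment> \<open>Rounds \<open>s\<close> down to the grid of mesh \<open>t / n\<close>, so only
    times up to \<open>t\<close> are sampled and \<open>F t\<close> measures them all. The cap gives
    the index a finite range; for \<open>t = 0\<close> division by 0 yields
    \<open>g n s = 0\<close>.\<close>
  define g where "g n s = real (nat (min (int n) \<lfloor>s * n / t\<rfloor>)) * t / n" for n :: nat and s :: real
  let ?R = "restrict_space borel {0..t} \<Otimes>\<^sub>M F t"
  have g_bounds: "g (Suc n) s \<in> {0..t}" "\<bar>g (Suc n) s - s\<bar> \<le> t / Suc n" if s: "s \<in> {0..t}" for n s
  proof -
    show "g (Suc n) s \<in> {0..t}"
    proof (cases "t = 0")
      case False
      then have t0: "0 < t" using t by simp
      have "real (nat (min (int (Suc n)) \<lfloor>s * Suc n / t\<rfloor>)) \<le> Suc n" by linarith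
      then have "real (nat (min (int (Suc n)) \<lfloor>s * Suc n / t\<rfloor>)) * t \<le> real (Suc n) * t"
        using t0 by (intro mult_right_mono) auto
      then show ?thesis using t0 by (simp add: g_def field_simps)
    qed (use t in \<open>simp add: g_def\<close>)
    show "\<bar>g (Suc n) s - s\<bar> \<le> t / Suc n"
    proof (cases "t = 0")
      case False
      then have t0: "0 < t" using t by simp
      define y where "y = s * Suc n / t"
      have y: "0 \<le> y" "y \<le> Suc n" using s t0 mult_right_mono[of s t "real (Suc n)"]
        by (auto simp: y_def divide_le_eq mult.commute simp del: of_nat_Suc)
      have r: "real (nat (min (int (Suc n)) \<lfloor>y\<rfloor>)) = of_int \<lfloor>y\<rfloor>" using y by (simp add: min_def) linarith
      have g: "g (Suc n) s = of_int \<lfloor>y\<rfloor> * (t / Suc n)" unfolding g_def y_def[symmetric] r by simp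
      have s_eq: "s = y * (t / Suc n)" using t0 by (simp add: y_def)
      have "\<bar>of_int \<lfloor>y\<rfloor> - y\<bar> * (t / Suc n) \<le> 1 * (t / Suc n)"
        by (rule mult_right_mono) (linarith, use t0 in simp)
      moreover have "g (Suc n) s - s = (of_int \<lfloor>y\<rfloor> - y) * (t / Suc n)"
        unfolding g by (subst s_eq) (simp only: left_diff_distrib)
      ultimately show ?thesis using t0 by (simp add: abs_mult)
    qed (use s in \<open>simp add: g_def\<close>)
  qed
  have ca: "s \<in> {0..T} \<Longrightarrow> Z s \<in> borel_measurable (F s)" for s
    using Z unfolding continuous_adapted_def by simp
  show "(\<lambda>(s, \<omega>). Z s \<omega>) \<in> borel_measurable ?R"
  proof (rule borel_measurable_LIMSEQ_real)
    fix n
    have "(\<lambda>p. Z (real i * t / Suc n) (snd p)) \<in> borel_measurable ?R" if "i \<in> {..Suc n}" for i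
    proof -
      have "real i * t / Suc n \<le> t" using that t mult_right_mono[of "real i" "real (Suc n)" t]
        by (auto simp: divide_le_eq mult.commute simp del: of_nat_Suc)
      then have "Z (real i * t / Suc n) \<in> borel_measurable (F t)"
        using t by (intro measurable_F_mono[OF ca]) auto
      then show ?thesis by simp
    qed
    moreover have "(\<lambda>p. nat (min (int (Suc n)) \<lfloor>fst p * Suc n / t\<rfloor>)) \<in> measurable ?R (count_space {..Suc n})"
    proof -
      have "(\<lambda>p. fst p) \<in> borel_measurable ?R"
        by (rule measurable_compose[OF measurable_fst]) (simp add: measurable_restrict_space1)
      then have "(\<lambda>p. nat (min (int (Suc n)) \<lfloor>fst p * Suc n / t\<rfloor>)) \<in> measurable ?R (count_space UNIV)"
        by measurable
      then show ?thesis
        by (rule measurable_count_space_extend[OF subset_UNIV, rotated]) (auto simp: Pi_iff)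
    qed
    ultimately have "(\<lambda>p. Z (real (nat (min (int (Suc n)) \<lfloor>fst p * Suc n / t\<rfloor>)) * t / Suc n) (snd p)) \<in> borel_measurable ?R"
      by (rule measurable_compose_countable'[where f = "\<lambda>i p. Z (real i * t / Suc n) (snd p)"]) auto
    then show "(\<lambda>p. Z (g (Suc n) (fst p)) (snd p)) \<in> borel_measurable ?R"
      by (simp add: g_def)
  next
    fix p assume "p \<in> space ?R"
    then have p: "fst p \<in> {0..t}" "snd p \<in> space M"
      by (auto simp: space_pair_measure space_restrict_space)
    have "(\<lambda>n. g (Suc n) (fst p)) \<longlonglongrightarrow> fst p"
    proof (rule LIM_zero_cancel, rule Lim_null_comparison)
      show "eventually (\<lambda>n. norm (g (Suc n) (fst p) - fst p) \<le> t / Suc n) sequentially"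
        using g_bounds(2)[OF p(1)] by simp
      show "(\<lambda>n. t / Suc n) \<longlonglongrightarrow> 0" by real_asymp
    qed
    moreover have "continuous_on {0..T} (\<lambda>s. Z s (snd p))"
      using Z p unfolding continuous_adapted_def by simp
    moreover have "fst p \<in> {0..T}" using p(1) t by auto
    moreover have "eventually (\<lambda>n. g (Suc n) (fst p) \<in> {0..T}) sequentially"
    proof (intro always_eventually allI)
      fix n show "g (Suc n) (fst p) \<in> {0..T}" using g_bounds(1)[OF p(1), of n] t by auto
    qed
    ultimately have "(\<lambda>n. Z (g (Suc n) (fst p)) (snd p)) \<longlonglongrightarrow> Z (fst p) (snd p)"
      by (intro continuous_on_tendsto_compose[where f = "\<lambda>s. Z s (snd p)"])
    then show "(\<lambda>n. Z (g (Suc n) (fst p)) (snd p)) \<longlonglongrightarrow> (case p of (s, \<omega>) \<Rightarrow> Z s \<omega>)"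
      by (simp add: case_prod_unfold)
  qed
qed

text \<open>Residuals are centred given the past, so the weighted terms are orthogonal. Over a step
  of length \<Delta> one term costs at most \<open>d\<^sup>2 * y\<^sup>2 * exp y\<close> times the
  second moment of \<open>Z\<close>, where \<open>y\<close> is at most
  \<open>c\<^sup>2 * \<Delta>\<close>. That moment and \<open>exp y\<close> are each at most
  \<open>exp (c\<^sup>2 * T)\<close>, whence the 2 in the exponent; of the two factors \<Delta> one
  becomes \<delta> and the other sums to at most \<open>T\<close>.\<close>

lemma nn_integral_square_residual_sum_le:
  assumes \<tau>: "0 \<le> \<tau> 0" "\<And>i. i < n \<Longrightarrow> \<tau> i \<le> \<tau> (Suc i)" "\<tau> n \<le> T"
    and k: "\<And>i. i < n \<Longrightarrow> k i \<in> borel_measurable (F (\<tau> i))"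
    and k_le: "\<And>i \<omega>. i < n \<Longrightarrow> \<omega> \<in> space M \<Longrightarrow> \<bar>k i \<omega>\<bar> \<le> c"
    and D_le: "\<And>i. i < n \<Longrightarrow> \<bar>D i\<bar> \<le> d"
    and mesh: "\<And>i. i < n \<Longrightarrow> \<tau> (Suc i) - \<tau> i \<le> \<delta>"
  defines "Z \<equiv> \<lambda>j \<omega>. exp (\<Sum>i<j. k i \<omega> * (B (\<tau> (Suc i)) \<omega> - B (\<tau> i) \<omega>) - (k i \<omega>)\<^sup>2 * (\<tau> (Suc i) - \<tau> i) / 2)"
  shows "(\<integral>\<^sup>+\<omega>. ennreal ((\<Sum>i<n. D i * Z i \<omega> * exp_residual (\<tau> (Suc i) - \<tau> i) (k i \<omega>) (B (\<tau> (Suc i)) \<omega> - B (\<tau> i) \<omega>))\<^sup>2) \<partial>M)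
    \<le> ennreal (d\<^sup>2 * c ^ 4 * exp (2 * c\<^sup>2 * T) * T * \<delta>)"
proof (cases "n = 0")
  case False
  then have \<delta>: "0 \<le> \<delta>" using mesh[of 0] \<tau>(2)[of 0] by simp
  have le: "i \<le> j \<Longrightarrow> j \<le> n \<Longrightarrow> \<tau> i \<le> \<tau> j" for i j
    by (induction j rule: dec_induct) (use \<tau>(2) in \<open>auto intro: order_trans\<close>)
  have in_T: "i \<le> n \<Longrightarrow> \<tau> i \<in> {0..T}" for i using le[of 0 i] le[of i n] \<tau> by auto
  let ?\<Delta> = "\<lambda>i. \<tau> (Suc i) - \<tau> i" and ?dB = "\<lambda>i \<omega>. B (\<tau> (Suc i)) \<omega> - B (\<tau> i) \<omega>"
  let ?N = "\<lambda>j \<omega>. \<Sum>i<j. D i * Z i \<omega> * exp_residual (?\<Delta> i) (k i \<omega>) (?dB i \<omega>)"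
  have \<Delta>: "0 \<le> ?\<Delta> i" "?\<Delta> i \<le> \<delta>" "?\<Delta> i \<le> T" if "i < n" for i
    using \<tau>(2)[OF that] mesh[OF that] in_T[of i] in_T[of "Suc i"] that by auto
  have km: "k i \<in> borel_measurable (F (\<tau> j))" if "Suc i \<le> j" "j \<le> n" for i j
    by (rule measurable_F_mono[OF k le]) (use that in simp_all)
  have dBm: "?dB i \<in> borel_measurable (F (\<tau> j))" if "Suc i \<le> j" "j \<le> n" for i j
    by (rule borel_measurable_diff; rule measurable_F_mono[OF B_adapted[OF in_T] le]) (use that in simp_all)
  have Z: "Z j \<in> borel_measurable (F (\<tau> j))" if "j \<le> n" for j
    unfolding Z_def
  proof (rule borel_measurable_exp[THEN measurable_compose[rotated]], rule borel_measurable_sum)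
    fix i assume "i \<in> {..<j}"
    then have ij: "Suc i \<le> j" "j \<le> n" using that by auto
    note [measurable] = km[OF ij] dBm[OF ij]
    show "(\<lambda>\<omega>. k i \<omega> * ?dB i \<omega> - (k i \<omega>)\<^sup>2 * ?\<Delta> i / 2) \<in> borel_measurable (F (\<tau> j))"
      by measurable
  qed
  have N: "?N j \<in> borel_measurable (F (\<tau> j))" if "j \<le> n" for j
  proof (rule borel_measurable_sum)
    fix i assume "i \<in> {..<j}"
    then have ij: "Suc i \<le> j" "j \<le> n" "i \<le> n" "\<tau> i \<le> \<tau> j" using that le[of i j] by auto
    note [measurable] = km[OF ij(1,2)] dBm[OF ij(1,2)] measurable_F_mono[OF Z[OF ij(3)] ij(4)]
    show "(\<lambda>\<omega>. D i * Z i \<omega> * exp_residual (?\<Delta> i) (k i \<omega>) (?dB i \<omega>)) \<in> borel_measurable (F (\<tau> j))"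
      unfolding exp_residual_def exp_increment_def by measurable
  qed
  have k_sq: "(k j \<omega>)\<^sup>2 \<le> c\<^sup>2" if "j < n" "\<omega> \<in> space M" for j \<omega>
    using k_le[OF that] by (intro abs_le_square_iff[THEN iffD1]) auto
  have Z2: "j \<le> n \<Longrightarrow> (\<integral>\<^sup>+\<omega>. ennreal ((Z j \<omega>)\<^sup>2) \<partial>M) \<le> ennreal (exp (c\<^sup>2 * (\<tau> j - \<tau> 0)))" for j
  proof (induction j)
    case 0 show ?case by (simp add: Z_def emeasure_space_1)
  next
    case (Suc j)
    have j: "j < n" "j \<le> n" "0 \<le> \<tau> j" "\<tau> (Suc j) \<le> T" "\<tau> j \<le> \<tau> (Suc j)" using Suc.prems in_T[of j] in_T[of "Suc j"] \<tau>(2)[of j] by auto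
    have [measurable]: "Z j \<in> borel_measurable M" using Z[OF j(2)] in_T[OF j(2)] by (rule measurable_F_M)
    have Zs: "Z (Suc j) \<omega> = Z j \<omega> * exp_increment (?\<Delta> j) (k j \<omega>) (?dB j \<omega>)" for \<omega>
      by (simp add: Z_def exp_increment_def exp_add[symmetric])
    have "(\<integral>\<^sup>+\<omega>. ennreal ((Z (Suc j) \<omega>)\<^sup>2) \<partial>M) = (\<integral>\<^sup>+\<omega>. ennreal ((Z j \<omega>)\<^sup>2 * exp ((k j \<omega>)\<^sup>2 * ?\<Delta> j)) \<partial>M)"
      unfolding Zs by (rule nn_integral_square_step_exp[OF j(3,5,4) Z[OF j(2)] k[OF j(1)]])
    also have "\<dots> \<le> (\<integral>\<^sup>+\<omega>. ennreal (exp (c\<^sup>2 * ?\<Delta> j)) * ennreal ((Z j \<omega>)\<^sup>2) \<partial>M)"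
    proof (rule nn_integral_mono)
      fix \<omega> assume "\<omega> \<in> space M"
      then have "exp ((k j \<omega>)\<^sup>2 * ?\<Delta> j) \<le> exp (c\<^sup>2 * ?\<Delta> j)"
        using k_sq[OF j(1)] \<Delta>[OF j(1)] by (simp add: mult_right_mono)
      then have "(Z j \<omega>)\<^sup>2 * exp ((k j \<omega>)\<^sup>2 * ?\<Delta> j) \<le> exp (c\<^sup>2 * ?\<Delta> j) * (Z j \<omega>)\<^sup>2"
        by (subst mult.commute) (rule mult_right_mono, simp_all)
      then show "ennreal ((Z j \<omega>)\<^sup>2 * exp ((k j \<omega>)\<^sup>2 * ?\<Delta> j)) \<le> ennreal (exp (c\<^sup>2 * ?\<Delta> j)) * ennreal ((Z j \<omega>)\<^sup>2)"
        by (simp add: ennreal_mult'[symmetric] ennreal_leI)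
    qed
    also have "\<dots> = ennreal (exp (c\<^sup>2 * ?\<Delta> j)) * (\<integral>\<^sup>+\<omega>. ennreal ((Z j \<omega>)\<^sup>2) \<partial>M)"
      by (rule nn_integral_cmult) measurable
    also have "\<dots> \<le> ennreal (exp (c\<^sup>2 * ?\<Delta> j)) * ennreal (exp (c\<^sup>2 * (\<tau> j - \<tau> 0)))"
      using Suc.IH[OF j(2)] by (rule mult_left_mono) simp
    also have "\<dots> = ennreal (exp (c\<^sup>2 * (\<tau> (Suc j) - \<tau> 0)))"
      by (simp add: ennreal_mult'[symmetric] exp_add[symmetric] algebra_simps)
    finally show ?case .
  qed
  define K where "K = d\<^sup>2 * c ^ 4 * exp (2 * c\<^sup>2 * T) * \<delta>"
  have K0: "0 \<le> K" using \<delta> by (simp add: K_def)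
  have "j \<le> n \<Longrightarrow> (\<integral>\<^sup>+\<omega>. ennreal ((?N j \<omega>)\<^sup>2) \<partial>M) \<le> ennreal (K * (\<tau> j - \<tau> 0))" for j
  proof (induction j)
    case (Suc j)
    have j: "j < n" "j \<le> n" "0 \<le> \<tau> j" "\<tau> (Suc j) \<le> T" "\<tau> j \<le> \<tau> (Suc j)" using Suc.prems in_T[of j] in_T[of "Suc j"] \<tau>(2)[of j] by auto
    note \<Delta>j = \<Delta>[OF j(1)]
    have [measurable]: "Z j \<in> borel_measurable M" "?N j \<in> borel_measurable M"
      by (rule measurable_F_M[OF Z[OF j(2)] in_T[OF j(2)]] measurable_F_M[OF N[OF j(2)] in_T[OF j(2)]])+
    define C where "C = d\<^sup>2 * c ^ 4 * exp (c\<^sup>2 * T) * \<delta> * ?\<Delta> j"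
    have C0: "0 \<le> C" using \<delta> \<Delta>j by (simp add: C_def)
    have "(\<integral>\<^sup>+\<omega>. ennreal ((?N (Suc j) \<omega>)\<^sup>2) \<partial>M) =
        (\<integral>\<^sup>+\<omega>. ennreal ((?N j \<omega> + (D j * Z j \<omega>) * exp_residual (?\<Delta> j) (k j \<omega>) (?dB j \<omega>))\<^sup>2) \<partial>M)"
      by simp
    also have "\<dots> = (\<integral>\<^sup>+\<omega>. ennreal ((?N j \<omega>)\<^sup>2 + (D j * Z j \<omega>)\<^sup>2 * (exp ((k j \<omega>)\<^sup>2 * ?\<Delta> j) - 1 - (k j \<omega>)\<^sup>2 * ?\<Delta> j)) \<partial>M)"
      by (rule nn_integral_square_step_residual[OF j(3,5,4) N[OF j(2)] _ k[OF j(1)]])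
        (intro borel_measurable_times borel_measurable_const Z[OF j(2)])
    also have "\<dots> \<le> (\<integral>\<^sup>+\<omega>. ennreal ((?N j \<omega>)\<^sup>2) + ennreal C * ennreal ((Z j \<omega>)\<^sup>2) \<partial>M)"
    proof (rule nn_integral_mono)
      fix \<omega> assume \<omega>: "\<omega> \<in> space M"
      define y where "y = (k j \<omega>)\<^sup>2 * ?\<Delta> j"
      have y: "0 \<le> y" "y \<le> c\<^sup>2 * ?\<Delta> j" "y \<le> c\<^sup>2 * T"
        using k_sq[OF j(1) \<omega>] \<Delta>j by (auto simp: y_def intro: mult_right_mono mult_mono)
      have y2: "y\<^sup>2 \<le> c ^ 4 * (\<delta> * ?\<Delta> j)"
      proof -
        have "y\<^sup>2 \<le> (c\<^sup>2 * ?\<Delta> j)\<^sup>2" using y by (intro power_mono) auto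
        also have "\<dots> = c ^ 4 * (?\<Delta> j * ?\<Delta> j)" by (simp add: power2_eq_square power4_eq_xxxx algebra_simps)
        also have "\<dots> \<le> c ^ 4 * (\<delta> * ?\<Delta> j)" using \<Delta>j by (intro mult_left_mono mult_right_mono) auto
        finally show ?thesis .
      qed
      have "exp y - 1 - y \<le> y\<^sup>2 * exp y" using y by (intro exp_minus_one_minus_le)
      also have "\<dots> \<le> (c ^ 4 * (\<delta> * ?\<Delta> j)) * exp (c\<^sup>2 * T)"
        using y y2 \<delta> \<Delta>j by (intro mult_mono) auto
      finally have v: "exp y - 1 - y \<le> c ^ 4 * (\<delta> * ?\<Delta> j) * exp (c\<^sup>2 * T)" .
      have "(D j * Z j \<omega>)\<^sup>2 * (exp y - 1 - y) \<le> (d\<^sup>2 * (Z j \<omega>)\<^sup>2) * (c ^ 4 * (\<delta> * ?\<Delta> j) * exp (c\<^sup>2 * T))"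
      proof (rule mult_mono)
        have "(D j)\<^sup>2 \<le> d\<^sup>2" using D_le[OF j(1)] by (intro abs_le_square_iff[THEN iffD1]) auto
        then show "(D j * Z j \<omega>)\<^sup>2 \<le> d\<^sup>2 * (Z j \<omega>)\<^sup>2" by (simp add: power_mult_distrib mult_right_mono)
        show "0 \<le> exp y - 1 - y" using exp_ge_add_one_self[of y] by linarith
      qed (use v in auto)
      also have "\<dots> = C * (Z j \<omega>)\<^sup>2" by (simp add: C_def)
      finally have "(D j * Z j \<omega>)\<^sup>2 * (exp y - 1 - y) \<le> C * (Z j \<omega>)\<^sup>2" .
      then have "ennreal ((?N j \<omega>)\<^sup>2 + (D j * Z j \<omega>)\<^sup>2 * (exp y - 1 - y)) \<le> ennreal ((?N j \<omega>)\<^sup>2 + C * (Z j \<omega>)\<^sup>2)"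
        by (intro ennreal_leI) simp
      also have "\<dots> = ennreal ((?N j \<omega>)\<^sup>2) + ennreal C * ennreal ((Z j \<omega>)\<^sup>2)"
        using C0 by (simp add: ennreal_mult'[symmetric])
      finally show "ennreal ((?N j \<omega>)\<^sup>2 + (D j * Z j \<omega>)\<^sup>2 * (exp ((k j \<omega>)\<^sup>2 * ?\<Delta> j) - 1 - (k j \<omega>)\<^sup>2 * ?\<Delta> j))
          \<le> ennreal ((?N j \<omega>)\<^sup>2) + ennreal C * ennreal ((Z j \<omega>)\<^sup>2)" by (simp add: y_def)
    qed
    also have "\<dots> = (\<integral>\<^sup>+\<omega>. ennreal ((?N j \<omega>)\<^sup>2) \<partial>M) + ennreal C * (\<integral>\<^sup>+\<omega>. ennreal ((Z j \<omega>)\<^sup>2) \<partial>M)"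
      by (subst nn_integral_add) (measurable, simp add: nn_integral_cmult)
    also have "\<dots> \<le> ennreal (K * (\<tau> j - \<tau> 0)) + ennreal C * ennreal (exp (c\<^sup>2 * T))"
    proof (intro add_mono mult_left_mono Suc.IH j)
      have "c\<^sup>2 * (\<tau> j - \<tau> 0) \<le> c\<^sup>2 * T" using \<tau>(1) in_T[OF j(2)] by (intro mult_left_mono) auto
      then show "(\<integral>\<^sup>+\<omega>. ennreal ((Z j \<omega>)\<^sup>2) \<partial>M) \<le> ennreal (exp (c\<^sup>2 * T))"
        using Z2[OF j(2)] by (elim order_trans) (simp add: ennreal_leI)
    qed simp
    also have "\<dots> = ennreal (K * (\<tau> j - \<tau> 0) + C * exp (c\<^sup>2 * T))"
      using K0 C0 le[of 0 j] j by (simp add: ennreal_mult'[symmetric])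
    also have "C * exp (c\<^sup>2 * T) = K * ?\<Delta> j"
    proof -
      have "exp (2 * c\<^sup>2 * T) = exp (c\<^sup>2 * T) * exp (c\<^sup>2 * T)" by (simp add: exp_add[symmetric])
      then show ?thesis by (simp add: C_def K_def)
    qed
    also have "K * (\<tau> j - \<tau> 0) + K * ?\<Delta> j = K * (\<tau> (Suc j) - \<tau> 0)"
      by (simp add: distrib_left[symmetric])
    finally show ?case .
  qed simp
  from this[of n] have "(\<integral>\<^sup>+\<omega>. ennreal ((?N n \<omega>)\<^sup>2) \<partial>M) \<le> ennreal (K * (\<tau> n - \<tau> 0))" by simp
  also have "\<dots> \<le> ennreal (K * T)" using K0 \<tau> by (intro ennreal_leI mult_left_mono) auto
  finally show ?thesis by (simp add: K_def mult.commute mult.left_commute)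
qed simp

end

subsection \<open>Integrands frozen on dyadic grids\<close>

text \<open>On a block of \<open>q\<close> fine cells the coarse coefficient is constant and the
  increments telescope. This puts integrands of two levels on one grid, where they can be
  subtracted.\<close>

lemma sum_refine:
  fixes \<xi> f :: "nat \<Rightarrow> real"
  assumes "0 < q"
  shows "(\<Sum>j<n * q. \<xi> (j div q) * (f (Suc j) - f j)) = (\<Sum>i<n. \<xi> i * (f (Suc i * q) - f (i * q)))"
proof -
  have "(\<Sum>j<n * q. \<xi> (j div q) * (f (Suc j) - f j))
      = (\<Sum>i<n. \<Sum>j\<in>{i * q..<i * q + q}. \<xi> (j div q) * (f (Suc j) - f j))"
    by (rule sum.nat_group[symmetric])
  also have "\<dots> = (\<Sum>i<n. \<xi> i * (f (Suc i * q) - f (i * q)))"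
  proof (rule sum.cong[OF refl])
    fix i
    have "(\<Sum>j\<in>{i * q..<i * q + q}. \<xi> (j div q) * (f (Suc j) - f j)) = (\<Sum>j\<in>{i * q..<i * q + q}. \<xi> i * (f (Suc j) - f j))"
    proof (rule sum.cong[OF refl])
      fix j assume "j \<in> {i * q..<i * q + q}"
      then have "j div q = i" by (intro div_nat_eqI) (auto simp: mult.commute)
      then show "\<xi> (j div q) * (f (Suc j) - f j) = \<xi> i * (f (Suc j) - f j)" by simp
    qed
    also have "\<dots> = \<xi> i * (f (i * q + q) - f (i * q))"
      by (simp add: sum_distrib_left[symmetric] sum_Suc_diff')
    finally show "(\<Sum>j\<in>{i * q..<i * q + q}. \<xi> (j div q) * (f (Suc j) - f j)) = \<xi> i * (f (Suc i * q) - f (i * q))"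
      by (simp add: add.commute)
  qed
  finally show ?thesis .
qed

text \<open>From index \<open>j\<close> on, both stopped points are \<open>\<tau> j\<close> and the
  increment is 0; the summands before \<open>j\<close> are unaffected by stopping.\<close>

lemma sum_stopped:
  fixes \<xi> :: "nat \<Rightarrow> real" and b :: "'b \<Rightarrow> real"
  assumes "j \<le> n" and u: "\<And>i. u i = \<tau> (min i j)"
  shows "(\<Sum>i<n. \<xi> i * (b (u (Suc i)) - b (u i))) = (\<Sum>i<j. \<xi> i * (b (\<tau> (Suc i)) - b (\<tau> i)))"
proof -
  have "(\<Sum>i<j. \<xi> i * (b (\<tau> (Suc i)) - b (\<tau> i))) = (\<Sum>i<j. \<xi> i * (b (u (Suc i)) - b (u i)))"
    by (rule sum.cong) (auto simp: u min_def)
  also have "\<dots> = (\<Sum>i<n. \<xi> i * (b (u (Suc i)) - b (u i)))"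
    using \<open>j \<le> n\<close> by (intro sum.mono_neutral_left) (auto simp: u min_def)
  finally show ?thesis by simp
qed

definition clip :: "real \<Rightarrow> real \<Rightarrow> real" where
  "clip c x = max (- c) (min c x)"

lemma abs_clip_le: "0 \<le> c \<Longrightarrow> \<bar>clip c x\<bar> \<le> c"
  and clip_eq: "\<bar>x\<bar> \<le> c \<Longrightarrow> clip c x = x"
  by (auto simp: clip_def)

lemma borel_measurable_clip [measurable]: "clip c \<in> borel_measurable borel"
  unfolding clip_def by measurable

lemma uniform_limit_telescoping:
  fixes f :: "nat \<Rightarrow> 'b \<Rightarrow> real"
  assumes "eventually (\<lambda>n. \<forall>x\<in>A. \<bar>f (Suc n) x - f n x\<bar> \<le> a n) sequentially" "summable a"
  shows "\<exists>g. uniform_limit A f g sequentially"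
proof -
  have "uniform_limit A (\<lambda>n x. \<Sum>i<n. f (Suc i) x - f i x) (\<lambda>x. suminf (\<lambda>i. f (Suc i) x - f i x)) sequentially"
    by (rule Weierstrass_m_test_ev) (use assms in simp_all)
  then have "uniform_limit A (\<lambda>n x. f 0 x + (\<Sum>i<n. f (Suc i) x - f i x)) (\<lambda>x. f 0 x + suminf (\<lambda>i. f (Suc i) x - f i x)) sequentially"
    by (intro uniform_limit_add uniform_limit_const)
  moreover have "(\<lambda>n x. f 0 x + (\<Sum>i<n. f (Suc i) x - f i x)) = f"
    by (intro ext) (simp add: sum_lessThan_telescope[of "\<lambda>i. f i _"])
  ultimately show ?thesis by auto
qed

locale brownian_integrand = brownian_setting M F T B for M :: "'a measure" and F T B +
  fixes h :: "'a process"
  assumes h: "continuous_adapted M F T h"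
begin

definition grid :: "nat \<Rightarrow> nat \<Rightarrow> real" where
  "grid m i = T * real i / 2 ^ m"

text \<open>Chosen so that \<open>exp (2 (lev m)\<^sup>2 T) = (m + 1)\<^sup>2\<close>, the growth of the second moments of the approximate
  solutions, is beaten by the mesh \<open>T / 2 ^ m\<close>.\<close>

definition lev :: "nat \<Rightarrow> real" where
  "lev m = sqrt (ln (real m + 1) / T)"

definition hs :: "nat \<Rightarrow> nat \<Rightarrow> 'a \<Rightarrow> real" where
  "hs m i \<omega> = clip (lev m) (h (grid m i) \<omega>)"

definition J :: "nat \<Rightarrow> 'a process" where
  "J m t \<omega> = (\<Sum>i<2 ^ m. hs m i \<omega> * (B (min t (grid m (Suc i))) \<omega> - B (min t (grid m i)) \<omega>))"

definition Q :: "nat \<Rightarrow> 'a process" where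
  "Q m t \<omega> = (\<Sum>i<2 ^ m. (hs m i \<omega>)\<^sup>2 * (min t (grid m (Suc i)) - min t (grid m i)))"

definition L :: "nat \<Rightarrow> 'a process" where
  "L m t \<omega> = J m t \<omega> - Q m t \<omega> / 2"

text \<open>Sampling paths on a countable set keeps \<open>bad\<close> measurable, and the set
  contains the points of all grids at once, so that one event serves all finer levels.\<close>

definition dyadics :: "real set" where
  "dyadics = (\<Union>m. grid m ` {..2 ^ m})"

text \<open>Off this set, clipping at level \<open>lev m\<close> is inactive and freezing \<open>h\<close> on a mesh of size \<open>T / 2 ^ m\<close> changes \<open>h\<close>
  and \<open>h\<^sup>2\<close> by at most \<open>\<eta>\<close>.\<close>

definition bad :: "nat \<Rightarrow> real \<Rightarrow> 'a set" where
  "bad m \<eta> = {\<omega> \<in> space M. \<exists>s\<in>dyadics. \<exists>t\<in>dyadics. \<bar>s - t\<bar> \<le> T / 2 ^ m \<and>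
       (\<bar>h s \<omega> - h t \<omega>\<bar> > \<eta> \<or> \<bar>(h s \<omega>)\<^sup>2 - (h t \<omega>)\<^sup>2\<bar> > \<eta>)}
     \<union> {\<omega> \<in> space M. \<exists>s\<in>dyadics. \<bar>h s \<omega>\<bar> > lev m}"

lemma h_adapted: "t \<in> {0..T} \<Longrightarrow> h t \<in> borel_measurable (F t)"
  and h_continuous: "\<omega> \<in> space M \<Longrightarrow> continuous_on {0..T} (\<lambda>t. h t \<omega>)"
  using h by (simp_all add: continuous_adapted_def)

lemma grid_0 [simp]: "grid m 0 = 0" by (simp add: grid_def)

lemma grid_top [simp]: "grid m (2 ^ m) = T" by (simp add: grid_def)

lemma grid_mono: "i \<le> j \<Longrightarrow> grid m i \<le> grid m j"
  using T_pos by (simp add: grid_def divide_right_mono mult_left_mono)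

lemma grid_Suc: "grid m (Suc i) - grid m i = T / 2 ^ m"
  by (simp add: grid_def diff_divide_distrib[symmetric] algebra_simps)

lemma grid_in: "i \<le> 2 ^ m \<Longrightarrow> grid m i \<in> {0..T}"
  using grid_mono[of 0 i m] grid_mono[of i "2 ^ m" m] by simp

lemma min_grid_in: "t \<in> {0..T} \<Longrightarrow> min t (grid m i) \<in> {0..T}"
  using grid_mono[of 0 i m] by auto

lemma grid_refine: "k \<le> l \<Longrightarrow> grid l (i * 2 ^ (l - k)) = grid k i"
  by (auto simp: grid_def power_add le_iff_add)

lemma grid_div: "k \<le> l \<Longrightarrow> \<bar>grid k (j div 2 ^ (l - k)) - grid l j\<bar> \<le> T / 2 ^ k"
proof -
  assume kl: "k \<le> l"
  define q :: nat where "q = 2 ^ (l - k)"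
  have "j div q * q \<le> j" "j \<le> Suc (j div q) * q"
    using div_times_less_eq_dividend[of j q] dividend_less_div_times[of q j] by (simp_all add: q_def)
  then have "grid l (j div q * q) \<le> grid l j" "grid l j \<le> grid l (Suc (j div q) * q)"
    by (auto intro: grid_mono)
  then show ?thesis
    using grid_Suc[of k "j div q"] unfolding q_def grid_refine[OF kl] by linarith
qed

lemma lev_nonneg: "0 \<le> lev m" using T_pos by (simp add: lev_def)

lemma lev_mono: "k \<le> l \<Longrightarrow> lev k \<le> lev l"
  using T_pos by (simp add: lev_def divide_right_mono)

lemma lev_tendsto: "filterlim lev at_top sequentially"
  unfolding lev_def using T_pos by real_asymp

lemma hs_le: "\<bar>hs m i \<omega>\<bar> \<le> lev m"
  by (simp add: hs_def abs_clip_le lev_nonneg)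

lemma hs_adapted: "i \<le> 2 ^ m \<Longrightarrow> hs m i \<in> borel_measurable (F (grid m i))"
  unfolding hs_def by (rule measurable_compose[OF h_adapted[OF grid_in]]) simp_all

lemma dyadics_subset: "dyadics \<subseteq> {0..T}"
  unfolding dyadics_def using grid_in by auto

lemma grid_dyadic: "i \<le> 2 ^ m \<Longrightarrow> grid m i \<in> dyadics"
  unfolding dyadics_def by auto

lemma countable_dyadics: "countable dyadics"
  unfolding dyadics_def by auto

lemma bad_sets: "bad m \<eta> \<in> sets M"
proof -
  have m: "h s \<in> borel_measurable M" if "s \<in> dyadics" for s
    using that dyadics_subset by (intro measurable_F_M[OF h_adapted]) auto
  have 1: "{\<omega> \<in> space M. \<bar>s - t\<bar> \<le> T / 2 ^ m \<and> (\<bar>h s \<omega> - h t \<omega>\<bar> > \<eta> \<or> \<bar>(h s \<omega>)\<^sup>2 - (h t \<omega>)\<^sup>2\<bar> > \<eta>)} \<in> sets M"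
    if "s \<in> dyadics" "t \<in> dyadics" for s t
  proof -
    note [measurable] = m[OF that(1)] m[OF that(2)]
    show ?thesis by measurable
  qed
  have 2: "{\<omega> \<in> space M. \<bar>h s \<omega>\<bar> > lev m} \<in> sets M" if "s \<in> dyadics" for s
  proof -
    note [measurable] = m[OF that(1)]
    show ?thesis by measurable
  qed
  have "bad m \<eta> = (\<Union>s\<in>dyadics. \<Union>t\<in>dyadics. {\<omega> \<in> space M. \<bar>s - t\<bar> \<le> T / 2 ^ m \<and> (\<bar>h s \<omega> - h t \<omega>\<bar> > \<eta> \<or> \<bar>(h s \<omega>)\<^sup>2 - (h t \<omega>)\<^sup>2\<bar> > \<eta>)})
      \<union> (\<Union>s\<in>dyadics. {\<omega> \<in> space M. \<bar>h s \<omega>\<bar> > lev m})"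
    unfolding bad_def by fast
  also have "\<dots> \<in> sets M"
    by (intro sets.Un sets.countable_UN'[OF countable_dyadics] image_subsetI 1 2)
  finally show ?thesis .
qed

text \<open>Purely pathwise: a continuous path on a compact interval is bounded and, like its
  square, uniformly continuous, whereas the mesh tends to 0 and the clipping level to
  infinity.\<close>

lemma eventually_not_bad:
  assumes "\<omega> \<in> space M" "0 < \<eta>"
  shows "eventually (\<lambda>m. \<omega> \<notin> bad m \<eta>) sequentially"
proof -
  have u: "uniformly_continuous_on {0..T} (\<lambda>t. h t \<omega>)" "uniformly_continuous_on {0..T} (\<lambda>t. (h t \<omega>)\<^sup>2)"
    using h_continuous[OF assms(1)] by (auto intro!: compact_uniformly_continuous continuous_intros)
  obtain d1 where d1: "d1 > 0" "\<And>s t. s \<in> {0..T} \<Longrightarrow> t \<in> {0..T} \<Longrightarrow> dist t s < d1 \<Longrightarrow> dist (h t \<omega>) (h s \<omega>) < \<eta>"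
    using u(1) \<open>0 < \<eta>\<close> unfolding uniformly_continuous_on_def by meson
  obtain d2 where d2: "d2 > 0" "\<And>s t. s \<in> {0..T} \<Longrightarrow> t \<in> {0..T} \<Longrightarrow> dist t s < d2 \<Longrightarrow> dist ((h t \<omega>)\<^sup>2) ((h s \<omega>)\<^sup>2) < \<eta>"
    using u(2) \<open>0 < \<eta>\<close> unfolding uniformly_continuous_on_def by meson
  have "compact ((\<lambda>t. h t \<omega>) ` {0..T})"
    using h_continuous[OF assms(1)] by (intro compact_continuous_image) auto
  then have "bounded ((\<lambda>t. h t \<omega>) ` {0..T})" by (rule compact_imp_bounded)
  then obtain C where C: "\<And>t. t \<in> {0..T} \<Longrightarrow> \<bar>h t \<omega>\<bar> \<le> C"
    unfolding bounded_real by blast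
  have "(\<lambda>m. T / 2 ^ m) \<longlonglongrightarrow> 0" by real_asymp
  then have "eventually (\<lambda>m. T / 2 ^ m < min d1 d2) sequentially"
    using d1(1) d2(1) by (intro order_tendstoD) auto
  moreover have "eventually (\<lambda>m. C \<le> lev m) sequentially"
    using lev_tendsto by (simp add: filterlim_at_top)
  ultimately show ?thesis
  proof eventually_elim
    case (elim m)
    have "\<not> \<bar>h s \<omega> - h t \<omega>\<bar> > \<eta> \<and> \<not> \<bar>(h s \<omega>)\<^sup>2 - (h t \<omega>)\<^sup>2\<bar> > \<eta>"
      if "s \<in> dyadics" "t \<in> dyadics" "\<bar>s - t\<bar> \<le> T / 2 ^ m" for s t
    proof -
      have st: "s \<in> {0..T}" "t \<in> {0..T}" using that dyadics_subset by auto
      have "dist s t < d1" "dist s t < d2" using that(3) elim(1) by (simp_all add: dist_real_def)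
      from d1(2)[OF st(2,1) this(1)] d2(2)[OF st(2,1) this(2)] show ?thesis
        by (simp add: dist_real_def)
    qed
    moreover have "\<not> \<bar>h s \<omega>\<bar> > lev m" if "s \<in> dyadics" for s
    proof -
      have "s \<in> {0..T}" using that dyadics_subset by auto
      then show ?thesis using C[of s] elim(2) by simp
    qed
    ultimately show ?case unfolding bad_def by blast
  qed
qed

lemma prob_bad_tendsto: "0 < \<eta> \<Longrightarrow> (\<lambda>m. prob (bad m \<eta>)) \<longlonglongrightarrow> 0"
  by (intro prob_tendsto_zero AE_I2 eventually_not_bad)

text \<open>Avoiding \<open>bad\<close> at one level controls every finer level: \<open>lev\<close>
  is monotone, and each fine grid point is within \<open>T / 2 ^ k\<close> of the left end of its
  coarse cell.\<close>

lemma not_badD: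
  assumes "\<omega> \<in> space M" "\<omega> \<notin> bad k \<eta>"
  shows "k \<le> l \<Longrightarrow> i \<le> 2 ^ l \<Longrightarrow> hs l i \<omega> = h (grid l i) \<omega>"
    and "k \<le> l \<Longrightarrow> i \<le> 2 ^ l \<Longrightarrow> \<bar>hs l i \<omega> - hs k (i div 2 ^ (l - k)) \<omega>\<bar> \<le> \<eta>"
    and "k \<le> l \<Longrightarrow> i \<le> 2 ^ l \<Longrightarrow> \<bar>(hs l i \<omega>)\<^sup>2 - (hs k (i div 2 ^ (l - k)) \<omega>)\<^sup>2\<bar> \<le> \<eta>"
proof -
  have le: "\<bar>h s \<omega>\<bar> \<le> lev k" if "s \<in> dyadics" for s
    using assms that unfolding bad_def by force
  have close: "\<bar>h s \<omega> - h t \<omega>\<bar> \<le> \<eta>" "\<bar>(h s \<omega>)\<^sup>2 - (h t \<omega>)\<^sup>2\<bar> \<le> \<eta>" if "s \<in> dyadics" "t \<in> dyadics" "\<bar>s - t\<bar> \<le> T / 2 ^ k" for s t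
    using assms that unfolding bad_def by force+
  have hs_eq: "hs l i \<omega> = h (grid l i) \<omega>" if "k \<le> l" "i \<le> 2 ^ l" for l i
    using le[OF grid_dyadic[OF that(2)]] lev_mono[OF that(1)] by (simp add: hs_def clip_eq)
  then show "k \<le> l \<Longrightarrow> i \<le> 2 ^ l \<Longrightarrow> hs l i \<omega> = h (grid l i) \<omega>" .
  assume kl: "k \<le> l" "i \<le> 2 ^ l"
  have "i div 2 ^ (l - k) \<le> 2 ^ l div 2 ^ (l - k)" using kl by (intro div_le_mono)
  also have "\<dots> = (2::nat) ^ k" using kl by (simp add: power_diff[symmetric])
  finally have i: "i div 2 ^ (l - k) \<le> 2 ^ k" .
  have "\<bar>grid l i - grid k (i div 2 ^ (l - k))\<bar> \<le> T / 2 ^ k"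
    using grid_div[OF kl(1), of i] by (simp add: abs_minus_commute)
  note * = close[OF grid_dyadic[OF kl(2)] grid_dyadic[OF i] this]
  show "\<bar>hs l i \<omega> - hs k (i div 2 ^ (l - k)) \<omega>\<bar> \<le> \<eta>" "\<bar>(hs l i \<omega>)\<^sup>2 - (hs k (i div 2 ^ (l - k)) \<omega>)\<^sup>2\<bar> \<le> \<eta>"
    using * hs_eq[OF kl] hs_eq[OF order_refl i] by simp_all
qed

lemma sum_grid_refine:
  assumes "k \<le> l"
  shows "(\<Sum>j<2 ^ l. \<xi> (j div 2 ^ (l - k)) * (b (grid l (Suc j)) - b (grid l j)))
    = (\<Sum>i<2 ^ k. \<xi> i * (b (grid k (Suc i)) - b (grid k i)) :: real)"
proof -
  have "(2::nat) ^ l = 2 ^ k * 2 ^ (l - k)" using assms by (simp add: power_add[symmetric])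
  then show ?thesis
    using sum_refine[of "2 ^ (l - k)" \<xi> "\<lambda>j. b (grid l j)" "2 ^ k"] grid_refine[OF assms] by (simp del: mult_Suc)
qed

lemma J_refine: "k \<le> l \<Longrightarrow> J k t \<omega> = (\<Sum>j<2 ^ l. hs k (j div 2 ^ (l - k)) \<omega> * (B (min t (grid l (Suc j))) \<omega> - B (min t (grid l j)) \<omega>))"
  unfolding J_def using sum_grid_refine[of k l "\<lambda>i. hs k i \<omega>" "\<lambda>s. B (min t s) \<omega>"] by simp

lemma Q_refine: "k \<le> l \<Longrightarrow> Q k t \<omega> = (\<Sum>j<2 ^ l. (hs k (j div 2 ^ (l - k)) \<omega>)\<^sup>2 * (min t (grid l (Suc j)) - min t (grid l j)))"
  unfolding Q_def using sum_grid_refine[of k l "\<lambda>i. (hs k i \<omega>)\<^sup>2" "\<lambda>s. min t s"] by simp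

lemma Q_close:
  assumes "\<omega> \<in> space M" "\<omega> \<notin> bad k \<eta>" "k \<le> l" "t \<in> {0..T}"
  shows "\<bar>Q l t \<omega> - Q k t \<omega>\<bar> \<le> \<eta> * T"
proof -
  have inc: "0 \<le> min t (grid l (Suc j)) - min t (grid l j)" for j using grid_mono[of j "Suc j" l] by auto
  have "\<bar>Q l t \<omega> - Q k t \<omega>\<bar> = \<bar>\<Sum>j<2 ^ l. ((hs l j \<omega>)\<^sup>2 - (hs k (j div 2 ^ (l - k)) \<omega>)\<^sup>2) * (min t (grid l (Suc j)) - min t (grid l j))\<bar>"
    unfolding Q_refine[OF assms(3)] Q_refine[OF order_refl, of l] by (simp add: sum_subtractf left_diff_distrib)
  also have "\<dots> \<le> (\<Sum>j<2 ^ l. \<eta> * (min t (grid l (Suc j)) - min t (grid l j)))"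
  proof (rule order_trans[OF sum_abs sum_mono])
    fix j :: nat assume "j \<in> {..<2 ^ l}"
    then show "\<bar>((hs l j \<omega>)\<^sup>2 - (hs k (j div 2 ^ (l - k)) \<omega>)\<^sup>2) * (min t (grid l (Suc j)) - min t (grid l j))\<bar>
        \<le> \<eta> * (min t (grid l (Suc j)) - min t (grid l j))"
      using not_badD(3)[OF assms(1-3), of j] inc[of j] by (simp add: abs_mult mult_right_mono)
  qed
  also have "\<dots> = \<eta> * t"
    using assms(4) by (simp add: sum_distrib_left[symmetric] sum_lessThan_telescope[of "\<lambda>j. min t (grid l j)"])
  also have "\<dots> \<le> \<eta> * T"
  proof (rule mult_left_mono)
    show "0 \<le> \<eta>" using not_badD(3)[OF assms(1-3), of 0] by linarith
  qed (use assms(4) in simp)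
  finally show ?thesis .
qed

lemma J_continuous: "\<omega> \<in> space M \<Longrightarrow> continuous_on {0..T} (\<lambda>t. J m t \<omega>)"
  unfolding J_def
  by (intro continuous_intros continuous_on_compose2[OF B_continuous]) (auto simp: grid_def T_pos less_imp_le)

lemma Q_continuous: "continuous_on A (\<lambda>t. Q m t \<omega>)"
  unfolding Q_def by (intro continuous_intros)

text \<open>If \<open>t\<close> precedes \<open>grid m i\<close>, the coefficient \<open>f\<close>
  need not be known at time \<open>t\<close>, but then both stopped points equal \<open>t\<close>
  and the term is 0.\<close>

lemma min_increment_adapted:
  assumes t: "t \<in> {0..T}" and f: "f \<in> borel_measurable (F (grid m i))"
  shows "(\<lambda>\<omega>. f \<omega> * (B (min t (grid m (Suc i))) \<omega> - B (min t (grid m i)) \<omega>)) \<in> borel_measurable (F t)"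
proof (cases "grid m i \<le> t")
  case True
  have "f \<in> borel_measurable (F t)" by (rule measurable_F_mono[OF f True])
  moreover have "B (min t (grid m j)) \<in> borel_measurable (F t)" for j
    by (rule measurable_F_mono[OF B_adapted[OF min_grid_in[OF t]]]) simp
  ultimately show ?thesis by (intro borel_measurable_times borel_measurable_diff)
next
  case False
  then have "min t (grid m (Suc i)) = t" "min t (grid m i) = t" using grid_mono[of i "Suc i" m] by auto
  then show ?thesis by simp
qed

lemma J_adapted:
  assumes t: "t \<in> {0..T}"
  shows "J m t \<in> borel_measurable (F t)"
  unfolding J_def by (intro borel_measurable_sum min_increment_adapted t hs_adapted) simp

lemma Q_adapted:
  assumes t: "t \<in> {0..T}"
  shows "Q m t \<in> borel_measurable (F t)"
  unfolding Q_def
proof (rule borel_measurable_sum)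
  fix i :: nat assume i: "i \<in> {..<2 ^ m}"
  show "(\<lambda>\<omega>. (hs m i \<omega>)\<^sup>2 * (min t (grid m (Suc i)) - min t (grid m i))) \<in> borel_measurable (F t)"
  proof (cases "grid m i \<le> t")
    case True
    then have "hs m i \<in> borel_measurable (F t)" using i by (intro measurable_F_mono[OF hs_adapted]) simp_all
    then show ?thesis by simp
  next
    case False
    then have "min t (grid m (Suc i)) = t" "min t (grid m i) = t" using grid_mono[of i "Suc i" m] by auto
    then show ?thesis by simp
  qed
qed

end

subsection \<open>Almost sure uniform convergence\<close>

lemma diagonal_indices:
  assumes "\<And>j. eventually (P j) sequentially"
  obtains \<kappa> :: "nat \<Rightarrow> nat" where "mono \<kappa>" "\<And>j. j \<le> \<kappa> j" "\<And>j. P j (\<kappa> j)"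
proof -
  have "\<forall>j. \<exists>N. \<forall>n\<ge>N. P j n" using assms by (simp add: eventually_sequentially)
  then obtain N where N: "\<And>j n. N j \<le> n \<Longrightarrow> P j n" by metis
  \<comment> \<open>Partial sums of the thresholds dominate each of them and increase with
    \<open>j\<close>; the summand \<open>j\<close> drives the sequence to infinity.\<close>
  define \<kappa> where "\<kappa> j = (\<Sum>i\<le>j. N i) + j" for j
  show thesis
  proof
    show "mono \<kappa>" by (simp add: mono_iff_le_Suc \<kappa>_def)
    show "j \<le> \<kappa> j" for j by (simp add: \<kappa>_def)
    have "N j \<le> \<kappa> j" for j unfolding \<kappa>_def by (rule trans_le_add1, rule member_le_sum) simp_all
    then show "P j (\<kappa> j)" for j by (rule N)
  qed
qed

context brownian_integrand
begin

text \<open>The bound of the discrete maximal inequality does not depend on the number of grid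
  points, so it survives refinement: the events on the grids of level \<open>l + n\<close> increase
  with \<open>n\<close>, their union obeys the same bound, and path continuity extends the estimate
  from dyadic times to all of \<open>[0, T]\<close>.\<close>

lemma J_maximal:
  assumes kl: "k \<le> l" and "0 \<le> \<eta>" "0 < \<epsilon>"
  obtains A where "A \<in> sets M" "prob A \<le> \<eta>\<^sup>2 * T / \<epsilon>\<^sup>2"
    "\<And>\<omega> t. \<omega> \<in> space M \<Longrightarrow> \<omega> \<notin> bad k \<eta> \<Longrightarrow> \<omega> \<notin> A \<Longrightarrow> t \<in> {0..T} \<Longrightarrow> \<bar>J l t \<omega> - J k t \<omega>\<bar> \<le> \<epsilon>"
proof -
  \<comment> \<open>The integrands of levels \<open>l\<close> and \<open>k\<close>, both read off on
    the grid of level \<open>l + n\<close>; the exponents are the gaps between the levels.\<close>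
  define \<xi> where "\<xi> n i \<omega> = hs l (i div 2 ^ n) \<omega> - hs k (i div 2 ^ (l + n - k)) \<omega>" for n i \<omega>
  define D where "D t \<omega> = J l t \<omega> - J k t \<omega>" for t \<omega>
  \<comment> \<open>Smallness of the integrand is part of the event, because the maximal inequality
    bounds only this intersection; outside \<open>bad k \<eta>\<close> it holds
    automatically.\<close>
  define E where "E n = {\<omega> \<in> space M. (\<exists>j\<le>2 ^ (l + n). \<bar>D (grid (l + n) j) \<omega>\<bar> > \<epsilon>) \<and> (\<forall>i<2 ^ (l + n). \<bar>\<xi> n i \<omega>\<bar> \<le> \<eta>)}" for n
  have D_eq: "D (grid (l + n) j) \<omega> = (\<Sum>i<j. \<xi> n i \<omega> * (B (grid (l + n) (Suc i)) \<omega> - B (grid (l + n) i) \<omega>))"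
    if "j \<le> 2 ^ (l + n)" for n j \<omega>
  proof -
    let ?s = "grid (l + n) j"
    have min: "min ?s (grid (l + n) i) = grid (l + n) (min i j)" for i
      by (cases "i \<le> j") (use grid_mono[of i j "l + n"] grid_mono[of j i "l + n"] in \<open>auto simp: min_def\<close>)
    have "D ?s \<omega> = (\<Sum>i<2 ^ (l + n). \<xi> n i \<omega> * (B (min ?s (grid (l + n) (Suc i))) \<omega> - B (min ?s (grid (l + n) i)) \<omega>))"
      unfolding D_def \<xi>_def using J_refine[of l "l + n" ?s \<omega>] J_refine[of k "l + n" ?s \<omega>] kl
      by (simp add: left_diff_distrib sum_subtractf)
    also have "\<dots> = (\<Sum>i<j. \<xi> n i \<omega> * (B (grid (l + n) (Suc i)) \<omega> - B (grid (l + n) i) \<omega>))"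
      using sum_stopped[OF that, of "\<lambda>i. min ?s (grid (l + n) i)" "grid (l + n)" "\<lambda>i. \<xi> n i \<omega>" "\<lambda>s. B s \<omega>"] min by simp
    finally show ?thesis .
  qed
  have \<xi>_meas: "\<xi> n i \<in> borel_measurable (F (grid (l + n) i))" if "i < 2 ^ (l + n)" for n i
  proof -
    have *: "hs m (i div 2 ^ (l + n - m)) \<in> borel_measurable (F (grid (l + n) i))" if "m \<le> l" for m
    proof -
      have "i div 2 ^ (l + n - m) \<le> 2 ^ (l + n) div 2 ^ (l + n - m)"
        using \<open>i < 2 ^ (l + n)\<close> by (intro div_le_mono) simp
      also have "\<dots> = (2::nat) ^ m" using that by (simp add: power_diff[symmetric])
      finally have "i div 2 ^ (l + n - m) \<le> 2 ^ m" .
      moreover have "grid m (i div 2 ^ (l + n - m)) \<le> grid (l + n) i"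
        using that by (subst grid_refine[of m "l + n", symmetric]) (auto intro: grid_mono)
      ultimately show ?thesis by (intro measurable_F_mono[OF hs_adapted])
    qed
    show ?thesis
      unfolding \<xi>_def using *[of l] *[of k] kl by (intro borel_measurable_diff) simp_all
  qed
  have E: "E n \<in> sets M" "prob (E n) \<le> \<eta>\<^sup>2 * T / \<epsilon>\<^sup>2" for n
  proof -
    have eq: "E n = {\<omega> \<in> space M. (\<exists>j\<le>2 ^ (l + n). \<bar>\<Sum>i<j. \<xi> n i \<omega> * (B (grid (l + n) (Suc i)) \<omega> - B (grid (l + n) i) \<omega>)\<bar> > \<epsilon>)
        \<and> (\<forall>i<2 ^ (l + n). \<bar>\<xi> n i \<omega>\<bar> \<le> \<eta>)}"
      unfolding E_def by (intro Collect_cong conj_cong ex_cong1 refl) (simp add: D_eq)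
    show "E n \<in> sets M" "prob (E n) \<le> \<eta>\<^sup>2 * T / \<epsilon>\<^sup>2"
      unfolding eq
      by (rule maximal_inequality[OF _ _ _ \<xi>_meas assms(2,3)]; simp add: grid_mono)+
  qed
  have inc: "incseq E"
  proof (rule incseq_SucI)
    fix n
    have \<xi>_Suc: "\<xi> (Suc n) i \<omega> = \<xi> n (i div 2) \<omega>" for i \<omega>
      using kl by (simp add: \<xi>_def Suc_diff_le div_mult2_eq)
    have grid_double: "grid (l + n) j = grid (l + Suc n) (2 * j)" for j
      by (simp add: grid_def)
    show "E n \<subseteq> E (Suc n)"
    proof
      fix \<omega> assume "\<omega> \<in> E n"
      then obtain j where j: "\<omega> \<in> space M" "j \<le> 2 ^ (l + n)" "\<bar>D (grid (l + n) j) \<omega>\<bar> > \<epsilon>"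
        and \<xi>: "\<And>i. i < 2 ^ (l + n) \<Longrightarrow> \<bar>\<xi> n i \<omega>\<bar> \<le> \<eta>" unfolding E_def by blast
      have "\<exists>j\<le>2 ^ (l + Suc n). \<bar>D (grid (l + Suc n) j) \<omega>\<bar> > \<epsilon>"
        using j by (intro exI[of _ "2 * j"]) (simp add: grid_double)
      moreover have "\<bar>\<xi> (Suc n) i \<omega>\<bar> \<le> \<eta>" if "i < 2 ^ (l + Suc n)" for i
        using that unfolding \<xi>_Suc by (intro \<xi>) auto
      ultimately show "\<omega> \<in> E (Suc n)" using j(1) unfolding E_def by blast
    qed
  qed
  show thesis
  proof (rule that)
    show "(\<Union>n. E n) \<in> sets M" using E(1) by auto
    have "(\<lambda>n. prob (E n)) \<longlonglongrightarrow> prob (\<Union>n. E n)"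
      using E(1) inc by (intro finite_Lim_measure_incseq) auto
    then show "prob (\<Union>n. E n) \<le> \<eta>\<^sup>2 * T / \<epsilon>\<^sup>2"
      by (rule LIMSEQ_le_const2) (use E(2) in blast)
  next
    fix \<omega> t assume \<omega>: "\<omega> \<in> space M" "\<omega> \<notin> bad k \<eta>" "\<omega> \<notin> (\<Union>n. E n)" and t: "t \<in> {0..T}"
    have \<xi>: "\<bar>\<xi> n i \<omega>\<bar> \<le> \<eta>" if "i < 2 ^ (l + n)" for n i
    proof -
      have "i div 2 ^ n < 2 ^ l" using that by (simp add: less_mult_imp_div_less power_add)
      moreover have "i div 2 ^ (l + n - k) = i div 2 ^ n div 2 ^ (l - k)"
        using kl by (simp add: div_mult2_eq[symmetric] power_add[symmetric] add.commute)
      ultimately show ?thesis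
        unfolding \<xi>_def using not_badD(2)[OF \<omega>(1,2) kl, of "i div 2 ^ n"] by simp
    qed
    have D_grid: "\<bar>D (grid (l + n) j) \<omega>\<bar> \<le> \<epsilon>" if "j \<le> 2 ^ (l + n)" for n j
    proof (rule ccontr)
      assume "\<not> ?thesis"
      then have "\<omega> \<in> E n" unfolding E_def using \<omega>(1) \<xi>[of _ n] that by (auto simp: not_le)
      then show False using \<omega>(3) by blast
    qed
    define j where "j n = nat \<lfloor>t * 2 ^ (l + n) / T\<rfloor>" for n
    have tj: "0 \<le> t * 2 ^ (l + n) / T" "t * 2 ^ (l + n) / T \<le> 2 ^ (l + n)" for n
      using t T_pos by (auto simp: field_simps mult_right_mono)
    have j_le: "j n \<le> 2 ^ (l + n)" for n
    proof -
      have "real (j n) \<le> t * 2 ^ (l + n) / T" using tj(1)[of n] unfolding j_def by linarith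
      from order_trans[OF this tj(2)] show ?thesis by simp
    qed
    have close: "\<bar>grid (l + n) (j n) - t\<bar> \<le> T / 2 ^ (l + n)" for n
    proof -
      have "\<bar>real (j n) - t * 2 ^ (l + n) / T\<bar> \<le> 1" using tj(1)[of n] unfolding j_def by linarith
      then have "\<bar>real (j n) - t * 2 ^ (l + n) / T\<bar> * (T / 2 ^ (l + n)) \<le> 1 * (T / 2 ^ (l + n))"
        using T_pos by (intro mult_right_mono) auto
      moreover have "grid (l + n) (j n) - t = (real (j n) - t * 2 ^ (l + n) / T) * (T / 2 ^ (l + n))"
        using T_pos by (simp add: grid_def field_simps)
      ultimately show ?thesis using T_pos by (simp add: abs_mult)
    qed
    have "(\<lambda>n. grid (l + n) (j n)) \<longlonglongrightarrow> t"
    proof (rule LIM_zero_cancel, rule Lim_null_comparison)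
      show "eventually (\<lambda>n. norm (grid (l + n) (j n) - t) \<le> T / 2 ^ (l + n)) sequentially"
        using close by simp
      have "(\<lambda>n. T / 2 ^ l / 2 ^ n) \<longlonglongrightarrow> 0" by real_asymp
      then show "(\<lambda>n. T / 2 ^ (l + n)) \<longlonglongrightarrow> 0" by (simp add: power_add)
    qed
    moreover have "continuous_on {0..T} (\<lambda>t. D t \<omega>)"
      unfolding D_def by (intro continuous_on_diff J_continuous \<omega>)
    moreover have "eventually (\<lambda>n. grid (l + n) (j n) \<in> {0..T}) sequentially"
      using grid_in[OF j_le] by (intro always_eventually allI)
    ultimately have "(\<lambda>n. D (grid (l + n) (j n)) \<omega>) \<longlonglongrightarrow> D t \<omega>"
      using t by (intro continuous_on_tendsto_compose[where f = "\<lambda>t. D t \<omega>"])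
    then have "(\<lambda>n. \<bar>D (grid (l + n) (j n)) \<omega>\<bar>) \<longlonglongrightarrow> \<bar>D t \<omega>\<bar>" by (rule tendsto_rabs)
    then have "\<bar>D t \<omega>\<bar> \<le> \<epsilon>"
      by (rule LIMSEQ_le_const2) (use D_grid[OF j_le] in blast)
    then show "\<bar>J l t \<omega> - J k t \<omega>\<bar> \<le> \<epsilon>" by (simp add: D_def)
  qed
qed

text \<open>Tolerance \<open>1 / 4 ^ j\<close> for the integrand and \<open>1 / 2 ^ j\<close> for
  the integral turn the maximal inequality into the probability bound
  \<open>T * (1 / 4) ^ j\<close>. All failure probabilities are then summable, so by Borel-Cantelli
  the successive uniform distances are almost surely dominated by a summable sequence from some
  index on.\<close>

lemma AE_L_converges:
  assumes "mono \<kappa>" and bad: "\<And>j. prob (bad (\<kappa> j) (1 / 4 ^ j)) \<le> 1 / 2 ^ j"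
  shows "AE \<omega> in M. \<exists>g. uniform_limit {0..T} (\<lambda>j t. L (\<kappa> j) t \<omega>) g sequentially"
proof -
  have \<kappa>: "\<kappa> j \<le> \<kappa> (Suc j)" for j using \<open>mono \<kappa>\<close> by (simp add: mono_def)
  have "\<exists>A. A \<in> sets M \<and> prob A \<le> T * (1 / 4) ^ j \<and>
    (\<forall>\<omega> t. \<omega> \<in> space M \<longrightarrow> \<omega> \<notin> bad (\<kappa> j) (1 / 4 ^ j) \<longrightarrow> \<omega> \<notin> A \<longrightarrow> t \<in> {0..T}
      \<longrightarrow> \<bar>J (\<kappa> (Suc j)) t \<omega> - J (\<kappa> j) t \<omega>\<bar> \<le> 1 / 2 ^ j)" for j
  proof -
    have p: "(1 / 4 ^ j)\<^sup>2 * T / (1 / 2 ^ j)\<^sup>2 = T * (1 / 4) ^ j"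
    proof -
      have "((2::real) ^ j)\<^sup>2 = 4 ^ j" by (simp add: power2_eq_square power_mult_distrib[symmetric])
      then show ?thesis by (simp add: power_divide power2_eq_square)
    qed
    show ?thesis
      by (rule J_maximal[OF \<kappa>, of "1 / 4 ^ j" "1 / 2 ^ j" j]) (simp_all add: p, blast)
  qed
  then obtain A where A: "\<And>j. A j \<in> sets M" "\<And>j. prob (A j) \<le> T * (1 / 4) ^ j"
    and close: "\<And>j \<omega> t. \<omega> \<in> space M \<Longrightarrow> \<omega> \<notin> bad (\<kappa> j) (1 / 4 ^ j) \<Longrightarrow> \<omega> \<notin> A j \<Longrightarrow> t \<in> {0..T}
      \<Longrightarrow> \<bar>J (\<kappa> (Suc j)) t \<omega> - J (\<kappa> j) t \<omega>\<bar> \<le> 1 / 2 ^ j"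
    by metis
  have "summable (\<lambda>j. prob (A j))"
    by (rule summable_comparison_test'[where g = "\<lambda>j. T * (1 / 4) ^ j"]) (use A(2) in \<open>simp_all add: summable_geometric\<close>)
  then have "AE \<omega> in M. eventually (\<lambda>j. \<omega> \<in> space M - A j) sequentially"
    by (intro borel_cantelli_AE1 A) (simp_all add: emeasure_eq_measure)
  moreover have "summable (\<lambda>j. prob (bad (\<kappa> j) (1 / 4 ^ j)))"
  proof (rule summable_comparison_test'[where g = "\<lambda>j. (1 / 2) ^ j"])
    show "summable (\<lambda>j. (1 / 2 :: real) ^ j)" by (simp add: summable_geometric)
    show "norm (prob (bad (\<kappa> j) (1 / 4 ^ j))) \<le> (1 / 2) ^ j" for j using bad[of j] by (simp add: power_divide)
  qed
  then have "AE \<omega> in M. eventually (\<lambda>j. \<omega> \<in> space M - bad (\<kappa> j) (1 / 4 ^ j)) sequentially"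
    by (intro borel_cantelli_AE1 bad_sets) (simp_all add: emeasure_eq_measure)
  ultimately show ?thesis
  proof eventually_elim
    case (elim \<omega>)
    show ?case
    proof (rule uniform_limit_telescoping)
      show "eventually (\<lambda>j. \<forall>t\<in>{0..T}. \<bar>L (\<kappa> (Suc j)) t \<omega> - L (\<kappa> j) t \<omega>\<bar> \<le> (1 / 2) ^ j + T * (1 / 4) ^ j) sequentially"
        using elim(1) elim(2)
      proof eventually_elim
        case (elim j)
        then have \<omega>: "\<omega> \<in> space M" "\<omega> \<notin> A j" "\<omega> \<notin> bad (\<kappa> j) (1 / 4 ^ j)" by auto
        show ?case
        proof
          fix t assume t: "t \<in> {0..T}"
          have "\<bar>J (\<kappa> (Suc j)) t \<omega> - J (\<kappa> j) t \<omega>\<bar> \<le> (1 / 2) ^ j"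
            using close[OF \<omega>(1,3,2) t] by (simp add: power_divide)
          moreover have "\<bar>Q (\<kappa> (Suc j)) t \<omega> - Q (\<kappa> j) t \<omega>\<bar> \<le> T * (1 / 4) ^ j"
            using Q_close[OF \<omega>(1,3) \<kappa> t] by (simp add: power_divide)
          ultimately show "\<bar>L (\<kappa> (Suc j)) t \<omega> - L (\<kappa> j) t \<omega>\<bar> \<le> (1 / 2) ^ j + T * (1 / 4) ^ j"
            unfolding L_def by linarith
        qed
      qed
      show "summable (\<lambda>j. (1 / 2) ^ j + T * (1 / 4) ^ j)"
        by (intro summable_add summable_mult summable_geometric) auto
    qed
  qed
qed

lemma L_continuous: "\<omega> \<in> space M \<Longrightarrow> continuous_on {0..T} (\<lambda>t. L m t \<omega>)"
  unfolding L_def by (intro continuous_intros J_continuous Q_continuous) auto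

lemma L_adapted: "t \<in> {0..T} \<Longrightarrow> L m t \<in> borel_measurable (F t)"
  unfolding L_def using J_adapted[of t m] Q_adapted[of t m] by simp

text \<open>The null sequence \<rho> is a parameter so that the same subsequence can also make the
  second moments of the Euler error summable.\<close>

lemma log_limit_exists:
  fixes \<rho> :: "nat \<Rightarrow> real"
  assumes \<rho>: "\<rho> \<longlonglongrightarrow> 0"
  obtains \<kappa> Y where "\<And>j. j \<le> \<kappa> j" "\<And>j. \<rho> (\<kappa> j) \<le> (1 / 2) ^ j" "continuous_adapted M F T Y"
    "AE \<omega> in M. uniform_limit {0..T} (\<lambda>j t. L (\<kappa> j) t \<omega>) (\<lambda>t. Y t \<omega>) sequentially"
proof -
  have "eventually (\<lambda>m. prob (bad m (1 / 4 ^ j)) < 1 / 2 ^ j \<and> \<rho> m < (1 / 2) ^ j) sequentially" for j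
    using prob_bad_tendsto[of "1 / 4 ^ j"] \<rho> by (intro eventually_conj order_tendstoD(2)) auto
  from diagonal_indices[of "\<lambda>j m. prob (bad m (1 / 4 ^ j)) < 1 / 2 ^ j \<and> \<rho> m < (1 / 2) ^ j", OF this]
  obtain \<kappa> where \<kappa>: "mono \<kappa>" "\<And>j. j \<le> \<kappa> j"
    "\<And>j. prob (bad (\<kappa> j) (1 / 4 ^ j)) < 1 / 2 ^ j \<and> \<rho> (\<kappa> j) < (1 / 2) ^ j" by blast
  have "AE \<omega> in M. \<exists>g. uniform_limit {0..T} (\<lambda>j t. L (\<kappa> j) t \<omega>) g sequentially"
    using \<kappa>(3) by (intro AE_L_converges \<kappa>(1)) (simp add: less_imp_le)
  then obtain N where N: "N \<in> null_sets M" "{\<omega> \<in> space M. \<not> (\<exists>g. uniform_limit {0..T} (\<lambda>j t. L (\<kappa> j) t \<omega>) g sequentially)} \<subseteq> N"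
    unfolding eventually_ae_filter by auto
  \<comment> \<open>Resetting on the null set gives continuity of every path; adaptedness survives
    because \<open>usual_conditions\<close> puts all null sets of \<open>M\<close> into each
    \<open>F t\<close>.\<close>
  define Y where "Y t \<omega> = (if \<omega> \<in> N then 0 else lim (\<lambda>j. L (\<kappa> j) t \<omega>))" for t \<omega>
  have lim: "uniform_limit {0..T} (\<lambda>j t. L (\<kappa> j) t \<omega>) (\<lambda>t. Y t \<omega>) sequentially"
    if \<omega>: "\<omega> \<in> space M" "\<omega> \<notin> N" for \<omega>
  proof -
    obtain g where g: "uniform_limit {0..T} (\<lambda>j t. L (\<kappa> j) t \<omega>) g sequentially" using N(2) \<omega> by blast
    have eq: "g t = Y t \<omega>" if "t \<in> {0..T}" for t
      using tendsto_uniform_limitI[OF g that] \<omega>(2) by (simp add: Y_def limI)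
    show ?thesis
    proof (rule uniform_limitI)
      fix e :: real assume "0 < e"
      from uniform_limitD[OF g this]
      show "eventually (\<lambda>j. \<forall>t\<in>{0..T}. dist (L (\<kappa> j) t \<omega>) (Y t \<omega>) < e) sequentially"
        by eventually_elim (simp add: eq[symmetric])
    qed
  qed
  show thesis
  proof (rule that)
    show "j \<le> \<kappa> j" "\<rho> (\<kappa> j) \<le> (1 / 2) ^ j" for j using \<kappa>(2,3) by (simp_all add: less_imp_le)
    show "AE \<omega> in M. uniform_limit {0..T} (\<lambda>j t. L (\<kappa> j) t \<omega>) (\<lambda>t. Y t \<omega>) sequentially"
      using AE_not_in[OF N(1)] AE_space by eventually_elim (rule lim)
    show "continuous_adapted M F T Y"
      unfolding continuous_adapted_def
    proof (intro conjI ballI)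
      fix t assume t: "t \<in> {0..T}"
      have NF: "N \<in> sets (F t)" using null_sets_F[OF t] N(1) by blast
      show "Y t \<in> borel_measurable (F t)"
      proof (rule borel_measurable_LIMSEQ_real)
        fix j
        show "(\<lambda>\<omega>. if \<omega> \<in> N then 0 else L (\<kappa> j) t \<omega>) \<in> borel_measurable (F t)"
          using sets.Int_space_eq2[OF NF] NF L_adapted[OF t] by (intro measurable_If_set) simp_all
      next
        fix \<omega> assume "\<omega> \<in> space (F t)"
        then show "(\<lambda>j. if \<omega> \<in> N then 0 else L (\<kappa> j) t \<omega>) \<longlonglongrightarrow> Y t \<omega>"
          using tendsto_uniform_limitI[OF lim t, of \<omega>] by (cases "\<omega> \<in> N") (simp_all add: Y_def)
      qed
    next
      fix \<omega> assume \<omega>: "\<omega> \<in> space M"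
      show "continuous_on {0..T} (\<lambda>t. Y t \<omega>)"
      proof (cases "\<omega> \<in> N")
        case False
        show ?thesis
          by (rule uniform_limit_theorem[OF _ lim[OF \<omega> False]]) (simp_all add: L_continuous[OF \<omega>])
      qed (simp add: Y_def)
    qed
  qed
qed

end

section \<open>Uniform limits, Stieltjes sums and integral processes\<close>

lemma uniform_limit_exp:
  fixes f :: "nat \<Rightarrow> 'b \<Rightarrow> real"
  assumes f: "uniform_limit A f g sequentially" and "bounded (g ` A)"
  shows "uniform_limit A (\<lambda>n x. exp (f n x)) (\<lambda>x. exp (g x)) sequentially"
proof -
  obtain K where K: "\<And>x. x \<in> A \<Longrightarrow> \<bar>g x\<bar> \<le> K" using \<open>bounded (g ` A)\<close> unfolding bounded_real by blast
  have "uniform_limit A (\<lambda>n x. exp (f n x)) (exp \<circ> g) sequentially"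
  proof (rule uniform_limit_compose[OF f])
    \<comment> \<open>\<open>exp\<close> is uniformly continuous only on bounded sets; the margin 1
      accommodates the approximations once they are within 1 of \<open>g\<close>.\<close>
    show "uniformly_continuous_on {- (K + 1)..K + 1} (exp :: real \<Rightarrow> real)"
      by (intro compact_uniformly_continuous continuous_intros) simp
    show "\<forall>\<^sub>F n in sequentially. f n ` A \<subseteq> {- (K + 1)..K + 1}"
      using uniform_limitD[OF f zero_less_one]
    proof eventually_elim
      case (elim n)
      show ?case
      proof
        fix y assume "y \<in> f n ` A"
        then obtain x where "x \<in> A" "y = f n x" by blast
        then show "y \<in> {- (K + 1)..K + 1}" using elim K[of x] by (auto simp: dist_real_def dest!: bspec[of _ _ x])
      qed
    qed
    show "g ` A \<subseteq> {- (K + 1)..K + 1}"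
    proof
      fix y assume "y \<in> g ` A"
      then obtain x where "x \<in> A" "y = g x" by blast
      then show "y \<in> {- (K + 1)..K + 1}" using K[of x] by auto
    qed
  qed
  then show ?thesis by (simp add: o_def)
qed

text \<open>A frozen process evaluates the approximation at the left end of the cell of
  \<open>s\<close> instead of at \<open>s\<close>; the modulus of continuity of the limit absorbs
  the shift.\<close>

lemma uniform_limit_nearby:
  fixes f :: "nat \<Rightarrow> real \<Rightarrow> real"
  assumes f: "uniform_limit A f g sequentially" and g: "uniformly_continuous_on A g"
    and p: "\<And>j s. s \<in> S \<Longrightarrow> p j s \<in> A" "\<And>j s. s \<in> S \<Longrightarrow> \<bar>p j s - s\<bar> \<le> a j" and "S \<subseteq> A" and a: "a \<longlonglongrightarrow> 0"
  shows "uniform_limit S (\<lambda>j s. f j (p j s)) g sequentially"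
proof (rule uniform_limitI)
  fix e :: real assume e: "0 < e"
  obtain d where d: "0 < d" "\<And>x y. x \<in> A \<Longrightarrow> y \<in> A \<Longrightarrow> dist y x < d \<Longrightarrow> dist (g y) (g x) < e / 2"
    using g e unfolding uniformly_continuous_on_def by (meson half_gt_zero)
  have "eventually (\<lambda>j. a j < d) sequentially" using a d(1) by (rule order_tendstoD)
  moreover have "eventually (\<lambda>j. \<forall>x\<in>A. dist (f j x) (g x) < e / 2) sequentially"
    using e by (intro uniform_limitD[OF f]) simp
  ultimately show "eventually (\<lambda>j. \<forall>s\<in>S. dist (f j (p j s)) (g s) < e) sequentially"
  proof eventually_elim
    case (elim j)
    show ?case
    proof
      fix s assume s: "s \<in> S"
      have "dist (p j s) s < d" using p(2)[OF s, of j] elim(1) by (simp add: dist_real_def)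
      then have "dist (g (p j s)) (g s) < e / 2" using s p(1)[OF s] \<open>S \<subseteq> A\<close> by (intro d(2)) auto
      moreover have "dist (f j (p j s)) (g (p j s)) < e / 2" using elim(2) p(1)[OF s] by blast
      ultimately show "dist (f j (p j s)) (g s) < e"
        using dist_triangle[of "f j (p j s)" "g s" "g (p j s)"] by linarith
    qed
  qed
qed

text \<open>On a cell the fundamental theorem of calculus writes the increment of \<open>D\<close>
  as an integral of \<open>D'\<close>, so the error there is the integral of
  \<open>D' s * (c i - Z s)\<close>. The values \<open>c\<close> are free because they will be
  approximations of \<open>Z\<close> at right endpoints.\<close>

lemma Stieltjes_sum_integral_le:
  fixes D D' Z :: "real \<Rightarrow> real" and u c :: "nat \<Rightarrow> real"
  assumes u: "\<And>i. i < n \<Longrightarrow> u i \<le> u (Suc i)"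
    and D: "\<And>x. (D has_real_derivative D' x) (at x)" and D': "continuous_on UNIV D'"
    and C: "\<And>x. x \<in> {u 0..u n} \<Longrightarrow> \<bar>D' x\<bar> \<le> C"
    and Z: "continuous_on {u 0..u n} Z"
    and \<epsilon>: "\<And>i s. i < n \<Longrightarrow> s \<in> {u i..u (Suc i)} \<Longrightarrow> \<bar>c i - Z s\<bar> \<le> \<epsilon>"
  shows "\<bar>(\<Sum>i<n. (D (u (Suc i)) - D (u i)) * c i) - integral {u 0..u n} (\<lambda>s. D' s * Z s)\<bar> \<le> C * \<epsilon> * (u n - u 0)"
proof -
  have le: "i \<le> j \<Longrightarrow> j \<le> n \<Longrightarrow> u i \<le> u j" for i j
    by (induction j rule: dec_induct) (use u in \<open>auto intro: order_trans\<close>)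
  have "j \<le> n \<Longrightarrow> \<bar>(\<Sum>i<j. (D (u (Suc i)) - D (u i)) * c i) - integral {u 0..u j} (\<lambda>s. D' s * Z s)\<bar> \<le> C * \<epsilon> * (u j - u 0)" for j
  proof (induction j)
    case (Suc j)
    let ?a = "u j" and ?b = "u (Suc j)"
    have ab: "u 0 \<le> ?a" "?a \<le> ?b" "?b \<le> u n" using le[of 0 j] le[of "Suc j" n] u[of j] Suc.prems by auto
    have cD': "continuous_on S D'" for S using D' by (rule continuous_on_subset) simp
    have cont: "continuous_on {u 0..?b} (\<lambda>s. D' s * Z s)" "continuous_on {?a..?b} Z"
      using ab by (auto intro!: continuous_intros cD' intro: continuous_on_subset[OF Z])
    have "(D' has_integral (D ?b - D ?a)) {?a..?b}"
      by (rule fundamental_theorem_of_calculus[OF ab(2)])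
        (use D in \<open>auto simp: has_real_derivative_iff_has_vector_derivative[symmetric] intro: has_field_derivative_at_within\<close>)
    then have "((\<lambda>s. D' s * c j) has_integral ((D ?b - D ?a) * c j)) {?a..?b}"
      by (rule has_integral_mult_left)
    moreover have "((\<lambda>s. D' s * Z s) has_integral integral {?a..?b} (\<lambda>s. D' s * Z s)) {?a..?b}"
      by (intro integrable_integral integrable_continuous_interval continuous_on_subset[OF cont(1)]) (use ab in auto)
    ultimately have "((\<lambda>s. D' s * c j - D' s * Z s) has_integral ((D ?b - D ?a) * c j - integral {?a..?b} (\<lambda>s. D' s * Z s))) {?a..?b}"
      by (rule has_integral_diff)
    then have "\<bar>(D ?b - D ?a) * c j - integral {?a..?b} (\<lambda>s. D' s * Z s)\<bar> = norm (integral {?a..?b} (\<lambda>s. D' s * c j - D' s * Z s))"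
      by (simp add: integral_unique)
    also have "\<dots> \<le> C * \<epsilon> * (?b - ?a)"
    proof (rule integral_bound[OF ab(2)])
      show "continuous_on {?a..?b} (\<lambda>s. D' s * c j - D' s * Z s)"
        by (intro continuous_intros cD' cont(2))
      fix s assume s: "s \<in> {?a..?b}"
      have "\<bar>D' s\<bar> * \<bar>c j - Z s\<bar> \<le> C * \<epsilon>"
        using C[of s] \<epsilon>[of j s] s ab Suc.prems by (intro mult_mono) auto
      then show "norm (D' s * c j - D' s * Z s) \<le> C * \<epsilon>"
        by (simp add: abs_mult[symmetric] right_diff_distrib)
    qed
    finally have 1: "\<bar>(D ?b - D ?a) * c j - integral {?a..?b} (\<lambda>s. D' s * Z s)\<bar> \<le> C * \<epsilon> * (?b - ?a)" .
    have 2: "integral {u 0..?a} (\<lambda>s. D' s * Z s) + integral {?a..?b} (\<lambda>s. D' s * Z s) = integral {u 0..?b} (\<lambda>s. D' s * Z s)"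
      using ab cont(1) by (intro Henstock_Kurzweil_Integration.integral_combine integrable_continuous_interval)
    have 3: "C * \<epsilon> * (?b - u 0) = C * \<epsilon> * (?b - ?a) + C * \<epsilon> * (?a - u 0)" by (simp add: algebra_simps)
    show ?case using 1 Suc.IH Suc.prems unfolding 2[symmetric] 3 by (simp add: abs_le_iff)
  qed simp
  then show ?thesis by simp
qed

text \<open>Summable second moments make the series of squares integrable, hence finite almost
  surely, and its terms tend to 0.\<close>

lemma (in prob_space) AE_tendsto_zero_second_moment:
  assumes f: "\<And>j. f j \<in> borel_measurable M"
    and le: "\<And>j. (\<integral>\<^sup>+\<omega>. ennreal ((f j \<omega>)\<^sup>2) \<partial>M) \<le> ennreal ((1 / 2) ^ j)"
  shows "AE \<omega> in M. (\<lambda>j. f j \<omega>) \<longlonglongrightarrow> 0"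
proof -
  note [measurable] = f
  have "(\<integral>\<^sup>+\<omega>. (\<Sum>j. ennreal ((f j \<omega>)\<^sup>2)) \<partial>M) = (\<Sum>j. \<integral>\<^sup>+\<omega>. ennreal ((f j \<omega>)\<^sup>2) \<partial>M)"
    by (rule nn_integral_suminf) measurable
  also have "\<dots> \<le> (\<Sum>j. ennreal ((1 / 2) ^ j))" by (intro suminf_le le) auto
  also have "\<dots> = ennreal (\<Sum>j. (1 / 2) ^ j)"
    by (intro suminf_ennreal_eq) (auto simp: summable_geometric summable_sums)
  also have "\<dots> < \<infinity>" by simp
  finally have "AE \<omega> in M. (\<Sum>j. ennreal ((f j \<omega>)\<^sup>2)) \<noteq> \<infinity>"
    by (intro nn_integral_PInf_AE) auto
  then show ?thesis
  proof eventually_elim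
    case (elim \<omega>)
    then have "summable (\<lambda>j. (f j \<omega>)\<^sup>2)" by (intro summable_suminf_not_top) auto
    then have "(\<lambda>j. (f j \<omega>)\<^sup>2) \<longlonglongrightarrow> 0" by (rule summable_LIMSEQ_zero)
    then have "(\<lambda>j. sqrt ((f j \<omega>)\<^sup>2)) \<longlonglongrightarrow> sqrt 0" by (rule tendsto_real_sqrt)
    then show ?case by (simp add: tendsto_rabs_zero_iff)
  qed
qed

text \<open>Adaptedness is where progressive measurability enters: Fubini derives the
  \<open>F t\<close>-measurability of the integral from joint measurability on the product of
  \<open>{0..t}\<close> and \<open>F t\<close>.\<close>

lemma (in brownian_setting) continuous_adapted_integral:
  assumes Z: "continuous_adapted M F T Z"
  shows "continuous_adapted M F T (\<lambda>t \<omega>. \<integral>s\<in>{0..t}. Z s \<omega> \<partial>lborel)"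
  unfolding continuous_adapted_def
proof (intro conjI ballI)
  fix \<omega> assume \<omega>: "\<omega> \<in> space M"
  then have c: "continuous_on {0..T} (\<lambda>s. Z s \<omega>)" using Z by (simp add: continuous_adapted_def)
  have eq: "(\<integral>s\<in>{0..t}. Z s \<omega> \<partial>lborel) = integral {0..t} (\<lambda>s. Z s \<omega>)" if "t \<in> {0..T}" for t
    using that by (intro set_borel_integral_eq_integral borel_integrable_atLeastAtMost' continuous_on_subset[OF c]) auto
  have "continuous_on {0..T} (\<lambda>t. integral {0..t} (\<lambda>s. Z s \<omega>))"
    by (intro indefinite_integral_continuous_1 integrable_continuous_interval c)
  then show "continuous_on {0..T} (\<lambda>t. \<integral>s\<in>{0..t}. Z s \<omega> \<partial>lborel)"
    by (rule continuous_on_cong[THEN iffD2, rotated 2]) (simp_all add: eq)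
next
  fix t assume t: "t \<in> {0..T}"
  let ?R = "restrict_space lborel {0..t}"
  interpret R: sigma_finite_measure ?R
    by (intro sigma_finite_measure_restrict_space sigma_finite_lborel) simp
  have s: "sets (restrict_space borel {0..t} \<Otimes>\<^sub>M F t) = sets (?R \<Otimes>\<^sub>M F t)"
    by (intro sets_pair_measure_cong sets_restrict_space_cong) simp_all
  have "(\<lambda>(s, \<omega>). Z s \<omega>) \<in> borel_measurable (restrict_space borel {0..t} \<Otimes>\<^sub>M F t)"
    using continuous_adapted_imp_progressive[OF Z] t unfolding progressive_def by blast
  then have "(\<lambda>(s, \<omega>). Z s \<omega>) \<in> borel_measurable (?R \<Otimes>\<^sub>M F t)"
    using measurable_cong_sets[OF s refl] by blast
  from measurable_pair_swap[OF this]
  have "case_prod (\<lambda>\<omega> s. Z s \<omega>) \<in> borel_measurable (F t \<Otimes>\<^sub>M ?R)" by simp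
  then have "(\<lambda>\<omega>. \<integral>s. Z s \<omega> \<partial>?R) \<in> borel_measurable (F t)"
    by (rule R.borel_measurable_lebesgue_integral)
  then show "(\<lambda>\<omega>. \<integral>s\<in>{0..t}. Z s \<omega> \<partial>lborel) \<in> borel_measurable (F t)"
    by (simp add: integral_restrict_space set_lebesgue_integral_def)
qed

subsection \<open>The linear equation on a grid\<close>

locale linear_sde = brownian_integrand M F T B h for M :: "'a measure" and F T B h +
  fixes w0 r :: real
  assumes w0_pos: "0 < w0"
begin

text \<open>The solution is sought as \<open>D t\<close> times a stochastic exponential; with the
  drift in a smooth deterministic factor, the drift term becomes an ordinary Stieltjes sum.\<close>

definition D :: "real \<Rightarrow> real" where "D t = w0 * exp (r * t)"

definition D_max :: real where "D_max = w0 * exp (\<bar>r\<bar> * T)"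

definition E :: "nat \<Rightarrow> 'a process" where "E m t \<omega> = exp (L m t \<omega>)"

text \<open>The Euler error accumulated up to time \<open>t\<close>. All grid points are stopped at
  \<open>t\<close>, so terms beyond \<open>t\<close> vanish.\<close>

definition N :: "nat \<Rightarrow> 'a process" where
  "N m t \<omega> = (\<Sum>i<2 ^ m. D (min t (grid m i)) * E m (min t (grid m i)) \<omega> *
     exp_residual (min t (grid m (Suc i)) - min t (grid m i)) (hs m i \<omega>) (B (min t (grid m (Suc i))) \<omega> - B (min t (grid m i)) \<omega>))"

text \<open>The bound of \<open>nn_integral_square_residual_sum_le\<close> with
  \<open>c = lev m\<close>, \<open>d = D_max\<close> and mesh \<open>T / 2 ^ m\<close>.\<close>

definition \<rho> :: "nat \<Rightarrow> real" where
  "\<rho> m = D_max\<^sup>2 * lev m ^ 4 * exp (2 * (lev m)\<^sup>2 * T) * T * (T / 2 ^ m)"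

text \<open>The Euler integrand of level \<open>m\<close>. The factor \<open>E\<close> is unbounded
  while a simple process must be bounded, hence a second clipping; its level \<open>j\<close> is
  separate from \<open>m\<close> because it only has to outgrow each fixed path.\<close>

definition V :: "nat \<Rightarrow> nat \<Rightarrow> nat \<Rightarrow> 'a \<Rightarrow> real" where
  "V j m i \<omega> = D (grid m i) * clip (real j) (E m (grid m i) \<omega>) * hs m i \<omega>"

lemma D_pos: "0 < D t" using w0_pos by (simp add: D_def)

lemma D_0 [simp]: "D 0 = w0" by (simp add: D_def)

lemma D_le: "t \<in> {0..T} \<Longrightarrow> D t \<le> D_max"
proof -
  assume t: "t \<in> {0..T}"
  have "r * t \<le> \<bar>r\<bar> * T"
    using t by (intro mult_mono) auto
  then show ?thesis using w0_pos by (simp add: D_def D_max_def)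
qed

lemma D_deriv: "(D has_real_derivative r * D t) (at t)"
  unfolding D_def by (auto intro!: derivative_eq_intros)

lemma D_continuous: "continuous_on A D"
  unfolding D_def by (intro continuous_intros)

lemma \<rho>_tendsto: "\<rho> \<longlonglongrightarrow> 0"
proof -
  have \<rho>_eq: "\<rho> m = D_max\<^sup>2 * ((ln (real m + 1))\<^sup>2 * (real m + 1)\<^sup>2 / 2 ^ m)" for m
  proof -
    have 1: "(lev m)\<^sup>2 = ln (real m + 1) / T" using T_pos by (simp add: lev_def)
    have 2: "lev m ^ 4 = (lev m)\<^sup>2 * (lev m)\<^sup>2" by (simp add: power4_eq_xxxx power2_eq_square)
    have "2 * (lev m)\<^sup>2 * T = ln (real m + 1) + ln (real m + 1)" using T_pos unfolding 1 by simp
    then have "exp (2 * (lev m)\<^sup>2 * T) = exp (ln (real m + 1) + ln (real m + 1))" by (simp only:)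
    also have "\<dots> = (real m + 1)\<^sup>2" by (subst exp_add) (simp add: power2_eq_square)
    finally have 3: "exp (2 * (lev m)\<^sup>2 * T) = (real m + 1)\<^sup>2" .
    show ?thesis unfolding \<rho>_def 3 unfolding 2 1 using T_pos by (simp add: power2_eq_square)
  qed
  have "(\<lambda>m. D_max\<^sup>2 * ((ln (real m + 1))\<^sup>2 * (real m + 1)\<^sup>2 / 2 ^ m)) \<longlonglongrightarrow> D_max\<^sup>2 * 0"
    by (intro tendsto_mult tendsto_const) real_asymp
  moreover have "\<rho> = (\<lambda>m. D_max\<^sup>2 * ((ln (real m + 1))\<^sup>2 * (real m + 1)\<^sup>2 / 2 ^ m))"
    by (rule ext) (rule \<rho>_eq)
  ultimately show ?thesis by simp
qed

lemma E_adapted: "t \<in> {0..T} \<Longrightarrow> E m t \<in> borel_measurable (F t)"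
  unfolding E_def using L_adapted[of t m] by simp

lemma min_min_grid: "min (min t (grid m j)) (grid m i) = min t (grid m (min i j))"
  using grid_mono[of i j m] grid_mono[of j i m] by (cases "i \<le> j") (auto simp: min_def)

lemma E_stopped:
  assumes "j \<le> 2 ^ m"
  shows "E m (min t (grid m j)) \<omega> = exp (\<Sum>i<j. hs m i \<omega> * (B (min t (grid m (Suc i))) \<omega> - B (min t (grid m i)) \<omega>)
    - (hs m i \<omega>)\<^sup>2 * (min t (grid m (Suc i)) - min t (grid m i)) / 2)"
proof -
  have 1: "J m (min t (grid m j)) \<omega> = (\<Sum>i<j. hs m i \<omega> * (B (min t (grid m (Suc i))) \<omega> - B (min t (grid m i)) \<omega>))"
    unfolding J_def by (rule sum_stopped[OF assms, where b = "\<lambda>s. B s \<omega>"]) (rule min_min_grid)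
  have 2: "Q m (min t (grid m j)) \<omega> = (\<Sum>i<j. (hs m i \<omega>)\<^sup>2 * (min t (grid m (Suc i)) - min t (grid m i)))"
    unfolding Q_def by (rule sum_stopped[OF assms, where b = "\<lambda>s. s"]) (rule min_min_grid)
  show ?thesis unfolding E_def L_def 1 2 by (simp add: sum_subtractf sum_divide_distrib)
qed

lemma E_Suc:
  assumes "i < 2 ^ m"
  shows "E m (min t (grid m (Suc i))) \<omega> = E m (min t (grid m i)) \<omega> *
    exp_increment (min t (grid m (Suc i)) - min t (grid m i)) (hs m i \<omega>) (B (min t (grid m (Suc i))) \<omega> - B (min t (grid m i)) \<omega>)"
  using E_stopped[of "Suc i" m t \<omega>] E_stopped[of i m t \<omega>] assms by (simp add: exp_increment_def exp_add[symmetric])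

lemma N_measurable:
  assumes t: "t \<in> {0..T}"
  shows "N m t \<in> borel_measurable M"
  unfolding N_def
proof (rule borel_measurable_sum)
  fix i :: nat assume i: "i \<in> {..<2 ^ m}"
  have 1: "hs m i \<in> borel_measurable M"
    by (rule measurable_F_M[OF hs_adapted grid_in]) (use i in simp_all)
  have 2: "B (min t (grid m k)) \<in> borel_measurable M" for k
    by (rule measurable_F_M[OF B_adapted[OF min_grid_in[OF t]] min_grid_in[OF t]])
  have 3: "E m (min t (grid m i)) \<in> borel_measurable M"
    by (rule measurable_F_M[OF E_adapted[OF min_grid_in[OF t]] min_grid_in[OF t]])
  note [measurable] = 1 2[of i] 2[of "Suc i"] 3
  show "(\<lambda>\<omega>. D (min t (grid m i)) * E m (min t (grid m i)) \<omega> *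
     exp_residual (min t (grid m (Suc i)) - min t (grid m i)) (hs m i \<omega>) (B (min t (grid m (Suc i))) \<omega> - B (min t (grid m i)) \<omega>)) \<in> borel_measurable M"
    unfolding exp_residual_def exp_increment_def by measurable
qed

lemma N_second_moment:
  assumes t: "t \<in> {0..T}"
  shows "(\<integral>\<^sup>+\<omega>. ennreal ((N m t \<omega>)\<^sup>2) \<partial>M) \<le> ennreal (\<rho> m)"
proof -
  define u where "u i = min t (grid m i)" for i
  \<comment> \<open>On a degenerate interval \<open>hs m i\<close> need not be measurable at the stopped time \<open>u i\<close>.\<close>
  define k where "k i \<omega> = (if u i < u (Suc i) then hs m i \<omega> else 0)" for i \<omega>
  have u_mono: "u i \<le> u (Suc i)" for i using grid_mono[of i "Suc i" m] by (auto simp: u_def)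
  have degenerate: "u (Suc i) = u i" if "\<not> u i < u (Suc i)" for i using u_mono[of i] that by simp
  have k_adapted: "k i \<in> borel_measurable (F (u i))" if "i < 2 ^ m" for i
  proof (cases "u i < u (Suc i)")
    case True
    then have "u i = grid m i" by (auto simp: u_def min_def split: if_splits)
    moreover have "k i = hs m i" using True by (intro ext) (simp add: k_def)
    ultimately show ?thesis using hs_adapted[of i m] that by simp
  next
    case False
    then have "k i = (\<lambda>_. 0)" by (intro ext) (simp add: k_def)
    then show ?thesis by simp
  qed
  have *: "(\<integral>\<^sup>+\<omega>. ennreal ((\<Sum>i<2 ^ m. D (u i) * exp (\<Sum>i<i. k i \<omega> * (B (u (Suc i)) \<omega> - B (u i) \<omega>) - (k i \<omega>)\<^sup>2 * (u (Suc i) - u i) / 2) *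
      exp_residual (u (Suc i) - u i) (k i \<omega>) (B (u (Suc i)) \<omega> - B (u i) \<omega>))\<^sup>2) \<partial>M)
    \<le> ennreal (D_max\<^sup>2 * lev m ^ 4 * exp (2 * (lev m)\<^sup>2 * T) * T * (T / 2 ^ m))"
  proof (rule nn_integral_square_residual_sum_le)
    show "0 \<le> u 0" "u (2 ^ m) \<le> T" using t by (auto simp: u_def)
    show "\<bar>k i \<omega>\<bar> \<le> lev m" for i \<omega> using hs_le lev_nonneg by (simp add: k_def)
    show "\<bar>D (u i)\<bar> \<le> D_max" for i
      using D_le[OF min_grid_in[OF t, of m i]] D_pos[of "u i"] by (simp add: u_def)
    show "u (Suc i) - u i \<le> T / 2 ^ m" for i
    proof -
      have "u (Suc i) - u i \<le> grid m (Suc i) - grid m i"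
        using grid_mono[of i "Suc i" m] by (auto simp: u_def min_def)
      then show ?thesis by (simp add: grid_Suc)
    qed
    show "u i \<le> u (Suc i)" for i by (rule u_mono)
    show "k i \<in> borel_measurable (F (u i))" if "i < 2 ^ m" for i by (rule k_adapted[OF that])
  qed
  have k_term: "k i \<omega> * (B (u (Suc i)) \<omega> - B (u i) \<omega>) = hs m i \<omega> * (B (u (Suc i)) \<omega> - B (u i) \<omega>)"
    "(k i \<omega>)\<^sup>2 * (u (Suc i) - u i) = (hs m i \<omega>)\<^sup>2 * (u (Suc i) - u i)" for i \<omega>
    using degenerate[of i] by (cases "u i < u (Suc i)"; simp add: k_def)+
  have 1: "exp (\<Sum>i<j. k i \<omega> * (B (u (Suc i)) \<omega> - B (u i) \<omega>) - (k i \<omega>)\<^sup>2 * (u (Suc i) - u i) / 2) = E m (u j) \<omega>" if "j \<le> 2 ^ m" for j \<omega>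
    unfolding k_term using E_stopped[OF that, of t \<omega>, folded u_def] by simp
  have 2: "exp_residual (u (Suc i) - u i) (k i \<omega>) (B (u (Suc i)) \<omega> - B (u i) \<omega>) = exp_residual (u (Suc i) - u i) (hs m i \<omega>) (B (u (Suc i)) \<omega> - B (u i) \<omega>)" for i \<omega>
    unfolding exp_residual_def exp_increment_def k_term ..
  have "N m t \<omega> = (\<Sum>i<2 ^ m. D (u i) * exp (\<Sum>i<i. k i \<omega> * (B (u (Suc i)) \<omega> - B (u i) \<omega>) - (k i \<omega>)\<^sup>2 * (u (Suc i) - u i) / 2) *
      exp_residual (u (Suc i) - u i) (k i \<omega>) (B (u (Suc i)) \<omega> - B (u i) \<omega>))" for \<omega>
    unfolding N_def u_def[symmetric] by (intro sum.cong refl) (simp add: 1 2)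
  then show ?thesis using * by (simp add: \<rho>_def)
qed

text \<open>The discrete substitute for Ito's formula, exact on every path. By \<open>E_Suc\<close>
  a step multiplies \<open>E\<close> by \<open>1 + hs * dB\<close> plus the residual, and the
  increment of \<open>D * E\<close> splits into a step of \<open>E\<close> weighted by the left
  value of \<open>D\<close> and a step of \<open>D\<close> weighted by the right value of
  \<open>E\<close>. The products telescope.\<close>

lemma stopped_sum_identity:
  assumes t: "t \<in> {0..T}"
  shows "(\<Sum>i<2 ^ m. D (grid m i) * E m (grid m i) \<omega> * hs m i \<omega> * (B (min t (grid m (Suc i))) \<omega> - B (min t (grid m i)) \<omega>))
    = D t * E m t \<omega> - w0
      - (\<Sum>i<2 ^ m. (D (min t (grid m (Suc i))) - D (min t (grid m i))) * E m (min t (grid m (Suc i))) \<omega>) - N m t \<omega>"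
proof -
  define u where "u i = min t (grid m i)" for i
  have term_eq: "D (grid m i) * E m (grid m i) \<omega> * hs m i \<omega> * (B (u (Suc i)) \<omega> - B (u i) \<omega>)
      = (D (u (Suc i)) * E m (u (Suc i)) \<omega> - D (u i) * E m (u i) \<omega>) - (D (u (Suc i)) - D (u i)) * E m (u (Suc i)) \<omega>
        - D (u i) * E m (u i) \<omega> * exp_residual (u (Suc i) - u i) (hs m i \<omega>) (B (u (Suc i)) \<omega> - B (u i) \<omega>)"
    if i: "i < 2 ^ m" for i
  proof (cases "grid m i \<le> t")
    case True
    then have "grid m i = u i" by (simp add: u_def)
    then show ?thesis
      using E_Suc[OF i, of t \<omega>, folded u_def] by (simp add: exp_residual_def algebra_simps)
  next
    \<comment> \<open>Beyond \<open>t\<close> the unstopped coefficient on the left meets a zero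
      increment, and every term on the right is 0 as well.\<close>
    case False
    then have "u (Suc i) = t" "u i = t" using grid_mono[of i "Suc i" m] by (auto simp: u_def)
    then show ?thesis by (simp add: exp_residual_def exp_increment_def)
  qed
  have ends: "u 0 = 0" "u (2 ^ m) = t" using t by (auto simp: u_def)
  have E0: "E m 0 \<omega> = 1" using E_stopped[of 0 m 0 \<omega>] by simp
  have "(\<Sum>i<2 ^ m. D (grid m i) * E m (grid m i) \<omega> * hs m i \<omega> * (B (u (Suc i)) \<omega> - B (u i) \<omega>))
    = (\<Sum>i<2 ^ m. D (u (Suc i)) * E m (u (Suc i)) \<omega> - D (u i) * E m (u i) \<omega>) - (\<Sum>i<2 ^ m. (D (u (Suc i)) - D (u i)) * E m (u (Suc i)) \<omega>) - N m t \<omega>"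
    unfolding N_def u_def[symmetric] sum_subtractf[symmetric] by (intro sum.cong refl) (simp add: term_eq)
  also have "(\<Sum>i<2 ^ m. D (u (Suc i)) * E m (u (Suc i)) \<omega> - D (u i) * E m (u i) \<omega>) = D t * E m t \<omega> - w0"
    using sum_lessThan_telescope[of "\<lambda>i. D (u i) * E m (u i) \<omega>" "2 ^ m"] by (simp add: ends E0)
  finally show ?thesis by (simp add: u_def)
qed

lemma V_simple: "simple_process M F T (2 ^ m, grid m, V j m)"
proof -
  have "V j m i \<in> borel_measurable (F (grid m i))" if "i < 2 ^ m" for i
  proof -
    have i: "i \<le> 2 ^ m" using that by simp
    note [measurable] = E_adapted[OF grid_in[OF i], of m] hs_adapted[OF i]
    show ?thesis unfolding V_def by measurable
  qed
  moreover have "bounded (V j m i ` space M)" if "i < 2 ^ m" for i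
    unfolding bounded_real
  proof (intro exI ballI)
    fix x assume "x \<in> V j m i ` space M"
    then obtain \<omega> where x: "x = V j m i \<omega>" by blast
    show "\<bar>x\<bar> \<le> D (grid m i) * real j * lev m"
      unfolding x V_def abs_mult using D_pos[of "grid m i"] lev_nonneg
      by (intro mult_mono hs_le abs_clip_le) auto
  qed
  ultimately show ?thesis by (simp add: grid_mono)
qed

text \<open>Step processes live on left-open cells, hence the ceiling minus one: a grid point
  belongs to the cell that it closes.\<close>

definition cell :: "nat \<Rightarrow> real \<Rightarrow> nat" where
  "cell m s = nat (\<lceil>s * 2 ^ m / T\<rceil> - 1)"

lemma cell:
  assumes "s \<in> {0<..T}"
  shows "cell m s < 2 ^ m" "s \<in> {grid m (cell m s)<..grid m (Suc (cell m s))}"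
proof -
  define y where "y = s * 2 ^ m / T"
  have y: "0 < y" "y \<le> 2 ^ m" using assms T_pos by (auto simp: y_def field_simps)
  have c: "real (cell m s) < y" "y \<le> real (cell m s) + 1"
    using y unfolding cell_def y_def[symmetric] by linarith+
  have "real (cell m s) < 2 ^ m" using c(1) y(2) by linarith
  then show "cell m s < 2 ^ m" by simp
  show "s \<in> {grid m (cell m s)<..grid m (Suc (cell m s))}"
    using c T_pos by (simp add: grid_def y_def field_simps)
qed

text \<open>Time 0 lies in no left-open cell and is excluded; a single time is a null set for the
  integrals that follow.\<close>

lemma step_value_cell:
  assumes s: "s \<in> {0<..T}"
  shows "step_value (2 ^ m, grid m, \<xi>) s \<omega> = \<xi> (cell m s) \<omega>"
proof -
  have "s \<in> {grid m i<..grid m (Suc i)} \<longleftrightarrow> i = cell m s" for i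
  proof
    assume i: "s \<in> {grid m i<..grid m (Suc i)}"
    note c = cell(2)[OF s, of m]
    have "\<not> Suc i \<le> cell m s"
    proof
      assume "Suc i \<le> cell m s"
      from grid_mono[OF this, of m] i c show False by simp
    qed
    moreover have "\<not> Suc (cell m s) \<le> i"
    proof
      assume "Suc (cell m s) \<le> i"
      from grid_mono[OF this, of m] i c show False by simp
    qed
    ultimately show "i = cell m s" by simp
  qed (use cell(2)[OF s, of m] in simp)
  then have "step_value (2 ^ m, grid m, \<xi>) s \<omega> = (\<Sum>i<2 ^ m. if i = cell m s then \<xi> i \<omega> else 0)"
    by (simp add: indicator_def if_distrib cong: sum.cong)
  then show ?thesis using cell(1)[OF s, of m] by (simp add: sum.delta)
qed

end

subsection \<open>Solution of the linear equation\<close>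

lemma bounded_continuous_image_interval:
  fixes f :: "real \<Rightarrow> real"
  assumes "continuous_on {a..b} f"
  shows "bounded (f ` {a..b})"
  using compact_continuous_image[OF assms compact_Icc] by (rule compact_imp_bounded)

context linear_sde
begin

section \<open>Limits along one fixed path\<close>

context
  fixes \<kappa> :: "nat \<Rightarrow> nat" and y :: "real \<Rightarrow> real" and \<omega> :: 'a
  assumes \<omega>: "\<omega> \<in> space M" and \<kappa>: "\<And>j. j \<le> \<kappa> j" and y: "continuous_on {0..T} y"
    and L_lim: "uniform_limit {0..T} (\<lambda>j t. L (\<kappa> j) t \<omega>) y sequentially"
begin

lemma E_lim: "uniform_limit {0..T} (\<lambda>j t. E (\<kappa> j) t \<omega>) (\<lambda>t. exp (y t)) sequentially"
  unfolding E_def by (rule uniform_limit_exp[OF L_lim bounded_continuous_image_interval[OF y]])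

lemma mesh_lim: "(\<lambda>j. T / 2 ^ \<kappa> j) \<longlonglongrightarrow> 0"
proof (rule Lim_null_comparison)
  have "T / 2 ^ \<kappa> j \<le> T / 2 ^ j" for j
    by (rule divide_left_mono[OF power_increasing[OF \<kappa>]]) (use T_pos in simp_all)
  then show "eventually (\<lambda>j. norm (T / 2 ^ \<kappa> j) \<le> T / 2 ^ j) sequentially"
    using T_pos by simp
  show "(\<lambda>j. T / 2 ^ j) \<longlonglongrightarrow> 0" by real_asymp
qed

text \<open>Both truncations become inactive: \<open>lev (\<kappa> j)\<close> outgrows the path of
  \<open>h\<close>, and \<open>j\<close> outgrows \<open>K + 1\<close>, where \<open>K\<close>
  bounds the limit of \<open>E\<close> and 1 bounds the uniform error.\<close>

lemma eventually_unclipped: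
  "eventually (\<lambda>j. \<forall>i\<le>2 ^ \<kappa> j. hs (\<kappa> j) i \<omega> = h (grid (\<kappa> j) i) \<omega> \<and>
    V j (\<kappa> j) i \<omega> = D (grid (\<kappa> j) i) * E (\<kappa> j) (grid (\<kappa> j) i) \<omega> * h (grid (\<kappa> j) i) \<omega>) sequentially"
proof -
  have "filterlim \<kappa> sequentially sequentially"
    using \<kappa> by (intro filterlim_at_top_mono[OF filterlim_ident]) simp
  then have "eventually (\<lambda>j. \<omega> \<notin> bad (\<kappa> j) 1) sequentially"
    by (rule eventually_compose_filterlim[OF eventually_not_bad[OF \<omega> zero_less_one]])
  moreover have "bounded ((\<lambda>t. exp (y t)) ` {0..T})" by (intro bounded_continuous_image_interval continuous_intros y)
  then obtain K where K: "\<And>t. t \<in> {0..T} \<Longrightarrow> \<bar>exp (y t)\<bar> \<le> K" unfolding bounded_real by blast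
  have "eventually (\<lambda>j. \<forall>t\<in>{0..T}. dist (E (\<kappa> j) t \<omega>) (exp (y t)) < 1) sequentially"
    by (rule uniform_limitD[OF E_lim zero_less_one])
  moreover have "eventually (\<lambda>j. K + 1 \<le> real j) sequentially"
    by (rule eventually_sequentiallyI[of "nat \<lceil>K + 1\<rceil>"]) linarith
  ultimately show ?thesis
  proof eventually_elim
    case (elim j)
    show ?case
    proof (intro allI impI)
      fix i :: nat assume i: "i \<le> 2 ^ \<kappa> j"
      have hs: "hs (\<kappa> j) i \<omega> = h (grid (\<kappa> j) i) \<omega>" by (rule not_badD(1)[OF \<omega> elim(1) order_refl i])
      have "\<bar>E (\<kappa> j) (grid (\<kappa> j) i) \<omega>\<bar> \<le> K + 1"
        using bspec[OF elim(2) grid_in[OF i]] K[OF grid_in[OF i]] unfolding dist_real_def by linarith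
      then have "clip (real j) (E (\<kappa> j) (grid (\<kappa> j) i) \<omega>) = E (\<kappa> j) (grid (\<kappa> j) i) \<omega>"
        using elim(3) by (intro clip_eq) simp
      then show "hs (\<kappa> j) i \<omega> = h (grid (\<kappa> j) i) \<omega> \<and>
          V j (\<kappa> j) i \<omega> = D (grid (\<kappa> j) i) * E (\<kappa> j) (grid (\<kappa> j) i) \<omega> * h (grid (\<kappa> j) i) \<omega>"
        by (simp add: V_def hs)
    qed
  qed
qed

text \<open>For large \<open>j\<close> the step process at \<open>s\<close> is the product of
  \<open>D\<close>, \<open>E\<close> and \<open>h\<close> at the left end of the cell of
  \<open>s\<close>, which is within one mesh of \<open>s\<close>.\<close>

lemma step_value_lim:
  "uniform_limit {0<..T} (\<lambda>j s. step_value (2 ^ \<kappa> j, grid (\<kappa> j), V j (\<kappa> j)) s \<omega>) (\<lambda>s. D s * exp (y s) * h s \<omega>) sequentially"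
proof -
  have "uniform_limit {0..T} (\<lambda>j t. D t * E (\<kappa> j) t \<omega> * h t \<omega>) (\<lambda>t. D t * exp (y t) * h t \<omega>) sequentially"
    by (intro uniform_lim_mult uniform_limit_const E_lim bounded_continuous_image_interval continuous_intros D_continuous h_continuous \<omega> y)
  moreover have "uniformly_continuous_on {0..T} (\<lambda>t. D t * exp (y t) * h t \<omega>)"
    by (intro compact_uniformly_continuous continuous_intros D_continuous h_continuous \<omega> y) simp
  moreover have "grid (\<kappa> j) (cell (\<kappa> j) s) \<in> {0..T}" if "s \<in> {0<..T}" for j s
    using cell(1)[OF that, of "\<kappa> j"] by (intro grid_in) simp
  moreover have "\<bar>grid (\<kappa> j) (cell (\<kappa> j) s) - s\<bar> \<le> T / 2 ^ \<kappa> j" if "s \<in> {0<..T}" for j s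
    using cell(2)[OF that, of "\<kappa> j"] grid_Suc[of "\<kappa> j" "cell (\<kappa> j) s"] by (simp add: abs_le_iff)
  ultimately have *: "uniform_limit {0<..T} (\<lambda>j s. D (grid (\<kappa> j) (cell (\<kappa> j) s)) * E (\<kappa> j) (grid (\<kappa> j) (cell (\<kappa> j) s)) \<omega>
      * h (grid (\<kappa> j) (cell (\<kappa> j) s)) \<omega>) (\<lambda>s. D s * exp (y s) * h s \<omega>) sequentially"
    by (rule uniform_limit_nearby[where p = "\<lambda>j s. grid (\<kappa> j) (cell (\<kappa> j) s)", OF _ _ _ _ _ mesh_lim]) auto
  show ?thesis
  proof (rule uniform_limitI)
    fix e :: real assume "0 < e"
    from uniform_limitD[OF * this] eventually_unclipped
    show "eventually (\<lambda>j. \<forall>s\<in>{0<..T}. dist (step_value (2 ^ \<kappa> j, grid (\<kappa> j), V j (\<kappa> j)) s \<omega>) (D s * exp (y s) * h s \<omega>) < e) sequentially"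
    proof eventually_elim
      case (elim j)
      show ?case
      proof
        fix s assume s: "s \<in> {0<..T}"
        have c: "cell (\<kappa> j) s \<le> 2 ^ \<kappa> j" using cell(1)[OF s, of "\<kappa> j"] by simp
        show "dist (step_value (2 ^ \<kappa> j, grid (\<kappa> j), V j (\<kappa> j)) s \<omega>) (D s * exp (y s) * h s \<omega>) < e"
          unfolding step_value_cell[OF s] using bspec[OF elim(1) s] elim(2) c by simp
      qed
    qed
  qed
qed

lemma drift_sum_lim:
  assumes t: "t \<in> {0..T}"
  shows "(\<lambda>j. \<Sum>i<2 ^ \<kappa> j. (D (min t (grid (\<kappa> j) (Suc i))) - D (min t (grid (\<kappa> j) i))) * E (\<kappa> j) (min t (grid (\<kappa> j) (Suc i))) \<omega>)
    \<longlonglongrightarrow> integral {0..t} (\<lambda>s. r * D s * exp (y s))"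
proof (rule LIMSEQ_I)
  fix e :: real assume e: "0 < e"
  define C where "C = \<bar>r\<bar> * D_max"
  have C: "\<bar>r * D s\<bar> \<le> C" if "s \<in> {0..T}" for s
    using D_le[OF that] D_pos[of s] by (simp add: C_def abs_mult mult_left_mono)
  have C0: "0 \<le> C" using C[OF t] by linarith
  \<comment> \<open>The summand 1 keeps the denominator positive when \<open>r = 0\<close>. Half of
    \<epsilon> goes to the error of \<open>E\<close>, the other half to the modulus of continuity of
    its limit.\<close>
  define \<epsilon> where "\<epsilon> = e / (2 * (C * T + 1))"
  have CT: "0 < C * T + 1" using C0 T_pos by (intro add_nonneg_pos) auto
  have \<epsilon>: "0 < \<epsilon>" "C * \<epsilon> * T < e"
  proof -
    show "0 < \<epsilon>" using e CT by (simp add: \<epsilon>_def)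
    have "C * \<epsilon> * T = (C * T) / (C * T + 1) * (e / 2)" by (simp add: \<epsilon>_def field_simps)
    also have "\<dots> \<le> 1 * (e / 2)" using CT e by (intro mult_right_mono) auto
    finally show "C * \<epsilon> * T < e" using e by simp
  qed
  have uc: "uniformly_continuous_on {0..T} (\<lambda>t. exp (y t))"
    by (intro compact_uniformly_continuous continuous_intros y) simp
  obtain d where d: "0 < d" "\<And>x x'. x \<in> {0..T} \<Longrightarrow> x' \<in> {0..T} \<Longrightarrow> dist x' x < d \<Longrightarrow> dist (exp (y x')) (exp (y x)) < \<epsilon> / 2"
    using uc \<epsilon>(1) unfolding uniformly_continuous_on_def by (meson half_gt_zero)
  have "eventually (\<lambda>j. T / 2 ^ \<kappa> j < d) sequentially" by (rule order_tendstoD(2)[OF mesh_lim d(1)])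
  moreover have "eventually (\<lambda>j. \<forall>t\<in>{0..T}. dist (E (\<kappa> j) t \<omega>) (exp (y t)) < \<epsilon> / 2) sequentially"
    using \<epsilon>(1) by (intro uniform_limitD[OF E_lim]) simp
  ultimately have "eventually (\<lambda>j. norm ((\<Sum>i<2 ^ \<kappa> j. (D (min t (grid (\<kappa> j) (Suc i))) - D (min t (grid (\<kappa> j) i))) * E (\<kappa> j) (min t (grid (\<kappa> j) (Suc i))) \<omega>)
    - integral {0..t} (\<lambda>s. r * D s * exp (y s))) < e) sequentially"
  proof eventually_elim
    case (elim j)
    define u where "u i = min t (grid (\<kappa> j) i)" for i
    have ends: "u 0 = 0" "u (2 ^ \<kappa> j) = t" using t by (auto simp: u_def)
    have u_mono: "u i \<le> u (Suc i)" for i using grid_mono[of i "Suc i" "\<kappa> j"] by (auto simp: u_def)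
    have "\<bar>(\<Sum>i<2 ^ \<kappa> j. (D (u (Suc i)) - D (u i)) * E (\<kappa> j) (u (Suc i)) \<omega>) - integral {u 0..u (2 ^ \<kappa> j)} (\<lambda>s. r * D s * exp (y s))\<bar>
        \<le> C * \<epsilon> * (u (2 ^ \<kappa> j) - u 0)"
    proof (rule Stieltjes_sum_integral_le)
      show "continuous_on UNIV (\<lambda>s. r * D s)" by (intro continuous_intros D_continuous)
      show "\<bar>r * D x\<bar> \<le> C" if "x \<in> {u 0..u (2 ^ \<kappa> j)}" for x using C[of x] that t ends by simp
      show "continuous_on {u 0..u (2 ^ \<kappa> j)} (\<lambda>s. exp (y s))"
        unfolding ends using t by (intro continuous_intros continuous_on_subset[OF y]) auto
      fix i s assume s: "s \<in> {u i..u (Suc i)}"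
      have uT: "u (Suc i) \<in> {0..T}" "u i \<in> {0..T}" unfolding u_def by (intro min_grid_in t)+
      then have sT: "s \<in> {0..T}" using s by auto
      have "u (Suc i) - u i \<le> grid (\<kappa> j) (Suc i) - grid (\<kappa> j) i"
        using grid_mono[of i "Suc i" "\<kappa> j"] by (auto simp: u_def min_def)
      then have "dist (u (Suc i)) s < d" using s elim(1) unfolding grid_Suc by (simp add: dist_real_def)
      then have "dist (exp (y (u (Suc i)))) (exp (y s)) < \<epsilon> / 2" by (rule d(2)[OF sT uT(1)])
      moreover have "dist (E (\<kappa> j) (u (Suc i)) \<omega>) (exp (y (u (Suc i)))) < \<epsilon> / 2" using elim(2) uT(1) by blast
      ultimately show "\<bar>E (\<kappa> j) (u (Suc i)) \<omega> - exp (y s)\<bar> \<le> \<epsilon>" unfolding dist_real_def by linarith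
    qed (use u_mono D_deriv in simp_all)
    also have "\<dots> \<le> C * \<epsilon> * T" using ends t C0 \<epsilon>(1) by (simp add: mult_left_mono)
    also have "\<dots> < e" by (rule \<epsilon>(2))
    finally show ?case unfolding ends by (simp add: u_def)
  qed
  then show "\<exists>n0. \<forall>n\<ge>n0. norm ((\<Sum>i<2 ^ \<kappa> n. (D (min t (grid (\<kappa> n) (Suc i))) - D (min t (grid (\<kappa> n) i))) * E (\<kappa> n) (min t (grid (\<kappa> n) (Suc i))) \<omega>)
    - integral {0..t} (\<lambda>s. r * D s * exp (y s))) < e"
    by (simp add: eventually_sequentially)
qed

text \<open>Every term of the discrete product rule converges, and
  \<open>eventually_unclipped\<close> identifies its left side with the elementary integral of
  \<open>V\<close>.\<close>

lemma step_integral_lim: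
  assumes t: "t \<in> {0..T}" and N: "(\<lambda>j. N (\<kappa> j) t \<omega>) \<longlonglongrightarrow> 0"
  shows "(\<lambda>j. step_integral B (2 ^ \<kappa> j, grid (\<kappa> j), V j (\<kappa> j)) t \<omega>)
    \<longlonglongrightarrow> D t * exp (y t) - w0 - integral {0..t} (\<lambda>s. r * D s * exp (y s))"
proof -
  have "(\<lambda>j. D t * E (\<kappa> j) t \<omega> - w0
      - (\<Sum>i<2 ^ \<kappa> j. (D (min t (grid (\<kappa> j) (Suc i))) - D (min t (grid (\<kappa> j) i))) * E (\<kappa> j) (min t (grid (\<kappa> j) (Suc i))) \<omega>)
      - N (\<kappa> j) t \<omega>) \<longlonglongrightarrow> D t * exp (y t) - w0 - integral {0..t} (\<lambda>s. r * D s * exp (y s)) - 0"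
    by (intro tendsto_diff tendsto_mult tendsto_const drift_sum_lim[OF t] N tendsto_uniform_limitI[OF E_lim t])
  moreover have "eventually (\<lambda>j. D t * E (\<kappa> j) t \<omega> - w0
      - (\<Sum>i<2 ^ \<kappa> j. (D (min t (grid (\<kappa> j) (Suc i))) - D (min t (grid (\<kappa> j) i))) * E (\<kappa> j) (min t (grid (\<kappa> j) (Suc i))) \<omega>)
      - N (\<kappa> j) t \<omega> = step_integral B (2 ^ \<kappa> j, grid (\<kappa> j), V j (\<kappa> j)) t \<omega>) sequentially"
    using eventually_unclipped
  proof eventually_elim
    case (elim j)
    then show ?case
      unfolding stopped_sum_identity[OF t, symmetric] by (auto intro!: sum.cong)
  qed
  ultimately show ?thesis by (simp add: tendsto_cong)
qed

end

lemma solution_exists: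
  obtains W I where "continuous_adapted M F T W" "\<And>t \<omega>. 0 < W t \<omega>"
    "ito_integral M F T B (\<lambda>t \<omega>. W t \<omega> * h t \<omega>) I"
    "\<And>t \<omega>. W t \<omega> = w0 + (\<integral>s\<in>{0..t}. W s \<omega> * r \<partial>lborel) + I t \<omega>"
proof -
  obtain \<kappa> Y where \<kappa>: "\<And>j. j \<le> \<kappa> j" "\<And>j. \<rho> (\<kappa> j) \<le> (1 / 2) ^ j" and Y: "continuous_adapted M F T Y"
    and lim: "AE \<omega> in M. uniform_limit {0..T} (\<lambda>j t. L (\<kappa> j) t \<omega>) (\<lambda>t. Y t \<omega>) sequentially"
    by (rule log_limit_exists[OF \<rho>_tendsto]) blast
  have Y_cont: "continuous_on {0..T} (\<lambda>t. Y t \<omega>)" if "\<omega> \<in> space M" for \<omega>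
    using Y that by (simp add: continuous_adapted_def)
  define W where "W t \<omega> = D t * exp (Y t \<omega>)" for t \<omega>
  define I where "I t \<omega> = W t \<omega> - w0 - (\<integral>s\<in>{0..t}. W s \<omega> * r \<partial>lborel)" for t \<omega>
  define P where "P j = (2 ^ \<kappa> j :: nat, grid (\<kappa> j), V j (\<kappa> j))" for j
  have W: "continuous_adapted M F T W"
    unfolding continuous_adapted_def
  proof (intro conjI ballI)
    fix t assume "t \<in> {0..T}"
    then have [measurable]: "Y t \<in> borel_measurable (F t)" using Y by (simp add: continuous_adapted_def)
    show "W t \<in> borel_measurable (F t)" unfolding W_def by measurable
  next
    fix \<omega> assume "\<omega> \<in> space M"
    then show "continuous_on {0..T} (\<lambda>t. W t \<omega>)"
      unfolding W_def by (intro continuous_intros D_continuous Y_cont)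
  qed
  have mult: "continuous_adapted M F T (\<lambda>t \<omega>. Z1 t \<omega> * Z2 t \<omega>)" if "continuous_adapted M F T Z1" "continuous_adapted M F T Z2" for Z1 Z2
    using that unfolding continuous_adapted_def by (auto intro!: borel_measurable_times continuous_on_mult)
  have Wr: "continuous_adapted M F T (\<lambda>t \<omega>. W t \<omega> * r)"
    using W unfolding continuous_adapted_def by (auto intro!: continuous_on_mult_right)
  have I: "continuous_adapted M F T I"
    using W continuous_adapted_integral[OF Wr] unfolding continuous_adapted_def I_def
    by (auto intro!: continuous_on_diff borel_measurable_diff)
  have I_eq: "I t \<omega> = D t * exp (Y t \<omega>) - w0 - integral {0..t} (\<lambda>s. r * D s * exp (Y s \<omega>))" if "t \<in> {0..T}" "\<omega> \<in> space M" for t \<omega>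
  proof -
    have "continuous_on {0..t} (\<lambda>s. W s \<omega> * r)"
      using Wr that by (auto simp: continuous_adapted_def intro: continuous_on_subset)
    then have "(\<integral>s\<in>{0..t}. W s \<omega> * r \<partial>lborel) = integral {0..t} (\<lambda>s. W s \<omega> * r)"
      by (intro set_borel_integral_eq_integral borel_integrable_atLeastAtMost')
    then show ?thesis by (simp add: I_def W_def ac_simps)
  qed
  have Wh: "continuous_adapted M F T (\<lambda>t \<omega>. W t \<omega> * h t \<omega>)" by (rule mult[OF W h])
  have sq_int: "AE \<omega> in M. (\<integral>\<^sup>+s\<in>{0..T}. ennreal ((W s \<omega> * h s \<omega>)\<^sup>2) \<partial>lborel) < \<infinity>"
  proof (rule AE_I2)
    fix \<omega> assume "\<omega> \<in> space M"
    then have "continuous_on {0..T} (\<lambda>s. (W s \<omega> * h s \<omega>)\<^sup>2)"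
      using Wh by (auto simp: continuous_adapted_def intro: continuous_on_power)
    then have "set_integrable lborel {0..T} (\<lambda>s. (W s \<omega> * h s \<omega>)\<^sup>2)" by (rule borel_integrable_atLeastAtMost')
    then have "(\<integral>\<^sup>+s. ennreal (norm (indicator {0..T} s *\<^sub>R (W s \<omega> * h s \<omega>)\<^sup>2)) \<partial>lborel) < \<infinity>"
      unfolding set_integrable_def integrable_iff_bounded by blast
    also have "(\<integral>\<^sup>+s. ennreal (norm (indicator {0..T} s *\<^sub>R (W s \<omega> * h s \<omega>)\<^sup>2)) \<partial>lborel)
        = (\<integral>\<^sup>+s\<in>{0..T}. ennreal ((W s \<omega> * h s \<omega>)\<^sup>2) \<partial>lborel)"
      by (intro nn_integral_cong) (simp add: indicator_def)
    finally show "(\<integral>\<^sup>+s\<in>{0..T}. ennreal ((W s \<omega> * h s \<omega>)\<^sup>2) \<partial>lborel) < \<infinity>" .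
  qed
  have conv1: "(\<lambda>k. prob {\<omega>\<in>space M. (\<integral>\<^sup>+s\<in>{0..T}. ennreal ((step_value (P k) s \<omega> - W s \<omega> * h s \<omega>)\<^sup>2) \<partial>lborel) > ennreal \<epsilon>}) \<longlonglongrightarrow> 0"
    if "0 < \<epsilon>" for \<epsilon>
  proof (rule prob_tendsto_zero)
    \<comment> \<open>A uniform error \<delta> costs at most
      \<open>\<delta>\<^sup>2 * T = \<epsilon>\<close> in the square integral.\<close>
    define \<delta> where "\<delta> = sqrt (\<epsilon> / T)"
    have \<delta>: "0 < \<delta>" "\<delta>\<^sup>2 * T = \<epsilon>" using that T_pos by (simp_all add: \<delta>_def)
    show "AE \<omega> in M. eventually (\<lambda>k. \<omega> \<notin> {\<omega>\<in>space M. (\<integral>\<^sup>+s\<in>{0..T}. ennreal ((step_value (P k) s \<omega> - W s \<omega> * h s \<omega>)\<^sup>2) \<partial>lborel) > ennreal \<epsilon>}) sequentially"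
      using lim AE_space
    proof eventually_elim
      case (elim \<omega>)
      from uniform_limitD[OF step_value_lim[OF elim(2) \<kappa>(1) Y_cont[OF elim(2)] elim(1)] \<delta>(1)]
      show ?case
      proof eventually_elim
        case (elim k)
        have "(\<integral>\<^sup>+s\<in>{0..T}. ennreal ((step_value (P k) s \<omega> - W s \<omega> * h s \<omega>)\<^sup>2) \<partial>lborel)
            \<le> (\<integral>\<^sup>+s. ennreal (\<delta>\<^sup>2) * indicator {0..T} s \<partial>lborel)"
        proof (rule nn_integral_mono_AE)
          show "AE s in lborel. ennreal ((step_value (P k) s \<omega> - W s \<omega> * h s \<omega>)\<^sup>2) * indicator {0..T} s \<le> ennreal (\<delta>\<^sup>2) * indicator {0..T} s"
            using AE_lborel_singleton[of 0]
          proof eventually_elim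
            case s: (elim s)
            show ?case
            proof (cases "s \<in> {0..T}")
              case True
              then have "s \<in> {0<..T}" using s by auto
              from bspec[OF elim this] have "\<bar>step_value (P k) s \<omega> - W s \<omega> * h s \<omega>\<bar> \<le> \<delta>"
                unfolding dist_real_def P_def W_def by simp
              then have "(step_value (P k) s \<omega> - W s \<omega> * h s \<omega>)\<^sup>2 \<le> \<delta>\<^sup>2"
                using \<delta>(1) by (intro abs_le_square_iff[THEN iffD1]) simp
              then show ?thesis using True by (simp add: ennreal_leI)
            qed simp
          qed
        qed
        also have "\<dots> = ennreal \<epsilon>"
          using T_pos \<delta>(2) by (simp add: nn_integral_cmult_indicator ennreal_mult'[symmetric])
        finally show ?case by (simp add: not_less)
      qed
    qed
  qed
  have conv2: "(\<lambda>k. prob {\<omega>\<in>space M. \<bar>step_integral B (P k) t \<omega> - I t \<omega>\<bar> > \<epsilon>}) \<longlonglongrightarrow> 0"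
    if t: "t \<in> {0..T}" and "0 < \<epsilon>" for t \<epsilon>
  proof (rule prob_tendsto_zero)
    \<comment> \<open>Here the choice \<open>\<rho> (\<kappa> j) \<le> (1 / 2) ^ j\<close> pays off.
      The null set may depend on \<open>t\<close>, since \<open>ito_integral\<close> asks for the
      convergence of elementary integrals at each \<open>t\<close> separately.\<close>
    have "AE \<omega> in M. (\<lambda>j. N (\<kappa> j) t \<omega>) \<longlonglongrightarrow> 0"
      by (rule AE_tendsto_zero_second_moment[OF N_measurable[OF t] order_trans[OF N_second_moment[OF t] ennreal_leI[OF \<kappa>(2)]]])
    then show "AE \<omega> in M. eventually (\<lambda>k. \<omega> \<notin> {\<omega>\<in>space M. \<bar>step_integral B (P k) t \<omega> - I t \<omega>\<bar> > \<epsilon>}) sequentially"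
      using lim AE_space
    proof eventually_elim
      case (elim \<omega>)
      have "(\<lambda>k. step_integral B (P k) t \<omega>) \<longlonglongrightarrow> I t \<omega>"
        unfolding P_def I_eq[OF t elim(3)]
        by (rule step_integral_lim[OF elim(3) \<kappa>(1) Y_cont[OF elim(3)] elim(2) t elim(1)])
      from tendstoD[OF this \<open>0 < \<epsilon>\<close>] show ?case
        by eventually_elim (simp add: dist_real_def)
    qed
  qed
  show thesis
  proof (rule that)
    show "continuous_adapted M F T W" by (rule W)
    show "0 < W t \<omega>" for t \<omega> by (simp add: W_def D_pos)
    show "W t \<omega> = w0 + (\<integral>s\<in>{0..t}. W s \<omega> * r \<partial>lborel) + I t \<omega>" for t \<omega> by (simp add: I_def)
    have "simple_process M F T (P k)" for k unfolding P_def by (rule V_simple)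
    then show "ito_integral M F T B (\<lambda>t \<omega>. W t \<omega> * h t \<omega>) I"
      unfolding ito_integral_def
      by (intro conjI exI[of _ P] allI impI ballI continuous_adapted_imp_progressive[OF Wh] sq_int I conv1 conv2)
  qed
qed

end

subsection \<open>Uniform densities and the objective\<close>

text \<open>For the stock noise, whose coefficient vanishes with the mean of the control; a process
  with no steps approximates 0 exactly.\<close>

lemma (in linear_sde) ito_integral_zero: "ito_integral M F T Z (\<lambda>_ _. 0) (\<lambda>_ _. 0)"
  unfolding ito_integral_def
proof (intro conjI exI[of _ "\<lambda>_. (0, \<lambda>_. 0, \<lambda>_ _. 0)"] allI impI ballI)
  show "continuous_adapted M F T (\<lambda>_ _. 0)" by (simp add: continuous_adapted_def)
  then show "progressive F T (\<lambda>_ _. 0)" by (rule continuous_adapted_imp_progressive)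
qed (use T_pos in \<open>simp_all add: not_less\<close>)

text \<open>A mean of 0 removes both the excess return and the stock noise, here \<open>Z\<close>;
  the Brownian motion \<open>B\<close> of the locale is the randomization noise, with coefficient
  \<open>h\<close>.\<close>

lemma (in linear_sde) wealth_exists:
  assumes Mean: "\<And>t \<omega>. Mean (\<pi> t \<omega>) = 0" and h_eq: "\<And>t \<omega>. \<sigma> t (X t \<omega>) * sqrt (Var (\<pi> t \<omega>)) = h t \<omega>"
    and sq: "\<And>t \<omega>. integrable (density_measure (\<pi> t \<omega>)) (\<lambda>a. a\<^sup>2)"
  shows "\<exists>W. wealth_equation M F T r \<mu> \<sigma> Z B X w0 \<pi> W"
proof -
  obtain W I where W: "continuous_adapted M F T W" "\<And>t \<omega>. 0 < W t \<omega>"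
    and I: "ito_integral M F T B (\<lambda>t \<omega>. W t \<omega> * h t \<omega>) I"
    and eq: "\<And>t \<omega>. W t \<omega> = w0 + (\<integral>s\<in>{0..t}. W s \<omega> * r \<partial>lborel) + I t \<omega>"
    by (rule solution_exists) (rule that; assumption)
  have Wr: "continuous_adapted M F T (\<lambda>t \<omega>. W t \<omega> * r)"
    using W(1) unfolding continuous_adapted_def by (auto intro!: continuous_on_mult_right)
  let ?HBs = "[(\<lambda>t \<omega>. W t \<omega> * 0, Z), (\<lambda>t \<omega>. W t \<omega> * h t \<omega>, B)]"
  have "ito_sde M F T w0 (\<lambda>t \<omega>. W t \<omega> * r) ?HBs W"
    unfolding ito_sde_def
  proof (intro conjI exI[of _ "\<lambda>i. if i = 0 then (\<lambda>_ _. 0) else I"] allI impI)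
    show "AE \<omega> in M. set_integrable lborel {0..T} (\<lambda>s. W s \<omega> * r)"
      using Wr by (intro AE_I2 borel_integrable_atLeastAtMost') (simp add: continuous_adapted_def)
    fix i assume "i < length ?HBs"
    then consider "i = 0" | "i = 1" by fastforce
    then show "ito_integral M F T (snd (?HBs ! i)) (fst (?HBs ! i)) (if i = 0 then \<lambda>_ _. 0 else I)"
      by cases (simp_all add: ito_integral_zero I)
  next
    show "AE \<omega> in M. \<forall>t\<in>{0..T}. W t \<omega> = w0 + (\<integral>s\<in>{0..t}. W s \<omega> * r \<partial>lborel)
        + (\<Sum>i<length ?HBs. (if i = 0 then \<lambda>_ _. 0 else I) t \<omega>)"
      by (intro AE_I2 ballI, subst eq) (simp add: numeral_2_eq_2)
  qed (use W(1) continuous_adapted_imp_progressive[OF Wr] in simp_all)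
  then show ?thesis
    using W(2) sq by (intro exI[of _ W]) (simp add: wealth_equation_def return_sde_def Mean h_eq)
qed

definition uniform_density :: "real \<Rightarrow> real \<Rightarrow> real" where
  "uniform_density A a = indicator {- A..A} a / (2 * A)"

lemma borel_measurable_uniform_density [measurable]: "uniform_density A \<in> borel_measurable borel"
  unfolding uniform_density_def[abs_def] by measurable

context
  fixes A :: real
  assumes A: "1 / 2 < A"
begin

lemma probability_density_uniform: "probability_density (uniform_density A)"
proof -
  have "emeasure (density_measure (uniform_density A)) (space (density_measure (uniform_density A)))
      = (\<integral>\<^sup>+a. ennreal (1 / (2 * A)) * indicator {- A..A} a \<partial>lborel)"
    unfolding density_measure_def
    by (subst emeasure_density) (auto intro!: nn_integral_cong simp: uniform_density_def indicator_def)
  also have "\<dots> = 1" using A by (simp add: nn_integral_cmult_indicator ennreal_mult'[symmetric])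
  finally have "prob_space (density_measure (uniform_density A))" by (rule prob_spaceI)
  then show ?thesis
    using A by (simp add: probability_density_def borel_measurable_uniform_density) (simp add: uniform_density_def)
qed

lemma integrable_uniform_square: "integrable (density_measure (uniform_density A)) (\<lambda>a. a\<^sup>2)"
proof -
  have "set_integrable lborel {- A..A} (\<lambda>a. a\<^sup>2 / (2 * A))"
    by (intro borel_integrable_atLeastAtMost' continuous_intros) (use A in auto)
  moreover have "indicator {- A..A} a *\<^sub>R (a\<^sup>2 / (2 * A)) = uniform_density A a *\<^sub>R a\<^sup>2" for a
    by (simp add: uniform_density_def)
  ultimately have "integrable lborel (\<lambda>a. uniform_density A a *\<^sub>R a\<^sup>2)"
    by (simp add: set_integrable_def)
  then show ?thesis
    unfolding density_measure_def using probability_density_uniform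
    by (subst integrable_density) (auto simp: probability_density_def)
qed

text \<open>The density is even, so substituting \<open>- a\<close> for \<open>a\<close> shows that
  the mean equals its own negative.\<close>

lemma Mean_uniform: "Mean (uniform_density A) = 0"
proof -
  have "Mean (uniform_density A) = (\<integral>a. uniform_density A a * a \<partial>lborel)"
    unfolding Mean_def density_measure_def using probability_density_uniform
    by (subst integral_density) (auto simp: probability_density_def)
  also have "\<dots> = (\<integral>a. uniform_density A (- a) * (- a) \<partial>lborel)"
    using lborel_integral_real_affine[of "-1" "\<lambda>a. uniform_density A a * a" 0] by simp
  also have "\<dots> = - (\<integral>a. uniform_density A a * a \<partial>lborel)"
  proof -
    have "uniform_density A (- a) = uniform_density A a" for a
      by (auto simp: uniform_density_def indicator_def)
    then show ?thesis by simp
  qed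
  finally show ?thesis
    unfolding Mean_def density_measure_def using probability_density_uniform
    by (subst (asm) integral_density) (auto simp: probability_density_def integral_density)
qed

text \<open>As \<open>2 * A > 1\<close>, the integrand is a nonnegative constant on the interval and
  0 elsewhere, so its negative part contributes nothing.\<close>

lemma entropy_uniform:
  shows "quasi_integrable lborel (entropy_integrand (uniform_density A))"
    and "differential_entropy (uniform_density A) = ereal (ln (2 * A))"
proof -
  define c where "c = ln (2 * A) / (2 * A)"
  have c: "0 \<le> c" using A by (simp add: c_def)
  have eq: "entropy_integrand (uniform_density A) = (\<lambda>a. ereal (c * indicator {- A..A} a))"
    using A by (auto simp: fun_eq_iff entropy_integrand_def uniform_density_def c_def indicator_def ln_div)
  have pos: "(\<integral>\<^sup>+a. e2ennreal (entropy_integrand (uniform_density A) a) \<partial>lborel) = ennreal (ln (2 * A))"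
  proof -
    have "(\<integral>\<^sup>+a. e2ennreal (entropy_integrand (uniform_density A) a) \<partial>lborel)
        = (\<integral>\<^sup>+a. ennreal c * indicator {- A..A} a \<partial>lborel)"
      unfolding eq by (intro nn_integral_cong) (auto simp: indicator_def ennreal_def)
    also have "\<dots> = ennreal (c * (2 * A))"
      using A c by (simp add: nn_integral_cmult_indicator ennreal_mult'[symmetric])
    finally show ?thesis using A by (simp add: c_def)
  qed
  have neg: "(\<integral>\<^sup>+a. e2ennreal (- entropy_integrand (uniform_density A) a) \<partial>lborel) = 0"
  proof -
    have "e2ennreal (- entropy_integrand (uniform_density A) a) = 0" for a
      unfolding eq using c by (auto simp: indicator_def ennreal_neg)
    then show ?thesis by simp
  qed
  show "quasi_integrable lborel (entropy_integrand (uniform_density A))"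
    unfolding quasi_integrable_def pos by (simp add: eq)
  show "differential_entropy (uniform_density A) = ereal (ln (2 * A))"
    unfolding differential_entropy_def ereal_integral_def pos neg using A by (simp add: enn2ereal_ennreal zero_ennreal.rep_eq)
qed

end

lemma ereal_integral_const_interval:
  assumes "0 \<le> c" "0 \<le> T"
  shows "quasi_integrable (restrict_space lborel {0..T}) (\<lambda>_. ereal c)"
    and "ereal_integral (restrict_space lborel {0..T}) (\<lambda>_. ereal c) = ereal (c * T)"
proof -
  have pos: "(\<integral>\<^sup>+s. e2ennreal (ereal c) \<partial>restrict_space lborel {0..T}) = ennreal (c * T)"
    using assms by (simp add: emeasure_restrict_space space_restrict_space ennreal_mult'[symmetric])
  have neg: "e2ennreal (- ereal c) = 0" using assms by (intro e2ennreal_neg) simp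
  show "quasi_integrable (restrict_space lborel {0..T}) (\<lambda>_. ereal c)"
    unfolding quasi_integrable_def pos by simp
  show "ereal_integral (restrict_space lborel {0..T}) (\<lambda>_. ereal c) = ereal (c * T)"
    unfolding ereal_integral_def pos neg using assms by (simp add: enn2ereal_ennreal zero_ennreal.rep_eq)
qed

text \<open>A nonnegative lower bound removes the negative part; this makes the payoff
  quasi-integrable without any estimate of the upper tail of terminal wealth.\<close>

lemma (in prob_space) ereal_integral_ge:
  assumes f: "f \<in> borel_measurable M" and le: "\<And>\<omega>. \<omega> \<in> space M \<Longrightarrow> c \<le> f \<omega>" and "0 \<le> c"
  shows "quasi_integrable M (\<lambda>\<omega>. ereal (f \<omega>))" and "ereal c \<le> ereal_integral M (\<lambda>\<omega>. ereal (f \<omega>))"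
proof -
  have neg: "(\<integral>\<^sup>+\<omega>. e2ennreal (- ereal (f \<omega>)) \<partial>M) = 0"
  proof -
    have "(\<integral>\<^sup>+\<omega>. e2ennreal (- ereal (f \<omega>)) \<partial>M) = (\<integral>\<^sup>+\<omega>. 0 \<partial>M)"
      using le \<open>0 \<le> c\<close> by (intro nn_integral_cong) (fastforce intro: ennreal_neg order_trans)
    then show ?thesis by simp
  qed
  show "quasi_integrable M (\<lambda>\<omega>. ereal (f \<omega>))"
    unfolding quasi_integrable_def neg using f by simp
  have "ennreal c = (\<integral>\<^sup>+\<omega>. ennreal c \<partial>M)" by (simp add: emeasure_space_1)
  also have "\<dots> \<le> (\<integral>\<^sup>+\<omega>. e2ennreal (ereal (f \<omega>)) \<partial>M)"
  proof (rule nn_integral_mono)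
    fix \<omega> assume "\<omega> \<in> space M"
    then show "ennreal c \<le> e2ennreal (ereal (f \<omega>))" using le[of \<omega>] by (simp add: ennreal_leI)
  qed
  finally have "enn2ereal (ennreal c) \<le> enn2ereal (\<integral>\<^sup>+\<omega>. e2ennreal (ereal (f \<omega>)) \<partial>M)"
    by (simp add: less_eq_ennreal.rep_eq)
  then show "ereal c \<le> ereal_integral M (\<lambda>\<omega>. ereal (f \<omega>))"
    unfolding ereal_integral_def neg using \<open>0 \<le> c\<close> by (simp add: enn2ereal_ennreal zero_ennreal.rep_eq)
qed

theorem proposition1:
  fixes M :: "'a measure" and F :: "real \<Rightarrow> 'a measure"
    and B Bt Bb X S :: "'a process"
    and T r \<rho> x0 s0 w0 \<gamma> lam :: real
    and \<mu> \<sigma> m \<nu> :: "real \<Rightarrow> real \<Rightarrow> real"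
  assumes "market T \<rho> \<mu> \<sigma> m \<nu> x0 s0 M F B Bt Bb X S"
    and "0 < \<gamma>" and "\<gamma> < 1" and "0 < lam" and "0 < w0"
  shows "(SUP \<pi>\<in>{\<pi>. randomized_control M F T r \<mu> \<sigma> B Bt Bb X w0 \<gamma> lam \<pi>}.
            objective M F T r \<mu> \<sigma> B Bb X w0 \<gamma> lam \<pi>) = \<infinity>"
proof -
  have T: "0 < T" and \<sigma>: "continuous_on ({0..T} \<times> UNIV) (\<lambda>(t, x). \<sigma> t x)"
    and weak: "weak_solution T \<rho> \<mu> \<sigma> m \<nu> x0 s0 M F B Bt X S"
    and Bb: "brownian_motion M F T Bb"
    using assms(1) by (auto simp: market_def independent_brownian_motions_def)
  have "prob_space M" and usual: "usual_conditions M F T" and X: "continuous_adapted M F T X"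
    using weak by (auto simp: weak_solution_def ito_sde_def)
  interpret brownian_setting M F T Bb
    by (intro brownian_setting.intro brownian_setting_axioms.intro \<open>prob_space M\<close> usual Bb T)
  \<comment> \<open>The factor \<open>c\<close> will be the standard deviation of the uniform
    density.\<close>
  have \<sigma>X: "continuous_adapted M F T (\<lambda>t \<omega>. \<sigma> t (X t \<omega>) * c)" for c
    unfolding continuous_adapted_def
  proof (intro conjI ballI)
    fix t assume t: "t \<in> {0..T}"
    have "continuous_on UNIV (\<lambda>x. (\<lambda>(t, x). \<sigma> t x) (t, x))"
      by (rule continuous_on_compose2[OF \<sigma>]) (use t in \<open>auto intro!: continuous_intros\<close>)
    then have "\<sigma> t \<in> borel_measurable borel" by (intro borel_measurable_continuous_onI) simp
    moreover have "X t \<in> borel_measurable (F t)" using X t by (simp add: continuous_adapted_def)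
    ultimately have "(\<lambda>\<omega>. \<sigma> t (X t \<omega>)) \<in> borel_measurable (F t)" by (rule measurable_compose[rotated])
    then show "(\<lambda>\<omega>. \<sigma> t (X t \<omega>) * c) \<in> borel_measurable (F t)"
      by (rule borel_measurable_times[OF _ borel_measurable_const])
  next
    fix \<omega> assume "\<omega> \<in> space M"
    then have "continuous_on {0..T} (\<lambda>t. X t \<omega>)" using X by (simp add: continuous_adapted_def)
    then have "continuous_on {0..T} (\<lambda>t. (\<lambda>(t, x). \<sigma> t x) (t, X t \<omega>))"
      by (rule continuous_on_compose2[OF \<sigma> continuous_on_Pair[OF continuous_on_id]]) auto
    then show "continuous_on {0..T} (\<lambda>t. \<sigma> t (X t \<omega>) * c)"
      by (intro continuous_on_mult_right) simp
  qed
  have "\<exists>\<pi>. randomized_control M F T r \<mu> \<sigma> B Bt Bb X w0 \<gamma> lam \<pi> \<and>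
      ereal c \<le> objective M F T r \<mu> \<sigma> B Bb X w0 \<gamma> lam \<pi>" if c: "0 < c" for c
  proof -
    \<comment> \<open>Solves \<open>lam * k * T - 1 / (1 - \<gamma>) = c\<close>: an entropy of
      \<open>k\<close> held over \<open>[0, T]\<close> exceeds the largest possible loss of utility
      by \<open>c\<close>. The interval of length \<open>2 * A = exp k\<close> has this
      entropy.\<close>
    define k where "k = (c + 1 / (1 - \<gamma>)) / (lam * T)"
    have k: "0 < k" using c T \<open>\<gamma> < 1\<close> \<open>0 < lam\<close> by (simp add: k_def add_pos_pos)
    have k_eq: "lam * k * T = c + 1 / (1 - \<gamma>)" using T \<open>0 < lam\<close> by (simp add: k_def)
    define A where "A = exp k / 2"
    have A: "1 / 2 < A" and ln_A: "ln (2 * A) = k" using k by (simp_all add: A_def)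
    define \<pi> :: "'a control" where "\<pi> t \<omega> = uniform_density A" for t \<omega>
    define h where "h t \<omega> = \<sigma> t (X t \<omega>) * sqrt (Var (uniform_density A))" for t \<omega>
    have "continuous_adapted M F T h" unfolding h_def by (rule \<sigma>X)
    interpret linear_sde M F T Bb h w0 r
      by unfold_locales (rule \<open>continuous_adapted M F T h\<close>, rule \<open>0 < w0\<close>)
    have ex: "\<exists>W. wealth_equation M F T r \<mu> \<sigma> B Bb X w0 \<pi> W"
      by (rule wealth_exists) (simp_all add: \<pi>_def h_def Mean_uniform[OF A] integrable_uniform_square[OF A])
    define W where "W = wealth M F T r \<mu> \<sigma> B Bb X w0 \<pi>"
    \<comment> \<open>\<open>wealth\<close> is an arbitrary choice among the solutions, which is
      harmless: measurability at \<open>T\<close> follows from the equation, and the lower bound on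
      utility holds for any terminal value because \<open>powr\<close> is nonnegative.\<close>
    have "wealth_equation M F T r \<mu> \<sigma> B Bb X w0 \<pi> W"
      unfolding W_def wealth_def by (rule someI_ex[OF ex])
    then have "continuous_adapted M F T W" by (simp add: wealth_equation_def return_sde_def ito_sde_def)
    then have "W T \<in> borel_measurable (F T)" using T by (simp add: continuous_adapted_def)
    then have [measurable]: "W T \<in> borel_measurable M" by (rule measurable_F_M) (use T in simp)
    define f where "f \<omega> = lam * k * T + power_utility \<gamma> (W T \<omega>)" for \<omega>
    have f: "f \<in> borel_measurable M" unfolding f_def power_utility_def by measurable
    have f_ge: "c \<le> f \<omega>" for \<omega>
    proof -
      have "- 1 / (1 - \<gamma>) \<le> power_utility \<gamma> (W T \<omega>)"
        unfolding power_utility_def using \<open>\<gamma> < 1\<close> by (intro divide_right_mono) auto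
      then show ?thesis by (simp add: f_def k_eq)
    qed
    have entropy: "ereal lam * differential_entropy (\<pi> s \<omega>) = ereal (lam * k)" for s \<omega>
      by (simp add: \<pi>_def entropy_uniform(2)[OF A] ln_A)
    have lk: "0 \<le> lam * k" "0 \<le> T" using k T \<open>0 < lam\<close> by simp_all
    have payoff: "payoff T \<gamma> lam \<pi> W = (\<lambda>\<omega>. ereal (f \<omega>))"
      by (rule ext) (simp add: payoff_def entropy ereal_integral_const_interval(2)[OF lk] f_def)
    have "well_defined_payoff M T \<gamma> lam \<pi> W"
      unfolding well_defined_payoff_def entropy payoff
      using entropy_uniform(1)[OF A] ereal_integral_const_interval(1)[OF lk] ereal_integral_ge(1)[OF f f_ge] c
      by (simp add: \<pi>_def)
    \<comment> \<open>The control is constant in time and in the sample point, so measurability into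
      \<open>prob_algebra\<close> reduces to membership in its space.\<close>
    moreover have "density_measure (uniform_density A) \<in> space (prob_algebra borel)"
      using probability_density_uniform[OF A]
      by (simp add: space_prob_algebra probability_density_def) (simp add: density_measure_def)
    ultimately have "randomized_control M F T r \<mu> \<sigma> B Bt Bb X w0 \<gamma> lam \<pi>"
      unfolding randomized_control_def W_def[symmetric]
      using ex probability_density_uniform[OF A] by (simp add: \<pi>_def)
    moreover have "ereal c \<le> objective M F T r \<mu> \<sigma> B Bb X w0 \<gamma> lam \<pi>"
      unfolding objective_def W_def[symmetric] payoff using c by (intro ereal_integral_ge(2) f f_ge) simp
    ultimately show ?thesis by blast
  qed
  then have le: "ereal c \<le> (SUP \<pi>\<in>{\<pi>. randomized_control M F T r \<mu> \<sigma> B Bt Bb X w0 \<gamma> lam \<pi>}.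
      objective M F T r \<mu> \<sigma> B Bb X w0 \<gamma> lam \<pi>)" if "0 < c" for c
    using that by (blast intro: SUP_upper2)
  show ?thesis
  proof (rule ereal_top)
    fix b :: real
    \<comment> \<open>The estimate is available at positive levels, hence
      \<open>max b 1\<close>.\<close>
    have "ereal b \<le> ereal (max b 1)" by simp
    also note le[of "max b 1"]
    finally show "ereal b \<le> (SUP \<pi>\<in>{\<pi>. randomized_control M F T r \<mu> \<sigma> B Bt Bb X w0 \<gamma> lam \<pi>}.
      objective M F T r \<mu> \<sigma> B Bb X w0 \<gamma> lam \<pi>)" by simp
  qed
qed

end
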